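(* Let $w$ be a word over the alphabet $\{a,b\}$. The relation $\vdash^*_{\{w\}}$ is a well quasi-order on $L^{\epsilon}_{\vdash_{\{w\}}}$ if and only if $w$ is good.
   Context: For a word $u$ and a letter $c$, $|u|_c$ is the number of occurrences of $c$ in $u$. For words $u,v$, the shuffle $u \sqcup\!\sqcup v$ is the set of all words $u_1v_1u_2v_2\cdots u_kv_k$ with $k\ge 1$, $u=u_1\cdots u_k$, $v=v_1\cdots v_k$ (the $u_i,v_i$ possibly empty). For a finite set $I$ of words, $v \vdash_I w$ means $w \in v \sqcup\!\sqcup u$ for some $u\in I$; $\vdash_I^*$ is the reflexive and transitive closure of $\vdash_I$, and $L^{\epsilon}_{\vdash_I}=\{w : \epsilon \vdash_I^* w\}$, where $\epsilon$ is the empty word. A quasi-order $\le$ on a set $S$ is a well quasi-order (wqo) iff for every infinite sequence $s_1,s_2,\dots$ of elements of $S$ there are $i<j$ with $s_i\le s_j$. Let $E$ be the morphism exchanging $a$ and $b$, and $\tilde w$ the mirror image (reversal) of $w$. A word $w$ over $\{a,b\}$ is bad if one of $w,\tilde w,E(w),E(\tilde w)$ has a factor of the form $a^kb^h$ with $k,h\ge 2$, or of the form $a^kba^lb^m$ with $k>l\ge 1$, $m\ge1$; $w$ is good if it is not bad. *)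

theory Defs
  imports Main "HOL-Library.Sublist"
begin

datatype letter = a | b

definition shuffle :: "letter list \<Rightarrow> letter list \<Rightarrow> letter list set" where
  "shuffle u v = shuffles u v"

definition step :: "letter list set \<Rightarrow> letter list \<Rightarrow> letter list \<Rightarrow> bool" where
  "step I v w \<longleftrightarrow> (\<exists>u\<in>I. w \<in> shuffle v u)"

definition derives :: "letter list set \<Rightarrow> letter list \<Rightarrow> letter list \<Rightarrow> bool" where
  "derives I = (step I)\<^sup>*\<^sup>*"

definition lang_eps :: "letter list set \<Rightarrow> letter list set" where
  "lang_eps I = {w. derives I [] w}"

definition wqo_on :: "('x \<Rightarrow> 'x \<Rightarrow> bool) \<Rightarrow> 'x set \<Rightarrow> bool" where
  "wqo_on R S \<longleftrightarrow> (\<forall>f::nat \<Rightarrow> 'x. (\<forall>i. f i \<in> S) \<longrightarrow> (\<exists>i j. i < j \<and> R (f i) (f j)))"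

fun exch :: "letter \<Rightarrow> letter" where
  "exch a = b" | "exch b = a"

definition E :: "letter list \<Rightarrow> letter list" where
  "E w = map exch w"

definition has_bad_factor :: "letter list \<Rightarrow> bool" where
  "has_bad_factor w \<longleftrightarrow>
     (\<exists>k h. k \<ge> 2 \<and> h \<ge> 2 \<and> sublist (replicate k a @ replicate h b) w) \<or>
     (\<exists>k l m. k > l \<and> l \<ge> 1 \<and> m \<ge> 1 \<and>
        sublist (replicate k a @ [b] @ replicate l a @ replicate m b) w)"

definition bad :: "letter list \<Rightarrow> bool" where
  "bad w \<longleftrightarrow> has_bad_factor w \<or> has_bad_factor (rev w) \<or>
              has_bad_factor (E w) \<or> has_bad_factor (E (rev w))"

definition good :: "letter list \<Rightarrow> bool" where
  "good w \<longleftrightarrow> \<not> bad w"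

end

theory Submission
  imports Defs "HOL-Library.Ramsey"
begin

text \<open>
  A word is derived from \<open>u\<close> iff it is a shuffle of \<open>u\<close> and finitely many copies of \<open>w\<close>.

  Up to exchange of the letters, the good words are the powers of \<open>a\<close> and the words
  \<open>a\<^sup>i (b a\<^sup>n)\<^sup>M b a\<^sup>j\<close> with \<open>i, j \<le> n\<close>. For these, the shuffles of \<open>k\<close> copies are
  exactly the paths in the \<open>(|p|\<^sub>b, |p|\<^sub>a)\<close>-plane that stay in a hexagon which is scaled by \<open>k\<close>. If \<open>k\<close>
  is large, such a path can be cut into a bounded number of pieces, each of which is close to at
  most one side of the hexagon. Paths above a line are well quasi-ordered by removing a path
  above the line through the origin with the same slope, by a minimal bad sequence argument on the
  first return to the line; applying this to all pieces simultaneously gives the well quasi-order.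

  If \<open>w\<close> has a bad factor, take its maximal runs to get \<open>w = x F y\<close>. Repeating each letter of \<open>x\<close>
  and \<open>y\<close> \<open>k\<close> times around a shuffle of \<open>k\<close> copies of \<open>F\<close> reduces the problem to \<open>w = F\<close>. Count
  letters with the weights for which \<open>F\<close> has weight \<open>0\<close>, and split \<open>F = s r\<close> at a proper prefix of
  least positive weight. Some shuffle \<open>\<beta> \<noteq> F\<close> of \<open>r\<close> and \<open>s\<close> can be read repeatedly while one copy
  stays open; since \<open>\<beta>\<close> is not \<open>F\<close>, no copies can be removed from a power of \<open>\<beta>\<close> between two markers of
  large weight, which gives an infinite bad sequence.
\<close>

section \<open>Iterated shuffles\<close>

text \<open>The obstacle in the positive direction is that the removed path must respect a lower and
  an upper line at once, while the minimal bad sequence argument controls only one. Scale resolves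
  this. Where the hexagon has width at least \<open>k\<close>, a piece shorter than a fixed fraction
  of \<open>k\<close> keeps distance at least \<open>k / 4\<close> from one of the two lines, and
  that line costs nothing once the larger word uses so many more copies that all heights of the
  smaller word are negligible. The width falls below \<open>k\<close> only if \<open>i = 0\<close>
  or \<open>j = 0\<close>, and then one of the lines already follows from the letter counts.

  That the hexagon contains nothing but shuffles holds because an evenly spread copy can be peeled
  off so that the rest fits the hexagon of the other copies, and the hexagon of one copy contains a
  single path.

  In the negative direction the minimality of \<open>s\<close> gives the rigidity: a prefix of a
  shuffle of copies of \<open>F\<close> has weight 0 or at least that of \<open>s\<close>, so a
  total weight equal to that of \<open>s\<close> cannot be divided between the smaller word and the
  inserted copies.\<close>

lemma append_in_shuffles:
  "p \<in> shuffles x y \<Longrightarrow> q \<in> shuffles x' y' \<Longrightarrow> p @ q \<in> shuffles (x @ x') (y @ y')"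
proof (induction p arbitrary: x y)
  case Nil
  then show ?case by simp
next
  case (Cons c p)
  then show ?case
    by (auto simp: Cons_in_shuffles_iff)
qed

lemma append_in_shufflesE:
  assumes "p @ q \<in> shuffles x y"
  obtains x1 x2 y1 y2 where "x = x1 @ x2" "y = y1 @ y2" "p \<in> shuffles x1 y1" "q \<in> shuffles x2 y2"
  using assms
proof (induction p arbitrary: x y thesis)
  case Nil
  from Nil(1)[of "[]" x "[]" y] Nil(2) show ?case by simp
next
  case (Cons c p)
  from Cons.prems(2) consider x' where "x = c # x'" "p @ q \<in> shuffles x' y"
    | y' where "y = c # y'" "p @ q \<in> shuffles x y'"
    by (auto simp: Cons_in_shuffles_iff neq_Nil_conv)
  then show ?case
  proof cases
    case 1
    from Cons.IH[OF _ 1(2)] obtain x1 x2 y1 y2 where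
      "x' = x1 @ x2" "y = y1 @ y2" "p \<in> shuffles x1 y1" "q \<in> shuffles x2 y2" by metis
    then show ?thesis using 1 Cons.prems(1)[of "c # x1" x2 y1 y2]
      by (simp add: Cons_in_shuffles_leftI)
  next
    case 2
    from Cons.IH[OF _ 2(2)] obtain x1 x2 y1 y2 where
      "x = x1 @ x2" "y' = y1 @ y2" "p \<in> shuffles x1 y1" "q \<in> shuffles x2 y2" by metis
    then show ?thesis using 2 Cons.prems(1)[of x1 x2 "c # y1" y2]
      by (simp add: Cons_in_shuffles_rightI)
  qed
qed

text \<open>Cuts at a moment when exactly \<open>y1\<close> has been read from the second component,
  whereas \<open>append_in_shufflesE\<close> cuts the shuffled word at a prescribed place.\<close>

lemma shuffles_append_rightE:
  assumes "v \<in> shuffles x (y1 @ y2)"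
  obtains v1 v2 x1 x2 where "v = v1 @ v2" "x = x1 @ x2" "v1 \<in> shuffles x1 y1" "v2 \<in> shuffles x2 y2"
  using assms
proof (induction v arbitrary: x y1 thesis)
  case Nil
  from Nil(1)[of "[]" "[]" "[]" "[]"] Nil(2) show ?case by simp
next
  case (Cons c v)
  show ?case
  proof (cases "y1 = []")
    case True
    then show ?thesis using Cons.prems(1)[of "[]" "c # v" "[]" x] Cons.prems(2) by simp
  next
    case False
    with Cons.prems(2) consider x' where "x = c # x'" "v \<in> shuffles x' (y1 @ y2)"
      | y' where "y1 = c # y'" "v \<in> shuffles x (y' @ y2)"
      by (auto simp: Cons_in_shuffles_iff neq_Nil_conv)
    then show ?thesis
    proof cases
      case 1
      from Cons.IH[OF _ 1(2)] obtain v1 v2 x1 x2 where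
        "v = v1 @ v2" "x' = x1 @ x2" "v1 \<in> shuffles x1 y1" "v2 \<in> shuffles x2 y2" by metis
      then show ?thesis using 1 Cons.prems(1)[of "c # v1" v2 "c # x1" x2]
        by (simp add: Cons_in_shuffles_leftI)
    next
      case 2
      from Cons.IH[OF _ 2(2)] obtain v1 v2 x1 x2 where
        "v = v1 @ v2" "x = x1 @ x2" "v1 \<in> shuffles x1 y'" "v2 \<in> shuffles x2 y2" by metis
      then show ?thesis using 2 Cons.prems(1)[of "c # v1" v2 x1 x2]
        by (simp add: Cons_in_shuffles_rightI)
    qed
  qed
qed

lemma shuffles_assocE:
  assumes "v \<in> shuffles u z" "u \<in> shuffles x y"
  obtains t where "t \<in> shuffles y z" "v \<in> shuffles x t"
  using assms
proof (induction v arbitrary: u x y z thesis)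
  case Nil
  then show ?case by simp
next
  case (Cons c v)
  from Cons.prems(2) consider u' where "u = c # u'" "v \<in> shuffles u' z"
    | z' where "z = c # z'" "v \<in> shuffles u z'"
    by (auto simp: Cons_in_shuffles_iff neq_Nil_conv)
  then show ?case
  proof cases
    case 1
    with Cons.prems(3) consider x' where "x = c # x'" "u' \<in> shuffles x' y"
      | y' where "y = c # y'" "u' \<in> shuffles x y'"
      by (auto simp: Cons_in_shuffles_iff neq_Nil_conv)
    then show ?thesis
    proof cases
      case 11: 1
      then show ?thesis using Cons.IH[OF _ 1(2) 11(2)] Cons.prems(1)
        by (metis Cons_in_shuffles_leftI)
    next
      case 12: 2
      then show ?thesis using Cons.IH[OF _ 1(2) 12(2)] Cons.prems(1)
        by (metis Cons_in_shuffles_leftI Cons_in_shuffles_rightI)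
    qed
  next
    case 2
    then show ?thesis using Cons.IH[OF _ 2(2) Cons.prems(3)] Cons.prems(1)
      by (metis Cons_in_shuffles_rightI)
  qed
qed

lemma rev_in_shuffles: "z \<in> shuffles x y \<Longrightarrow> rev z \<in> shuffles (rev x) (rev y)"
proof (induction z arbitrary: x y)
  case Nil
  then show ?case by simp
next
  case (Cons c z)
  from Cons.prems consider x' where "x = c # x'" "z \<in> shuffles x' y"
    | y' where "y = c # y'" "z \<in> shuffles x y'"
    by (auto simp: Cons_in_shuffles_iff neq_Nil_conv)
  then show ?case
  proof cases
    case 1
    from append_in_shuffles[OF Cons.IH[OF 1(2)], of "[c]" "[c]" "[]"] 1 show ?thesis by simp
  next
    case 2
    from append_in_shuffles[OF Cons.IH[OF 2(2)], of "[c]" "[]" "[c]"] 2 show ?thesis by simp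
  qed
qed

lemma map_in_shuffles: "z \<in> shuffles x y \<Longrightarrow> map f z \<in> shuffles (map f x) (map f y)"
proof (induction z arbitrary: x y)
  case (Cons c z)
  then show ?case by (auto simp: Cons_in_shuffles_iff neq_Nil_conv)
qed simp

lemma count_list_shuffles:
  "z \<in> shuffles x y \<Longrightarrow> count_list z c = count_list x c + count_list y c"
proof (induction z arbitrary: x y)
  case (Cons c z)
  then show ?case by (auto simp: Cons_in_shuffles_iff neq_Nil_conv)
qed simp

lemma count_list_replicate [simp]: "count_list (replicate r c) d = (if c = d then r else 0)"
  by (induction r) auto

lemma prefix_replicateE:
  assumes "prefix p (replicate r c)"
  obtains s where "p = replicate s c" "s \<le> r"
proof
  show "p = replicate (length p) c" using set_mono_prefix[OF assms] by (intro replicate_eqI) auto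
  show "length p \<le> r" using prefix_length_le[OF assms] by simp
qed

primrec shuffle_power :: "'x list \<Rightarrow> nat \<Rightarrow> 'x list set" where
  "shuffle_power w 0 = {[]}"
| "shuffle_power w (Suc k) = (\<Union>y\<in>shuffle_power w k. shuffles y w)"

lemma shuffle_power_add:
  "v \<in> shuffles u z \<Longrightarrow> u \<in> shuffle_power w k \<Longrightarrow> z \<in> shuffle_power w l \<Longrightarrow>
    v \<in> shuffle_power w (k + l)"
proof (induction l arbitrary: z v)
  case (Suc l)
  then obtain y where y: "y \<in> shuffle_power w l" "z \<in> shuffles y w" by auto
  from Suc.prems(1) y(2) obtain t where "t \<in> shuffles u y" "v \<in> shuffles t w"
    by (metis shuffles_assocE shuffles_commutes)
  with Suc.IH[OF _ Suc.prems(2) y(1)] show ?case by auto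
qed simp

lemma length_shuffle_power: "x \<in> shuffle_power w k \<Longrightarrow> length x = k * length w"
  by (induction k arbitrary: x) (auto simp: length_shuffles)

lemma count_list_shuffle_power:
  "x \<in> shuffle_power w k \<Longrightarrow> count_list x c = k * count_list w c"
  by (induction k arbitrary: x) (auto simp: count_list_shuffles)

lemma derives_iff:
  "derives {w} u v \<longleftrightarrow> (\<exists>k. \<exists>z\<in>shuffle_power w k. v \<in> shuffles u z)"
proof
  assume "derives {w} u v"
  then have "(step {w})\<^sup>*\<^sup>* u v" by (simp add: derives_def)
  then show "\<exists>k. \<exists>z\<in>shuffle_power w k. v \<in> shuffles u z"
  proof induction
    case base
    have "[] \<in> shuffle_power w 0" "u \<in> shuffles u []" by auto
    then show ?case by blast
  next
    case (step y v)
    then obtain k z where z: "z \<in> shuffle_power w k" "y \<in> shuffles u z" by blast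
    from step(2) have "v \<in> shuffles y w" by (simp add: step_def shuffle_def)
    from shuffles_assocE[OF this z(2)] obtain t where "t \<in> shuffles z w" "v \<in> shuffles u t" .
    moreover from this z(1) have "t \<in> shuffle_power w (Suc k)" by auto
    ultimately show ?case by blast
  qed
next
  assume "\<exists>k. \<exists>z\<in>shuffle_power w k. v \<in> shuffles u z"
  then obtain k z where "z \<in> shuffle_power w k" "v \<in> shuffles u z" by blast
  then have "(step {w})\<^sup>*\<^sup>* u v"
  proof (induction k arbitrary: z v)
    case 0
    then show ?case by simp
  next
    case (Suc k)
    then obtain y where y: "y \<in> shuffle_power w k" "z \<in> shuffles y w" by auto
    from Suc.prems(2) y(2) obtain t where t: "t \<in> shuffles u y" "v \<in> shuffles t w"
      by (metis shuffles_assocE shuffles_commutes)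
    from t(2) have "step {w} t v" by (simp add: step_def shuffle_def)
    with Suc.IH[OF y(1) t(1)] show ?case by (rule rtranclp.rtrancl_into_rtrancl)
  qed
  then show "derives {w} u v" by (simp add: derives_def)
qed

lemma lang_eps_iff: "v \<in> lang_eps {w} \<longleftrightarrow> (\<exists>k. v \<in> shuffle_power w k)"
  by (simp add: lang_eps_def derives_iff)

lemma rev_shuffle_power: "x \<in> shuffle_power w k \<Longrightarrow> rev x \<in> shuffle_power (rev w) k"
  by (induction k arbitrary: x) (auto dest: rev_in_shuffles)

lemma map_shuffle_power: "x \<in> shuffle_power w k \<Longrightarrow> map f x \<in> shuffle_power (map f w) k"
  by (induction k arbitrary: x) (auto dest: map_in_shuffles)

lemma exch_exch [simp]: "exch (exch c) = c"
  by (cases c) auto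

lemma E_E [simp]: "E (E w) = w"
  by (simp add: E_def o_def)

lemma E_rev: "E (rev w) = rev (E w)"
  by (simp add: E_def rev_map)

lemma derives_rev: "derives {w} u v \<Longrightarrow> derives {rev w} (rev u) (rev v)"
  unfolding derives_iff by (blast intro: rev_in_shuffles rev_shuffle_power)

lemma derives_E: "derives {w} u v \<Longrightarrow> derives {E w} (E u) (E v)"
  unfolding derives_iff E_def by (blast intro: map_in_shuffles map_shuffle_power)

text \<open>The involution carries a sequence for \<open>f w\<close> to one for \<open>w\<close>,
  and the comparable pair found there back again.\<close>

lemma wqo_on_involution:
  assumes wqo: "wqo_on (derives {w}) (lang_eps {w})"
    and inv: "\<And>x. f (f x) = x" "f [] = []"
    and der: "\<And>w u v. derives {w} u v \<Longrightarrow> derives {f w} (f u) (f v)"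
  shows "wqo_on (derives {f w}) (lang_eps {f w})"
  unfolding wqo_on_def
proof (intro allI impI)
  fix g :: "nat \<Rightarrow> letter list"
  assume g: "\<forall>i. g i \<in> lang_eps {f w}"
  have "f (g i) \<in> lang_eps {w}" for i
    using g der[of "f w" "[]" "g i"] inv by (simp add: lang_eps_def)
  then have "\<exists>i j. i < j \<and> derives {w} (f (g i)) (f (g j))"
    using wqo[unfolded wqo_on_def, rule_format, of "\<lambda>i. f (g i)"] by blast
  then obtain i j where "i < j" "derives {w} (f (g i)) (f (g j))" by blast
  with der[of w] inv show "\<exists>i j. i < j \<and> derives {f w} (g i) (g j)"
    by metis
qed

lemma wqo_on_derives_rev:
  "wqo_on (derives {w}) (lang_eps {w}) \<Longrightarrow> wqo_on (derives {rev w}) (lang_eps {rev w})"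
  by (rule wqo_on_involution) (auto intro: derives_rev)

lemma wqo_on_derives_E:
  "wqo_on (derives {w}) (lang_eps {w}) \<Longrightarrow> wqo_on (derives {E w}) (lang_eps {E w})"
  by (rule wqo_on_involution) (auto intro: derives_E simp: E_def[of "[]"])

section \<open>Paths above a line\<close>

text \<open>A relation on the indices of a fixed sequence rather than on words, so that it may
  mention data attached to an index, such as the number of copies or the part read before.
  Quantifying over all subsequences makes the notion closed under conjunction.\<close>

definition almost_full :: "(nat \<Rightarrow> nat \<Rightarrow> bool) \<Rightarrow> bool" where
  "almost_full Q \<longleftrightarrow> (\<forall>\<phi>::nat \<Rightarrow> nat. strict_mono \<phi> \<longrightarrow> (\<exists>i j. i < j \<and> Q (\<phi> i) (\<phi> j)))"

lemma almost_full_mono: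
  "almost_full P \<Longrightarrow> (\<And>i j. i < j \<Longrightarrow> P i j \<Longrightarrow> Q i j) \<Longrightarrow> almost_full Q"
  unfolding almost_full_def by (meson strict_monoD)

text \<open>Ramsey's theorem yields an infinite index set on which all pairs satisfy
  \<open>Q\<close> or none does, and almost fullness excludes the latter.\<close>

lemma almost_full_subseq:
  assumes "almost_full Q" "strict_mono \<phi>"
  obtains \<psi> :: "nat \<Rightarrow> nat" where "strict_mono \<psi>" "\<And>i j. i < j \<Longrightarrow> Q (\<phi> (\<psi> i)) (\<phi> (\<psi> j))"
proof -
  \<comment> \<open>Ramsey's theorem colours unordered pairs; \<open>Min\<close> and
    \<open>Max\<close> recover which index comes first.\<close>
  define f where "f X = (if Q (\<phi> (Min X)) (\<phi> (Max X)) then 0 else (1::nat))" for X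
  have "\<forall>x\<in>(UNIV::nat set). \<forall>y\<in>UNIV. x \<noteq> y \<longrightarrow> f {x, y} < 2" by (simp add: f_def)
  from Ramsey2[OF infinite_UNIV_nat this] obtain Y t where
    Y: "infinite Y" "\<forall>x\<in>Y. \<forall>y\<in>Y. x \<noteq> y \<longrightarrow> f {x, y} = t" by blast
  define \<psi> where "\<psi> = enumerate Y"
  have sm: "strict_mono \<psi>" unfolding \<psi>_def by (rule strict_mono_enumerate[OF Y(1)])
  have inY: "\<psi> i \<in> Y" for i unfolding \<psi>_def by (rule enumerate_in_set[OF Y(1)])
  have Q: "Q (\<phi> (\<psi> i)) (\<phi> (\<psi> j)) \<longleftrightarrow> t = 0" if "i < j" for i j
  proof -
    have less: "\<psi> i < \<psi> j" using sm that by (rule strict_monoD)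
    then have "f {\<psi> i, \<psi> j} = t" using Y(2) inY by (metis less_irrefl)
    moreover have "Min {\<psi> i, \<psi> j} = \<psi> i" "Max {\<psi> i, \<psi> j} = \<psi> j" using less by simp_all
    ultimately show ?thesis unfolding f_def by (auto split: if_splits)
  qed
  have "strict_mono (\<lambda>i. \<phi> (\<psi> i))" using assms(2) sm by (simp add: strict_mono_def)
  with assms(1) obtain i j where "i < j" "Q (\<phi> (\<psi> i)) (\<phi> (\<psi> j))"
    unfolding almost_full_def by blast
  with Q have "t = 0" by blast
  with Q show thesis by (intro that[OF sm]) blast
qed

lemma almost_full_conj:
  assumes P: "almost_full P" and Q: "almost_full Q"
  shows "almost_full (\<lambda>i j. P i j \<and> Q i j)"
  unfolding almost_full_def
proof (intro allI impI)
  fix \<phi> :: "nat \<Rightarrow> nat" assume \<phi>: "strict_mono \<phi>"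
  from almost_full_subseq[OF P \<phi>] obtain \<psi> :: "nat \<Rightarrow> nat" where
    \<psi>: "strict_mono \<psi>" "\<And>i j. i < j \<Longrightarrow> P (\<phi> (\<psi> i)) (\<phi> (\<psi> j))" by blast
  with \<phi> have "strict_mono (\<lambda>i. \<phi> (\<psi> i))" by (simp add: strict_mono_def)
  with Q obtain i j where "i < j" "Q (\<phi> (\<psi> i)) (\<phi> (\<psi> j))"
    unfolding almost_full_def by blast
  moreover from this \<psi>(1) have "\<psi> i < \<psi> j" by (simp add: strict_monoD)
  ultimately show "\<exists>i j. i < j \<and> P (\<phi> i) (\<phi> j) \<and> Q (\<phi> i) (\<phi> j)"
    using \<psi>(2) by blast
qed

lemma almost_full_All_less:
  "(\<And>r. r < (n::nat) \<Longrightarrow> almost_full (P r)) \<Longrightarrow> almost_full (\<lambda>i j. \<forall>r<n. P r i j)"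
proof (induction n)
  case 0
  have "(0::nat) < 1" by simp
  then show ?case unfolding almost_full_def by blast
next
  case (Suc n)
  from almost_full_conj[OF Suc.IH Suc.prems[of n]] Suc.prems show ?case
    by (auto elim!: almost_full_mono simp: less_Suc_eq)
qed

lemma infinite_strict_mono:
  assumes "infinite (Y :: nat set)"
  obtains \<psi> :: "nat \<Rightarrow> nat" where "strict_mono \<psi>" "\<And>i. \<psi> i \<in> Y"
  using assms strict_mono_enumerate[OF assms] enumerate_in_set[OF assms] by blast

lemma finite_range_const_subseq:
  fixes c :: "nat \<Rightarrow> 't"
  assumes "finite (range c)"
  obtains \<psi> :: "nat \<Rightarrow> nat" and v where "strict_mono \<psi>" "\<And>i. c (\<psi> i) = v"
proof -
  from pigeonhole_infinite[OF infinite_UNIV_nat assms] obtain k where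
    "infinite {i. c i = c k}" by auto
  from infinite_strict_mono[OF this] obtain \<psi> :: "nat \<Rightarrow> nat" where
    "strict_mono \<psi>" "\<And>i. \<psi> i \<in> {i. c i = c k}" by blast
  then show thesis by (intro that[of \<psi> "c k"]) auto
qed

section \<open>Minimal bad sequences and decomposition into smaller components\<close>

lemma minimal_bad_sequence:
  fixes R :: "'x \<Rightarrow> 'x \<Rightarrow> bool" and \<mu> :: "'x \<Rightarrow> nat" and S :: "'x set"
  assumes f0: "\<And>i::nat. f0 i \<in> S" "\<And>i j. i < j \<Longrightarrow> \<not> R (f0 i) (f0 j)"
  obtains f :: "nat \<Rightarrow> 'x" where "\<And>i. f i \<in> S" "\<And>i j. i < j \<Longrightarrow> \<not> R (f i) (f j)"
    "\<And>g n. (\<And>i. g i \<in> S) \<Longrightarrow> (\<And>i j. i < j \<Longrightarrow> \<not> R (g i) (g j)) \<Longrightarrow> (\<And>i. i < n \<Longrightarrow> g i = f i)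
      \<Longrightarrow> \<mu> (f n) \<le> \<mu> (g n)"
proof -
  define seq where "seq g \<longleftrightarrow> (\<forall>i. g i \<in> S) \<and> (\<forall>i j. i < j \<longrightarrow> \<not> R (g i) (g j))" for g :: "nat \<Rightarrow> 'x"
  \<comment> \<open>A finite list is admissible if it begins some bad sequence. Choosing each next
    element of least measure among the admissible continuations never gets stuck, and the limit is
    bad because badness concerns two entries at a time.\<close>
  define ext where "ext xs \<longleftrightarrow> (\<exists>g. seq g \<and> (\<forall>i < length xs. g i = xs ! i))" for xs
  define nxt where "nxt xs = (ARG_MIN \<mu> x. ext (xs @ [x]))" for xs
  define L where "L = rec_nat [] (\<lambda>_ xs. xs @ [nxt xs])"
  define f where "f n = nxt (L n)" for n
  have L: "L 0 = []" "L (Suc n) = L n @ [f n]" for n by (simp_all add: L_def f_def)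
  have len: "length (L n) = n" for n by (induction n) (simp_all add: L)
  have nth: "i < n \<Longrightarrow> L n ! i = f i" for i n
    by (induction n) (auto simp: L len nth_append less_Suc_eq)
  have step: "ext (xs @ [nxt xs]) \<and> (\<forall>x. ext (xs @ [x]) \<longrightarrow> \<mu> (nxt xs) \<le> \<mu> x)" if "ext xs" for xs
  proof -
    from that obtain g where "seq g" "\<forall>i < length xs. g i = xs ! i" unfolding ext_def by blast
    then have "ext (xs @ [g (length xs)])"
      unfolding ext_def by (intro exI[of _ g]) (auto simp: nth_append less_Suc_eq)
    from arg_min_nat_lemma[of "\<lambda>x. ext (xs @ [x])", OF this, of \<mu>] show ?thesis
      unfolding nxt_def by blast
  qed
  have ext: "ext (L n)" for n
  proof (induction n)
    case 0
    show ?case using f0 unfolding ext_def seq_def L by auto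
  next
    case (Suc n)
    with step[of "L n"] show ?case by (simp add: L f_def)
  qed
  have approx: "\<exists>g. seq g \<and> (\<forall>i \<le> n. g i = f i)" for n
  proof -
    from ext[of "Suc n"] obtain g where "seq g" "\<forall>i < length (L (Suc n)). g i = L (Suc n) ! i"
      unfolding ext_def by blast
    then show ?thesis using nth[of _ "Suc n"] by (intro exI[of _ g]) (simp add: len)
  qed
  show thesis
  proof (rule that[of f])
    show "f i \<in> S" for i
    proof -
      from approx[of i] obtain g where "seq g" "g i = f i" by blast
      then show ?thesis unfolding seq_def by metis
    qed
    show "\<not> R (f i) (f j)" if "i < j" for i j
    proof -
      from approx[of j] that obtain g where "seq g" "g i = f i" "g j = f j" by force
      with that show ?thesis unfolding seq_def by metis
    qed
    fix g :: "nat \<Rightarrow> 'x" and n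
    assume "\<And>i. g i \<in> S" "\<And>i j. i < j \<Longrightarrow> \<not> R (g i) (g j)" "\<And>i. i < n \<Longrightarrow> g i = f i"
    then have "ext (L n @ [g n])"
      unfolding ext_def
      by (intro exI[of _ g]) (auto simp: seq_def len nth_append less_Suc_eq nth)
    with step[OF ext[of n]] show "\<mu> (f n) \<le> \<mu> (g n)" by (simp add: f_def)
  qed
qed

text \<open>The common core of the theorems of Higman and Kruskal: \<open>t\<close> acts as a
  constructor from a finite signature and \<open>ss\<close> as its arguments. Along a minimal bad
  sequence the arguments in a fixed position are almost full, since otherwise a bad sequence of them
  could be spliced in and would contradict minimality. Hence two elements with equal constructor
  have all their arguments related.\<close>

lemma wqo_on_decomposition:
  fixes R :: "'x \<Rightarrow> 'x \<Rightarrow> bool" and \<mu> :: "'x \<Rightarrow> nat"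
    and dec :: "'x \<Rightarrow> 't \<Rightarrow> 'x list \<Rightarrow> bool"
  assumes "finite T"
    and ex: "\<And>x. x \<in> S \<Longrightarrow> \<exists>t\<in>T. \<exists>ss. dec x t ss"
    and sub: "\<And>x t ss s. x \<in> S \<Longrightarrow> dec x t ss \<Longrightarrow> s \<in> set ss \<Longrightarrow> s \<in> S \<and> \<mu> s < \<mu> x"
    and subterm: "\<And>x t ss s u. x \<in> S \<Longrightarrow> dec x t ss \<Longrightarrow> s \<in> set ss \<Longrightarrow> u \<in> S \<Longrightarrow> R u s \<Longrightarrow> R u x"
    and len: "\<And>x y t ss ss'. dec x t ss \<Longrightarrow> dec y t ss' \<Longrightarrow> length ss = length ss'"
    and cong: "\<And>x y t ss ss'. x \<in> S \<Longrightarrow> y \<in> S \<Longrightarrow> dec x t ss \<Longrightarrow> dec y t ss' \<Longrightarrow>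
      list_all2 R ss ss' \<Longrightarrow> R x y"
  shows "wqo_on R S"
proof (rule ccontr)
  assume "\<not> wqo_on R S"
  then obtain f0 :: "nat \<Rightarrow> 'x" where "\<And>i. f0 i \<in> S" "\<And>i j. i < j \<Longrightarrow> \<not> R (f0 i) (f0 j)"
    unfolding wqo_on_def by blast
  from minimal_bad_sequence[where ?f0.0 = f0 and S = S and R = R and \<mu> = \<mu>, OF this] obtain f where
    fS: "\<And>i::nat. f i \<in> S" and fbad: "\<And>i j. i < j \<Longrightarrow> \<not> R (f i) (f j)" and
    fmin: "\<And>g n. (\<And>i. g i \<in> S) \<Longrightarrow> (\<And>i j. i < j \<Longrightarrow> \<not> R (g i) (g j)) \<Longrightarrow>
      (\<And>i. i < n \<Longrightarrow> g i = f i) \<Longrightarrow> \<mu> (f n) \<le> \<mu> (g n)" by blast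
  from ex[OF fS] have "\<forall>i. \<exists>t ss. t \<in> T \<and> dec (f i) t ss" by blast
  then obtain tg sb where tg: "\<And>i. tg i \<in> T" and sb: "\<And>i. dec (f i) (tg i) (sb i)" by metis
  from tg \<open>finite T\<close> have "finite (range tg)" by (meson finite_subset image_subsetI)
  then obtain \<psi> :: "nat \<Rightarrow> nat" and v where \<psi>: "strict_mono \<psi>" "\<And>i. tg (\<psi> i) = v"
    using finite_range_const_subseq by blast
  define m where "m = length (sb (\<psi> 0))"
  have m: "length (sb (\<psi> i)) = m" for i
    using len[of "f (\<psi> i)" v _ "f (\<psi> 0)"] sb \<psi>(2) unfolding m_def by metis
  have "almost_full (\<lambda>i j. R (sb (\<psi> i) ! r) (sb (\<psi> j) ! r))" if r: "r < m" for r
    unfolding almost_full_def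
  proof (intro allI impI, rule ccontr)
    fix \<phi> :: "nat \<Rightarrow> nat"
    assume \<phi>: "strict_mono \<phi>"
      and nR: "\<not> (\<exists>i j. i < j \<and> R (sb (\<psi> (\<phi> i)) ! r) (sb (\<psi> (\<phi> j)) ! r))"
    define \<chi> where "\<chi> i = \<psi> (\<phi> i)" for i
    have \<chi>: "strict_mono \<chi>" using \<phi> \<psi>(1) by (simp add: \<chi>_def strict_mono_def)
    have mem: "sb (\<chi> i) ! r \<in> set (sb (\<chi> i))" for i using r m by (simp add: \<chi>_def)
    \<comment> \<open>The splice: the old sequence before \<open>\<chi> 0\<close>, bad arguments
      from there on. A relation across the seam would lift by \<open>subterm\<close> to a relation
      inside \<open>f\<close>.\<close>
    define g where "g i = (if i < \<chi> 0 then f i else sb (\<chi> (i - \<chi> 0)) ! r)" for i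
    have "\<mu> (f (\<chi> 0)) \<le> \<mu> (g (\<chi> 0))"
    proof (rule fmin)
      show "g i \<in> S" for i using fS sub[OF fS sb mem] by (simp add: g_def)
      show "\<not> R (g i) (g j)" if ij: "i < j" for i j
      proof -
        consider "j < \<chi> 0" | "i < \<chi> 0" "\<chi> 0 \<le> j" | "\<chi> 0 \<le> i" by linarith
        then show ?thesis
        proof cases
          case 1
          then show ?thesis using ij fbad by (simp add: g_def)
        next
          case 2
          have "\<chi> 0 \<le> \<chi> (j - \<chi> 0)" using \<chi> by (simp add: strict_mono_less_eq)
          then have "\<not> R (f i) (f (\<chi> (j - \<chi> 0)))" using 2 fbad by simp
          then have "\<not> R (f i) (sb (\<chi> (j - \<chi> 0)) ! r)"
            using subterm[OF fS sb mem fS] by blast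
          then show ?thesis using 2 by (simp add: g_def)
        next
          case 3
          then have "i - \<chi> 0 < j - \<chi> 0" using ij by simp
          then show ?thesis using nR 3 ij by (auto simp: g_def \<chi>_def)
        qed
      qed
      show "g i = f i" if "i < \<chi> 0" for i using that by (simp add: g_def)
    qed
    moreover have "\<mu> (g (\<chi> 0)) < \<mu> (f (\<chi> 0))" using sub[OF fS sb mem] by (simp add: g_def)
    ultimately show False by simp
  qed
  from almost_full_All_less[of m, OF this]
  have "almost_full (\<lambda>i j. \<forall>r<m. R (sb (\<psi> i) ! r) (sb (\<psi> j) ! r))" .
  from this[unfolded almost_full_def, rule_format, of "\<lambda>i. i"]
  obtain i j where ij: "i < j" "\<forall>r<m. R (sb (\<psi> i) ! r) (sb (\<psi> j) ! r)"
    by (auto simp: strict_mono_def)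
  then have "list_all2 R (sb (\<psi> i)) (sb (\<psi> j))" by (simp add: list_all2_conv_all_nth m)
  then have "R (f (\<psi> i)) (f (\<psi> j))" using cong[OF fS fS] sb \<psi>(2) by metis
  with fbad[of "\<psi> i" "\<psi> j"] \<psi>(1) ij(1) show False by (simp add: strict_monoD)
qed

section \<open>Nonnegative paths ordered by removal of nonnegative paths\<close>

abbreviation weight :: "('c \<Rightarrow> int) \<Rightarrow> 'c list \<Rightarrow> int" where
  "weight g x \<equiv> sum_list (map g x)"

definition nonneg_path :: "('c \<Rightarrow> int) \<Rightarrow> 'c list \<Rightarrow> bool" where
  "nonneg_path g x \<longleftrightarrow> (\<forall>p. prefix p x \<longrightarrow> 0 \<le> weight g p)"

text \<open>Stronger than the subword order: the additional letters by themselves have to form a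
  path that never becomes negative, because later they have to be a shuffle of further
  copies.\<close>

definition embeds :: "('c \<Rightarrow> int) \<Rightarrow> 'c list \<Rightarrow> 'c list \<Rightarrow> bool" where
  "embeds g x y \<longleftrightarrow> (\<exists>z. y \<in> shuffles x z \<and> nonneg_path g z)"

lemma weight_shuffles:
  fixes g :: "'c \<Rightarrow> int"
  shows "z \<in> shuffles x y \<Longrightarrow> weight g z = weight g x + weight g y"
proof (induction z arbitrary: x y)
  case (Cons c z)
  then show ?case by (auto simp: Cons_in_shuffles_iff neq_Nil_conv)
qed simp

lemma nonneg_path_weight: "nonneg_path g x \<Longrightarrow> 0 \<le> weight g x"
  by (simp add: nonneg_path_def)

lemma nonneg_path_Nil [simp]: "nonneg_path g []"
  by (simp add: nonneg_path_def)

lemma nonneg_path_append: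
  "nonneg_path g (x @ y) \<longleftrightarrow>
    nonneg_path g x \<and> (\<forall>p. prefix p y \<longrightarrow> 0 \<le> weight g x + weight g p)"
  by (auto simp: nonneg_path_def prefix_append)

lemma nonneg_path_snoc:
  "nonneg_path g (x @ [c]) \<longleftrightarrow> nonneg_path g x \<and> 0 \<le> weight g x + g c"
  by (auto simp: nonneg_path_def)

lemma embeds_append: "embeds g x x' \<Longrightarrow> embeds g y y' \<Longrightarrow> embeds g (x @ y) (x' @ y')"
  unfolding embeds_def
proof clarify
  fix z z' assume "x' \<in> shuffles x z" "nonneg_path g z" "y' \<in> shuffles y z'" "nonneg_path g z'"
  then have "x' @ y' \<in> shuffles (x @ y) (z @ z')" "nonneg_path g (z @ z')"
    by (auto intro: append_in_shuffles simp: nonneg_path_append nonneg_path_weight)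
      (auto simp: nonneg_path_def)
  then show "\<exists>z. x' @ y' \<in> shuffles (x @ y) z \<and> nonneg_path g z" by blast
qed

lemma embeds_Cons: "embeds g x x' \<Longrightarrow> embeds g (c # x) (c # x')"
  unfolding embeds_def by (blast intro: Cons_in_shuffles_leftI)

text \<open>\<open>P\<close> goes entirely into the remainder. It ends at a nonnegative height, so
  the old remainder may be appended to it.\<close>

lemma embeds_suffix:
  assumes "embeds g u D" "nonneg_path g (P @ D)"
  shows "embeds g u (P @ D)"
proof -
  from assms(1) obtain z where z: "D \<in> shuffles u z" "nonneg_path g z" unfolding embeds_def by blast
  have "P @ D \<in> shuffles ([] @ u) (P @ z)" by (rule append_in_shuffles) (simp_all add: z)
  moreover have "nonneg_path g (P @ z)"
    using assms(2) z(2) nonneg_path_weight[of g P]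
    by (auto simp: nonneg_path_append) (auto simp: nonneg_path_def)
  ultimately show ?thesis unfolding embeds_def by auto
qed

text \<open>The weights of \<open>u\<close> and of the remainder of \<open>D\<close> are nonnegative
  with sum 0, so the remainder has weight 0 and putting it in place of \<open>D\<close> changes no
  height along \<open>Q\<close>.\<close>

lemma embeds_factor:
  assumes "embeds g u D" "nonneg_path g u" "weight g D = 0" "nonneg_path g (P @ D @ Q)"
  shows "embeds g u (P @ D @ Q)"
proof -
  from assms(1) obtain z where z: "D \<in> shuffles u z" "nonneg_path g z" unfolding embeds_def by blast
  have zw: "weight g z = 0"
    using weight_shuffles[OF z(1), of g] assms(3) nonneg_path_weight[OF assms(2)]
      nonneg_path_weight[OF z(2)] by simp
  have "D @ Q \<in> shuffles (u @ []) (z @ Q)" by (rule append_in_shuffles) (simp_all add: z)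
  then have "P @ D @ Q \<in> shuffles ([] @ u) (P @ z @ Q)" by (intro append_in_shuffles) simp_all
  moreover have "nonneg_path g (P @ z @ Q)"
    unfolding append_assoc[symmetric]
    using assms(3,4) z(2) zw nonneg_path_weight[of g P]
    by (auto simp: nonneg_path_append append_assoc[symmetric] simp del: append_assoc)
      (auto simp: nonneg_path_def)
  ultimately show ?thesis unfolding embeds_def by auto
qed

fun interleave :: "'c list list \<Rightarrow> 'c list \<Rightarrow> 'c list" where
  "interleave (D # Ds) (c # cs) = D @ c # interleave Ds cs"
| "interleave (D # Ds) [] = D"
| "interleave [] cs = []"

lemma embeds_interleave:
  "list_all2 (embeds g) Ds Ds' \<Longrightarrow> embeds g (interleave Ds cs) (interleave Ds' cs)"
proof (induction Ds cs arbitrary: Ds' rule: interleave.induct)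
  case (1 D Ds c cs)
  then show ?case by (auto simp: list_all2_Cons1 intro!: embeds_append embeds_Cons)
next
  case (2 D Ds)
  then show ?case by (auto simp: list_all2_Cons1)
next
  case (3 cs)
  then show ?case by (auto simp: embeds_def)
qed

lemma interleave_split:
  "D \<in> set Ds \<Longrightarrow> length Ds = Suc (length cs) \<Longrightarrow> \<exists>P Q. interleave Ds cs = P @ D @ Q"
proof (induction Ds cs rule: interleave.induct)
  case (1 D' Ds c cs)
  show ?case
  proof (cases "D = D'")
    case True
    then show ?thesis by (intro exI[of _ "[]"] exI[of _ "c # interleave Ds cs"]) simp
  next
    case False
    with 1 obtain P Q where "interleave Ds cs = P @ D @ Q" by auto
    then show ?thesis by (intro exI[of _ "D' @ c # P"] exI[of _ Q]) simp
  qed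
next
  case (2 D' Ds)
  then show ?case by (intro exI[of _ "[]"] exI[of _ "[]"]) simp
qed simp

context
  fixes g :: "'c \<Rightarrow> int"
  assumes g_le: "\<And>c. g c \<le> 1"
begin

text \<open>Cut at the last visit to height 0. Letters rise by at most 1, so the next letter leads
  to height exactly 1, and the path stays at or above 1 from there on.\<close>

lemma last_zero_split:
  "nonneg_path g y \<Longrightarrow> 0 < weight g y \<Longrightarrow>
    \<exists>D c y'. y = D @ c # y' \<and> nonneg_path g D \<and> weight g D = 0 \<and> g c = 1 \<and> nonneg_path g y'"
proof (induction y rule: rev_induct)
  case (snoc d y)
  from snoc.prems have y: "nonneg_path g y" by (simp add: nonneg_path_snoc)
  show ?case
  proof (cases "weight g y = 0")
    case True
    then show ?thesis using snoc.prems y g_le[of d]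
      by (intro exI[of _ y] exI[of _ d] exI[of _ "[]"]) simp
  next
    case False
    then have "0 < weight g y" using nonneg_path_weight[OF y] by simp
    from snoc.IH[OF y this] obtain D c y' where
      *: "y = D @ c # y'" "nonneg_path g D" "weight g D = 0" "g c = 1" "nonneg_path g y'" by blast
    then show ?thesis using snoc.prems(2)
      by (intro exI[of _ D] exI[of _ c] exI[of _ "y' @ [d]"]) (simp add: nonneg_path_snoc)
  qed
qed simp

text \<open>The separators \<open>cs\<close> are the letters that leave the heights
  \<open>0, ..., e - 1\<close> for the last time.\<close>

lemma interleave_decomposition:
  "nonneg_path g y \<Longrightarrow> weight g y = int e \<Longrightarrow>
    \<exists>Ds cs. length cs = e \<and> length Ds = Suc e \<and> y = interleave Ds cs \<and>
      (\<forall>D\<in>set Ds. nonneg_path g D \<and> weight g D = 0)"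
proof (induction e arbitrary: y)
  case 0
  then show ?case by (intro exI[of _ "[y]"] exI[of _ "[]"]) simp
next
  case (Suc e)
  then obtain D c y' where *: "y = D @ c # y'" "nonneg_path g D" "weight g D = 0" "g c = 1"
    "nonneg_path g y'" using last_zero_split[of y] by auto
  with Suc.prems(2) have "weight g y' = int e" by simp
  from Suc.IH[OF *(5) this] obtain Ds cs where
    "length cs = e \<and> length Ds = Suc e \<and> y' = interleave Ds cs \<and>
      (\<forall>D\<in>set Ds. nonneg_path g D \<and> weight g D = 0)" by blast
  with * show ?case by (intro exI[of _ "D # Ds"] exI[of _ "c # cs"]) auto
qed

text \<open>Since \<open>g c \<le> 1\<close>, the heights along \<open>x\<close> are at least -1. So
  if \<open>x\<close> becomes negative, its first negative height is -1, and at that moment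
  \<open>c # x\<close> is back at height 0.\<close>

lemma first_return_split:
  "nonneg_path g (c # x) \<Longrightarrow> nonneg_path g x \<or>
    (\<exists>y d x'. x = y @ d # x' \<and> nonneg_path g y \<and> weight g y + g d = - 1 \<and> nonneg_path g x')"
proof (induction x rule: rev_induct)
  case (snoc e x)
  from snoc.prems have cx: "nonneg_path g (c # x)" and tot: "0 \<le> g c + weight g x + g e"
    using nonneg_path_snoc[of g "c # x" e] by simp_all
  from snoc.IH[OF cx] show ?case
  proof
    assume x: "nonneg_path g x"
    show ?thesis
    proof (cases "0 \<le> weight g x + g e")
      case True
      with x show ?thesis by (simp add: nonneg_path_snoc)
    next
      case False
      with tot g_le[of c] have "weight g x + g e = - 1" by simp
      with x show ?thesis by (intro disjI2 exI[of _ x] exI[of _ e] exI[of _ "[]"]) simp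
    qed
  next
    assume "\<exists>y d x'. x = y @ d # x' \<and> nonneg_path g y \<and> weight g y + g d = - 1 \<and> nonneg_path g x'"
    then obtain y d x' where *: "x = y @ d # x'" "nonneg_path g y" "weight g y + g d = - 1"
      "nonneg_path g x'" by blast
    then show ?thesis using tot g_le[of c]
      by (intro disjI2 exI[of _ y] exI[of _ d] exI[of _ "x' @ [e]"]) (simp add: nonneg_path_snoc)
  qed
qed simp

text \<open>The letter \<open>d\<close> of the first return may fall by more than 1, so the part
  before it need not have weight 0. Cut at its last visits, it becomes \<open>- g d\<close> factors
  of weight 0, which is the condition in \<open>embeds_factor\<close>. This number is bounded, so
  finitely many tags suffice.\<close>

lemma wqo_on_embeds:
  assumes fin: "finite (UNIV :: 'c set)"
  shows "wqo_on (embeds g) {x. nonneg_path g x}"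
proof -
  define dec where "dec x t ss \<longleftrightarrow>
      (x = [] \<and> t = [] \<and> ss = []) \<or>
      (\<exists>c x'. x = c # x' \<and> t = [c] \<and> ss = [x'] \<and> nonneg_path g x') \<or>
      (\<exists>c cs d Ds x'. x = c # interleave Ds cs @ d # x' \<and> t = c # d # cs \<and> ss = x' # Ds \<and>
        length Ds = Suc (length cs) \<and> nonneg_path g x' \<and>
        (\<forall>D\<in>set Ds. nonneg_path g D \<and> weight g D = 0))" for x t ss
  \<comment> \<open>A tag \<open>c # d # cs\<close> has \<open>length cs = - 1 - g d\<close>, so its
    length is bounded in terms of the steepest fall.\<close>
  define K where "K = nat (Max (range (\<lambda>c. - g c))) + 2"
  have K: "- g c \<le> int K - 2" for c
  proof -
    have "- g c \<le> Max (range (\<lambda>c. - g c))" using fin by (intro Max_ge) auto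
    then show ?thesis by (simp add: K_def)
  qed
  show ?thesis
  proof (rule wqo_on_decomposition[where dec = dec and T = "{t. set t \<subseteq> UNIV \<and> length t \<le> K}" and \<mu> = length])
    show "finite {t :: 'c list. set t \<subseteq> UNIV \<and> length t \<le> K}" by (rule finite_lists_length_le[OF fin])
  next
    fix x assume "x \<in> {x. nonneg_path g x}"
    then have x: "nonneg_path g x" by simp
    show "\<exists>t\<in>{t. set t \<subseteq> UNIV \<and> length t \<le> K}. \<exists>ss. dec x t ss"
    proof (cases x)
      case Nil
      then have "dec x [] []" by (simp add: dec_def)
      then show ?thesis by (intro bexI[of _ "[]"] exI[of _ "[]"]) auto
    next
      case (Cons c x')
      from first_return_split[of c x'] x Cons consider "nonneg_path g x'"
        | y d x'' where "x' = y @ d # x''" "nonneg_path g y" "weight g y + g d = - 1" "nonneg_path g x''"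
        by blast
      then show ?thesis
      proof cases
        case 1
        then have "dec x [c] [x']" by (simp add: dec_def Cons)
        then show ?thesis by (intro bexI[of _ "[c]"] exI[of _ "[x']"]) (auto simp: K_def)
      next
        case 2
        define e where "e = nat (weight g y)"
        have e: "weight g y = int e" using nonneg_path_weight[OF 2(2)] by (simp add: e_def)
        from interleave_decomposition[OF 2(2) e] obtain Ds cs where
          *: "length cs = e" "length Ds = Suc e" "y = interleave Ds cs"
          "\<forall>D\<in>set Ds. nonneg_path g D \<and> weight g D = 0" by blast
        have "dec x (c # d # cs) (x'' # Ds)" using * 2 by (simp add: dec_def Cons)
        moreover have "length (c # d # cs) \<le> K" using * e 2(3) K[of d] by simp
        ultimately show ?thesis by (intro bexI[of _ "c # d # cs"] exI) auto
      qed
    qed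
  next
    fix x t ss s assume "x \<in> {x. nonneg_path g x}" "dec x t ss" "s \<in> set ss"
    then show "s \<in> {x. nonneg_path g x} \<and> length s < length x"
      using interleave_split[of s] by (fastforce simp: dec_def)
  next
    fix x t ss s u
    assume as: "x \<in> {x. nonneg_path g x}" "dec x t ss" "s \<in> set ss"
      "u \<in> {x. nonneg_path g x}" "embeds g u s"
    from as(2,3) consider c where "x = [c] @ s"
      | c y d where "x = (c # y @ [d]) @ s"
      | c d x' cs Ds where "x = c # interleave Ds cs @ d # x'" "s \<in> set Ds" "weight g s = 0"
        "length Ds = Suc (length cs)"
      unfolding dec_def by auto
    then show "embeds g u x"
    proof cases
      case 1
      then show ?thesis using as embeds_suffix by blast
    next
      case 2
      then show ?thesis using as embeds_suffix by blast
    next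
      case 3
      from interleave_split[OF 3(2,4)] obtain P Q where "interleave Ds cs = P @ s @ Q" by blast
      then have "x = (c # P) @ s @ (Q @ d # x')" using 3 by simp
      then show ?thesis using as embeds_factor[of g u s "c # P" "Q @ d # x'"] 3 by simp
    qed
  next
    fix x y t ss ss' assume "dec x t ss" "dec y t ss'"
    then show "length ss = length ss'" by (auto simp: dec_def)
  next
    fix x y t ss ss'
    assume "dec x t ss" "dec y t ss'" "list_all2 (embeds g) ss ss'"
    then show "embeds g x y"
      unfolding dec_def
      by (auto simp: embeds_def[of _ "[]"] intro!: embeds_Cons embeds_append embeds_interleave)
  qed
qed

end

section \<open>Words over two letters as paths above a line of slope \<open>q\<close>\<close>

definition wt :: "nat \<Rightarrow> letter list \<Rightarrow> int" where
  "wt q p = int (count_list p a) - int q * int (count_list p b)"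

lemma wt_Nil [simp]: "wt q [] = 0" by (simp add: wt_def)

lemma wt_append [simp]: "wt q (x @ y) = wt q x + wt q y" by (simp add: wt_def algebra_simps)

lemma wt_rev [simp]: "wt q (rev x) = wt q x" by (simp add: wt_def)

lemma wt_shuffles: "z \<in> shuffles x y \<Longrightarrow> wt q z = wt q x + wt q y"
  by (simp add: wt_def count_list_shuffles algebra_simps)

text \<open>A path starting at height \<open>s\<close> is encoded as a word with \<open>s\<close> leading markers \<^term>\<open>None\<close>.\<close>

lemma almost_full_above_line:
  fixes s :: "nat \<Rightarrow> nat" and y :: "nat \<Rightarrow> letter list"
  assumes nonneg: "\<And>l p. prefix p (y l) \<Longrightarrow> 0 \<le> int (s l) + wt q p"
  shows "almost_full (\<lambda>l l'. \<exists>z. y l' \<in> shuffles (y l) z \<and>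
    (\<forall>p. prefix p z \<longrightarrow> 0 \<le> int (s l') - int (s l) + wt q p))"
proof -
  define g :: "letter option \<Rightarrow> int" where "g c = (if c = Some b then - int q else 1)" for c
  define enc where "enc n x = replicate n None @ map Some x" for n and x :: "letter list"
  have g_le: "g c \<le> 1" for c by (simp add: g_def)
  have UNIV_opt: "(UNIV :: letter option set) = {None, Some a, Some b}"
    by (auto, metis letter.exhaust option.exhaust)
  have fin: "finite (UNIV :: letter option set)" unfolding UNIV_opt by simp
  have weight_map: "weight g (map Some p) = wt q p" for p
  proof (induction p)
    case (Cons c p)
    then show ?case by (cases c) (simp_all add: g_def wt_def algebra_simps)
  qed simp
  have weight_rep: "weight g (replicate n None) = int n" for n
    by (induction n) (simp_all add: g_def)
  have prefix_map: "\<exists>p'. prefix p' x \<and> p = map Some p'" if "prefix p (map Some x)" for p and x :: "letter list"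
    using that by (auto simp: prefix_def append_eq_map_conv map_eq_append_conv)
  have valid: "nonneg_path g (enc (s l) (y l))" for l
    unfolding nonneg_path_def enc_def prefix_append
  proof (intro allI impI, elim disjE exE conjE)
    fix p :: "letter option list" assume "prefix p (replicate (s l) None)"
    then have "p = replicate (length p) None"
      by (metis in_set_replicate replicate_eqI set_mono_prefix subsetD)
    then show "0 \<le> weight g p" using weight_rep by (metis of_nat_0_le_iff)
  next
    fix p us :: "letter option list" assume "p = replicate (s l) None @ us" "prefix us (map Some (y l))"
    then show "0 \<le> weight g p" using prefix_map nonneg weight_map weight_rep by fastforce
  qed
  show ?thesis
    unfolding almost_full_def
  proof (intro allI impI)
    fix \<phi> :: "nat \<Rightarrow> nat" assume "strict_mono \<phi>"
    have "wqo_on (embeds g) {x. nonneg_path g x}" using g_le fin by (rule wqo_on_embeds)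
    from this[unfolded wqo_on_def, rule_format, of "\<lambda>l. enc (s (\<phi> l)) (y (\<phi> l))"] valid
    obtain i j where ij: "i < j" "embeds g (enc (s (\<phi> i)) (y (\<phi> i))) (enc (s (\<phi> j)) (y (\<phi> j)))"
      by blast
    define l l' where "l = \<phi> i" and "l' = \<phi> j"
    from ij(2) obtain Z where Z: "enc (s l') (y l') \<in> shuffles (enc (s l) (y l)) Z" "nonneg_path g Z"
      unfolding embeds_def l_def l'_def by blast
    \<comment> \<open>Cutting the larger code behind its markers also cuts the smaller code and the
      remainder behind theirs, because markers come first and match only markers.\<close>
    from Z(1) obtain X1 X2 Z1 Z2 where
      X: "enc (s l) (y l) = X1 @ X2" "Z = Z1 @ Z2" and
      sh: "replicate (s l') None \<in> shuffles X1 Z1" "map Some (y l') \<in> shuffles X2 Z2"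
      unfolding enc_def[of "s l'"] by (rule append_in_shufflesE)
    have set1: "set X1 \<union> set Z1 \<subseteq> {None}" using set_shuffles[OF sh(1)] by (auto simp: set_replicate_conv_if split: if_splits)
    have set2: "None \<notin> set X2" "None \<notin> set Z2" using set_shuffles[OF sh(2)] by auto
    have "filter (\<lambda>c. c = None) X1 = X1" "filter (\<lambda>c. c \<noteq> None) X1 = []"
      using set1 by (auto simp: filter_id_conv filter_empty_conv)
    moreover have "filter (\<lambda>c. c = None) X2 = []" "filter (\<lambda>c. c \<noteq> None) X2 = X2"
      using set2(1) by (auto simp: filter_id_conv filter_empty_conv) (metis not_None_eq)+
    ultimately have "X1 = filter (\<lambda>c. c = None) (X1 @ X2)" "X2 = filter (\<lambda>c. c \<noteq> None) (X1 @ X2)"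
      by simp_all
    then have X1: "X1 = replicate (s l) None" and X2: "X2 = map Some (y l)"
      unfolding X(1)[symmetric] enc_def by (simp_all add: filter_map o_def)
    have Z1: "Z1 = replicate (length Z1) None" using set1 by (intro replicate_eqI) auto
    have len: "s l' = s l + length Z1" using length_shuffles[OF sh(1)] X1 by simp
    define z where "z = map the Z2"
    have Z2: "Z2 = map Some z" using set2(2) unfolding z_def
      by (induction Z2) auto
    have "map the (map Some (y l')) \<in> shuffles (map the X2) (map the Z2)"
      using sh(2) by (rule map_in_shuffles)
    then have "y l' \<in> shuffles (y l) z" by (simp add: X2 z_def o_def)
    moreover have "0 \<le> int (s l') - int (s l) + wt q p" if "prefix p z" for p
    proof -
      have "prefix (Z1 @ map Some p) Z" using that by (simp add: X(2) Z2 map_mono_prefix)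
      then have "0 \<le> weight g (Z1 @ map Some p)" using Z(2) by (simp only: nonneg_path_def)
      also have "\<dots> = int (length Z1) + wt q p"
        using weight_rep[of "length Z1"] weight_map[of p] Z1 by (metis map_append sum_list_append)
      finally show ?thesis using len by simp
    qed
    ultimately show "\<exists>i j. i < j \<and> (\<exists>z. y (\<phi> j) \<in> shuffles (y (\<phi> i)) z \<and>
        (\<forall>p. prefix p z \<longrightarrow> 0 \<le> int (s (\<phi> j)) - int (s (\<phi> i)) + wt q p))"
      using ij(1) unfolding l_def l'_def by blast
  qed
qed

section \<open>Paths between two lines\<close>

text \<open>A piece starts at the height reached by the prefix \<open>s l\<close>; this height
  becomes the number of markers.\<close>

lemma almost_full_low:
  fixes s y :: "nat \<Rightarrow> letter list" and h :: "nat \<Rightarrow> int"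
  assumes nonneg: "\<And>l p. prefix p (y l) \<Longrightarrow> 0 \<le> h l + wt q (s l @ p)"
  shows "almost_full (\<lambda>l l'. \<exists>z. y l' \<in> shuffles (y l) z \<and>
    (\<forall>p. prefix p z \<longrightarrow> 0 \<le> (h l' + wt q (s l' @ p)) - (h l + wt q (s l))))"
proof -
  define t where "t l = nat (h l + wt q (s l))" for l
  have t: "int (t l) = h l + wt q (s l)" for l using nonneg[of "[]" l] by (simp add: t_def)
  have "0 \<le> int (t l) + wt q p" if "prefix p (y l)" for l p
    using nonneg[OF that] by (simp add: t algebra_simps)
  moreover have "int (t l') - int (t l) + wt q p = (h l' + wt q (s l' @ p)) - (h l + wt q (s l))" for l l' p
    by (simp add: t)
  ultimately show ?thesis using almost_full_above_line[of y t q] by (simp only:)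
qed

text \<open>Reading words backwards turns upper bounds into lower bounds.\<close>

lemma almost_full_high:
  fixes s y :: "nat \<Rightarrow> letter list" and h :: "nat \<Rightarrow> int"
  assumes nonneg: "\<And>l p. prefix p (y l) \<Longrightarrow> 0 \<le> h l - wt q (s l @ p)"
  shows "almost_full (\<lambda>l l'. \<exists>z. y l' \<in> shuffles (y l) z \<and>
    (\<forall>p. prefix p z \<longrightarrow> 0 \<le> (h l' - wt q (s l' @ p)) - (h l - wt q (s l))))"
proof -
  define t where "t l = nat (h l - wt q (s l @ y l))" for l
  have t: "int (t l) = h l - wt q (s l) - wt q (y l)" for l using nonneg[of "y l" l] by (simp add: t_def)
  have "0 \<le> int (t l) + wt q p" if "prefix p (rev (y l))" for l p
  proof -
    from that obtain r where "rev (y l) = p @ r" by (auto simp: prefix_def)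
    then have "y l = rev r @ rev p" by (metis rev_append rev_rev_ident)
    then show ?thesis using nonneg[of "rev r" l] by (simp add: t algebra_simps)
  qed
  from almost_full_above_line[of "\<lambda>l. rev (y l)" t q, OF this] show ?thesis
  proof (rule almost_full_mono)
    fix l l' :: nat
    assume "\<exists>z. rev (y l') \<in> shuffles (rev (y l)) z \<and>
      (\<forall>p. prefix p z \<longrightarrow> 0 \<le> int (t l') - int (t l) + wt q p)"
    then obtain z where z: "rev (y l') \<in> shuffles (rev (y l)) z"
      "\<And>p. prefix p z \<Longrightarrow> 0 \<le> int (t l') - int (t l) + wt q p" by blast
    have sh: "y l' \<in> shuffles (y l) (rev z)" using rev_in_shuffles[OF z(1)] by simp
    have "0 \<le> (h l' - wt q (s l' @ p)) - (h l - wt q (s l))" if "prefix p (rev z)" for p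
    proof -
      from that obtain r where r: "rev z = p @ r" by (auto simp: prefix_def)
      then have "z = rev r @ rev p" by (metis rev_append rev_rev_ident)
      then have "0 \<le> int (t l') - int (t l) + wt q (rev r)" by (intro z(2)) simp
      moreover have "wt q (y l') = wt q (y l) + wt q p + wt q r"
        using wt_shuffles[OF sh, of q] r by simp
      ultimately show ?thesis by (simp add: t)
    qed
    with sh show "\<exists>z. y l' \<in> shuffles (y l) z \<and>
      (\<forall>p. prefix p z \<longrightarrow> 0 \<le> (h l' - wt q (s l' @ p)) - (h l - wt q (s l)))" by blast
  qed
qed

text \<open>Presents a point of the remainder as the difference of a point of the larger word and a
  point of the smaller one, which is how heights along the remainder are estimated.\<close>

lemma shuffles_prefix_rightE:
  assumes "v \<in> shuffles u z" "prefix p z"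
  obtains v' u' where "prefix v' v" "prefix u' u" "v' \<in> shuffles u' p"
proof -
  from assms(2) obtain r where "z = p @ r" by (auto simp: prefix_def)
  with assms(1) obtain v1 v2 u1 u2 where "v = v1 @ v2" "u = u1 @ u2" "v1 \<in> shuffles u1 p"
    by (metis shuffles_append_rightE)
  with that show thesis by (metis prefixI)
qed

lemma abs_wt_le: "\<bar>wt q p\<bar> \<le> int (1 + q) * int (length p)"
proof (induction p)
  case (Cons c p)
  then show ?case by (cases c) (auto simp: wt_def algebra_simps)
qed simp

text \<open>Allows the larger word of a pair to use any prescribed multiple of the number of copies
  of the smaller one.\<close>

lemma almost_full_growth:
  fixes k :: "nat \<Rightarrow> nat"
  assumes "strict_mono k"
  shows "almost_full (\<lambda>l l'. D * k l \<le> k l')"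
  unfolding almost_full_def
proof (intro allI impI)
  fix \<phi> :: "nat \<Rightarrow> nat" assume "strict_mono \<phi>"
  with assms have "strict_mono (\<lambda>i. k (\<phi> i))" by (simp add: strict_mono_def)
  from strict_mono_imp_increasing[OF this, of "Suc (D * k (\<phi> 0))"]
  have "D * k (\<phi> 0) \<le> k (\<phi> (Suc (D * k (\<phi> 0))))" by simp
  then show "\<exists>i j. i < j \<and> D * k (\<phi> i) \<le> k (\<phi> j)" by blast
qed

text \<open>Words are paths between two lines whose distance grows with the number \<open>k l\<close> of copies.
  The flags \<open>T1\<close>, \<open>T2\<close> switch off the lower and the upper line.\<close>

context
  fixes k :: "nat \<Rightarrow> nat" and c1 c2 :: int and q1 q2 :: nat and T1 T2 :: bool
begin

definition lo :: "nat \<Rightarrow> letter list \<Rightarrow> int" where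
  "lo l x = c1 * int (k l) + wt q1 x"

definition hi :: "nat \<Rightarrow> letter list \<Rightarrow> int" where
  "hi l x = c2 * int (k l) - wt q2 x"

text \<open>Here \<open>z\<close> continues whatever remains of \<open>s l'\<close> after removing
  \<open>s l\<close>. By linearity the two differences are the heights of this continued remainder
  with respect to the lines for \<open>k l' - k l\<close> copies.\<close>

definition fills :: "(nat \<Rightarrow> letter list) \<Rightarrow> (nat \<Rightarrow> letter list) \<Rightarrow> nat \<Rightarrow> nat \<Rightarrow> bool" where
  "fills s y l l' \<longleftrightarrow> (\<exists>z. y l' \<in> shuffles (y l) z \<and> (\<forall>p. prefix p z \<longrightarrow>
     (T1 \<or> 0 \<le> lo l' (s l' @ p) - lo l (s l)) \<and> (T2 \<or> 0 \<le> hi l' (s l' @ p) - hi l (s l))))"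

lemma lo_diff: "v \<in> shuffles u p \<Longrightarrow> lo l' (s' @ p) - lo l s = lo l' (s' @ v) - lo l (s @ u)"
  using wt_shuffles[of v u p q1] by (simp add: lo_def)

lemma hi_diff: "v \<in> shuffles u p \<Longrightarrow> hi l' (s' @ p) - hi l s = hi l' (s' @ v) - hi l (s @ u)"
  using wt_shuffles[of v u p q2] by (simp add: hi_def)

lemma lo_le: "length x \<le> C * k l \<Longrightarrow> lo l x \<le> int (nat \<bar>c1\<bar> + (1 + q1) * C) * int (k l)"
proof -
  assume "length x \<le> C * k l"
  then have "(1 + q1) * length x \<le> (1 + q1) * (C * k l)" by (rule mult_le_mono2)
  then have "int (1 + q1) * int (length x) \<le> int (1 + q1) * (int C * int (k l))"
    unfolding of_nat_mult[symmetric] by (simp only: of_nat_le_iff)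
  moreover have "c1 * int (k l) \<le> \<bar>c1\<bar> * int (k l)" by (simp add: mult_right_mono)
  ultimately show ?thesis using abs_wt_le[of q1 x] unfolding lo_def by (simp add: distrib_right mult.assoc)
qed

lemma hi_le: "length x \<le> C * k l \<Longrightarrow> hi l x \<le> int (nat \<bar>c2\<bar> + (1 + q2) * C) * int (k l)"
proof -
  assume "length x \<le> C * k l"
  then have "(1 + q2) * length x \<le> (1 + q2) * (C * k l)" by (rule mult_le_mono2)
  then have "int (1 + q2) * int (length x) \<le> int (1 + q2) * (int C * int (k l))"
    unfolding of_nat_mult[symmetric] by (simp only: of_nat_le_iff)
  moreover have "c2 * int (k l) \<le> \<bar>c2\<bar> * int (k l)" by (simp add: mult_right_mono)
  ultimately show ?thesis using abs_wt_le[of q2 x] unfolding hi_def by (simp add: distrib_right mult.assoc)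
qed

lemma fills_append:
  assumes "fills s y1 l l'" "fills (\<lambda>l. s l @ y1 l) y2 l l'"
  shows "fills s (\<lambda>l. y1 l @ y2 l) l l'"
proof -
  from assms obtain z1 z2 where z1: "y1 l' \<in> shuffles (y1 l) z1"
    "\<And>p. prefix p z1 \<Longrightarrow> (T1 \<or> 0 \<le> lo l' (s l' @ p) - lo l (s l)) \<and> (T2 \<or> 0 \<le> hi l' (s l' @ p) - hi l (s l))"
    and z2: "y2 l' \<in> shuffles (y2 l) z2"
    "\<And>p. prefix p z2 \<Longrightarrow> (T1 \<or> 0 \<le> lo l' ((s l' @ y1 l') @ p) - lo l (s l @ y1 l)) \<and>
      (T2 \<or> 0 \<le> hi l' ((s l' @ y1 l') @ p) - hi l (s l @ y1 l))"
    unfolding fills_def by blast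
  have "(T1 \<or> 0 \<le> lo l' (s l' @ p) - lo l (s l)) \<and> (T2 \<or> 0 \<le> hi l' (s l' @ p) - hi l (s l))"
    if "prefix p (z1 @ z2)" for p
    using that unfolding prefix_append
  proof (elim disjE exE conjE)
    assume "prefix p z1"
    then show ?thesis by (rule z1(2))
  next
    fix p2 assume p: "p = z1 @ p2" "prefix p2 z2"
    have "wt q (y1 l') = wt q (y1 l) + wt q z1" for q using z1(1) by (rule wt_shuffles)
    then have "lo l' (s l' @ p) - lo l (s l) = lo l' ((s l' @ y1 l') @ p2) - lo l (s l @ y1 l)"
      "hi l' (s l' @ p) - hi l (s l) = hi l' ((s l' @ y1 l') @ p2) - hi l (s l @ y1 l)"
      by (simp_all add: p(1) lo_def hi_def)
    then show ?thesis using z2(2)[OF p(2)] by (simp only:)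
  qed
  with append_in_shuffles[OF z1(1) z2(1)] show ?thesis unfolding fills_def by blast
qed

context
  assumes k: "strict_mono k"
begin

text \<open>One line is treated by the result for a single line. The other one is far away along the
  whole piece: in the larger word the height above it is at least \<open>k l' / 4\<close>, and by
  growth this exceeds every height occurring in the smaller word.\<close>

lemma almost_full_fills_piece:
  assumes lo: "\<And>l p. prefix p (y l) \<Longrightarrow> 0 \<le> lo l (s l @ p)"
    and hi: "\<And>l p. prefix p (y l) \<Longrightarrow> 0 \<le> hi l (s l @ p)"
    and len: "\<And>l. length (s l @ y l) \<le> C * k l"
    and slack: "T1 \<or> T2 \<or> (\<forall>l. (\<forall>p. prefix p (y l) \<longrightarrow> int (k l) \<le> 4 * lo l (s l @ p)) \<or>
      (\<forall>p. prefix p (y l) \<longrightarrow> int (k l) \<le> 4 * hi l (s l @ p)))"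
  shows "almost_full (fills s y)"
proof -
  have low: "almost_full (\<lambda>l l'. \<exists>z. y l' \<in> shuffles (y l) z \<and>
      (\<forall>p. prefix p z \<longrightarrow> 0 \<le> lo l' (s l' @ p) - lo l (s l)))"
    unfolding lo_def by (rule almost_full_low) (use lo in \<open>simp add: lo_def\<close>)
  have high: "almost_full (\<lambda>l l'. \<exists>z. y l' \<in> shuffles (y l) z \<and>
      (\<forall>p. prefix p z \<longrightarrow> 0 \<le> hi l' (s l' @ p) - hi l (s l)))"
    unfolding hi_def by (rule almost_full_high) (use hi in \<open>simp add: hi_def\<close>)
  have slen: "length (s l @ p) \<le> C * k l" if "prefix p (y l)" for l p
    using len[of l] prefix_length_le[OF that] by simp
  \<comment> \<open>On words of length at most \<open>C * k l\<close> both heights are bounded by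
    these multiples of \<open>k l\<close>, so \<open>D * k l \<le> k l'\<close> brings four times
    any height of word \<open>l\<close> below \<open>k l'\<close>.\<close>
  define D where "D = 4 * (nat \<bar>c1\<bar> + (1 + q1) * C) + 4 * (nat \<bar>c2\<bar> + (1 + q2) * C)"
  have growth: "almost_full (\<lambda>l l'. D * k l \<le> k l')" using k by (rule almost_full_growth)
  have bound: "4 * lo l (s l @ u) \<le> int (k l')" "4 * hi l (s l @ u) \<le> int (k l')"
    if u: "prefix u (y l)" and D: "D * k l \<le> k l'" for l l' u
  proof -
    have D': "int (D * k l) \<le> int (k l')" using D by (simp only: of_nat_le_iff)
    have eq: "int (D * k l) = 4 * (int (nat \<bar>c1\<bar> + (1 + q1) * C) * int (k l))
        + 4 * (int (nat \<bar>c2\<bar> + (1 + q2) * C) * int (k l))"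
      unfolding D_def by (simp add: algebra_simps)
    have nonneg: "0 \<le> int (nat \<bar>c1\<bar> + (1 + q1) * C) * int (k l)" "0 \<le> int (nat \<bar>c2\<bar> + (1 + q2) * C) * int (k l)"
      by simp_all
    show "4 * lo l (s l @ u) \<le> int (k l')" "4 * hi l (s l @ u) \<le> int (k l')"
      using lo_le[OF slen[OF u]] hi_le[OF slen[OF u]] D' nonneg unfolding eq by linarith+
  qed
  consider T1 | T2 | "\<forall>l. (\<forall>p. prefix p (y l) \<longrightarrow> int (k l) \<le> 4 * lo l (s l @ p)) \<or>
      (\<forall>p. prefix p (y l) \<longrightarrow> int (k l) \<le> 4 * hi l (s l @ p))" using slack by blast
  then show ?thesis
  proof cases
    case 1
    from high show ?thesis by (rule almost_full_mono) (use 1 in \<open>unfold fills_def, blast\<close>)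
  next
    case 2
    from low show ?thesis by (rule almost_full_mono) (use 2 in \<open>unfold fills_def, blast\<close>)
  next
    case 3
    show ?thesis
      unfolding almost_full_def
    proof (intro allI impI)
      fix \<phi> :: "nat \<Rightarrow> nat" assume \<phi>: "strict_mono \<phi>"
      \<comment> \<open>Which line is far away may depend on the index; one of the two alternatives
        occurs infinitely often.\<close>
      define I where "I = {i. \<forall>p. prefix p (y (\<phi> i)) \<longrightarrow> int (k (\<phi> i)) \<le> 4 * lo (\<phi> i) (s (\<phi> i) @ p)}"
      show "\<exists>i j. i < j \<and> fills s y (\<phi> i) (\<phi> j)"
      proof (cases "infinite I")
        case True
        from infinite_strict_mono[OF this] obtain \<psi> :: "nat \<Rightarrow> nat" where
          \<psi>: "strict_mono \<psi>" "\<And>i. \<psi> i \<in> I" by blast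
        have "strict_mono (\<lambda>i. \<phi> (\<psi> i))" using \<phi> \<psi> by (simp add: strict_mono_def)
        with almost_full_conj[OF high growth] obtain i j z where ij: "i < j"
          and z: "y (\<phi> (\<psi> j)) \<in> shuffles (y (\<phi> (\<psi> i))) z"
            "\<forall>p. prefix p z \<longrightarrow> 0 \<le> hi (\<phi> (\<psi> j)) (s (\<phi> (\<psi> j)) @ p) - hi (\<phi> (\<psi> i)) (s (\<phi> (\<psi> i)))"
          and gr: "D * k (\<phi> (\<psi> i)) \<le> k (\<phi> (\<psi> j))"
          unfolding almost_full_def by blast
        have "0 \<le> lo (\<phi> (\<psi> j)) (s (\<phi> (\<psi> j)) @ p) - lo (\<phi> (\<psi> i)) (s (\<phi> (\<psi> i)))" if p: "prefix p z" for p
        proof -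
          from shuffles_prefix_rightE[OF z(1) p] obtain v u where
            vu: "prefix v (y (\<phi> (\<psi> j)))" "prefix u (y (\<phi> (\<psi> i)))" "v \<in> shuffles u p" .
          have "int (k (\<phi> (\<psi> j))) \<le> 4 * lo (\<phi> (\<psi> j)) (s (\<phi> (\<psi> j)) @ v)"
            using \<psi>(2)[of j] vu(1) by (simp add: I_def)
          with bound(1)[OF vu(2) gr] show ?thesis unfolding lo_diff[OF vu(3)] by linarith
        qed
        with z have "fills s y (\<phi> (\<psi> i)) (\<phi> (\<psi> j))" unfolding fills_def by blast
        with ij \<psi>(1) show ?thesis by (meson strict_monoD)
      next
        case False
        then have "infinite (- I)" by (metis finite_Un Compl_partition infinite_UNIV_nat)
        from infinite_strict_mono[OF this] obtain \<psi> :: "nat \<Rightarrow> nat" where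
          \<psi>: "strict_mono \<psi>" "\<And>i. \<psi> i \<in> - I" by blast
        have "strict_mono (\<lambda>i. \<phi> (\<psi> i))" using \<phi> \<psi> by (simp add: strict_mono_def)
        with almost_full_conj[OF low growth] obtain i j z where ij: "i < j"
          and z: "y (\<phi> (\<psi> j)) \<in> shuffles (y (\<phi> (\<psi> i))) z"
            "\<forall>p. prefix p z \<longrightarrow> 0 \<le> lo (\<phi> (\<psi> j)) (s (\<phi> (\<psi> j)) @ p) - lo (\<phi> (\<psi> i)) (s (\<phi> (\<psi> i)))"
          and gr: "D * k (\<phi> (\<psi> i)) \<le> k (\<phi> (\<psi> j))"
          unfolding almost_full_def by blast
        have "0 \<le> hi (\<phi> (\<psi> j)) (s (\<phi> (\<psi> j)) @ p) - hi (\<phi> (\<psi> i)) (s (\<phi> (\<psi> i)))" if p: "prefix p z" for p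
        proof -
          from shuffles_prefix_rightE[OF z(1) p] obtain v u where
            vu: "prefix v (y (\<phi> (\<psi> j)))" "prefix u (y (\<phi> (\<psi> i)))" "v \<in> shuffles u p" .
          have "int (k (\<phi> (\<psi> j))) \<le> 4 * hi (\<phi> (\<psi> j)) (s (\<phi> (\<psi> j)) @ v)"
            using \<psi>(2)[of j] vu(1) 3 unfolding I_def by blast
          with bound(2)[OF vu(2) gr] show ?thesis unfolding hi_diff[OF vu(3)] by linarith
        qed
        with z have "fills s y (\<phi> (\<psi> i)) (\<phi> (\<psi> j))" unfolding fills_def by blast
        with ij \<psi>(1) show ?thesis by (meson strict_monoD)
      qed
    qed
  qed
qed

text \<open>A piece of length at most \<open>m l\<close> changes each height by at most
  \<open>k l / 4\<close>. Two heights with sum at least \<open>k l\<close> include one that is at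
  least \<open>k l / 2\<close> at the start of the piece, hence at least \<open>k l / 4\<close>
  throughout.\<close>

lemma almost_full_fills_pieces:
  assumes "\<And>l p. prefix p (y l) \<Longrightarrow> 0 \<le> lo l (s l @ p)"
    and "\<And>l p. prefix p (y l) \<Longrightarrow> 0 \<le> hi l (s l @ p)"
    and "\<And>l. length (s l @ y l) \<le> C * k l"
    and "T1 \<or> T2 \<or> (\<forall>l p. prefix p (y l) \<longrightarrow> int (k l) \<le> lo l (s l @ p) + hi l (s l @ p))"
    and m: "\<And>l. 4 * (1 + q1 + q2) * m l \<le> k l"
    and "\<And>l. length (y l) \<le> Suc N * m l"
  shows "almost_full (fills s y)"
  using assms(1-4,6)
proof (induction N arbitrary: s y)
  case 0
  have "(\<forall>p. prefix p (y l) \<longrightarrow> int (k l) \<le> 4 * lo l (s l @ p)) \<or>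
      (\<forall>p. prefix p (y l) \<longrightarrow> int (k l) \<le> 4 * hi l (s l @ p))"
    if "\<not> T1" "\<not> T2" for l
  proof -
    have w: "4 * \<bar>wt q p\<bar> \<le> int (k l)" if p: "prefix p (y l)" and q: "q \<le> q1 + q2" for q p
    proof -
      have "length p \<le> m l" using prefix_length_le[OF p] 0(5)[of l] by simp
      then have "(1 + q) * length p \<le> (1 + q1 + q2) * m l" using q by (intro mult_le_mono) simp_all
      then have "4 * ((1 + q) * length p) \<le> 4 * ((1 + q1 + q2) * m l)" by (rule mult_le_mono2)
      also have "\<dots> \<le> k l" using m[of l] by (simp only: mult.assoc)
      finally have "4 * ((1 + q) * length p) \<le> k l" .
      then have "4 * (int (1 + q) * int (length p)) \<le> int (k l)"
        by (metis of_nat_le_iff of_nat_mult of_nat_numeral)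
      with abs_wt_le[of q p] show ?thesis by linarith
    qed
    have "int (k l) \<le> lo l (s l) + hi l (s l)" using 0(4) that by (metis Nil_prefix append_Nil2)
    then consider "int (k l) \<le> 2 * lo l (s l)" | "int (k l) \<le> 2 * hi l (s l)" by linarith
    then show ?thesis
    proof cases
      case 1
      have "int (k l) \<le> 4 * lo l (s l @ p)" if "prefix p (y l)" for p
        using w[OF that, of q1] 1 by (simp add: lo_def)
      then show ?thesis by blast
    next
      case 2
      have "int (k l) \<le> 4 * hi l (s l @ p)" if "prefix p (y l)" for p
        using w[OF that, of q2] 2 by (simp add: hi_def)
      then show ?thesis by blast
    qed
  qed
  then show ?case using 0 by (intro almost_full_fills_piece) blast+
next
  case (Suc N)
  define y1 y2 where "y1 l = take (m l) (y l)" and "y2 l = drop (m l) (y l)" for l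
  have y: "y l = y1 l @ y2 l" for l by (simp add: y1_def y2_def)
  have y1: "prefix p (y l)" if "prefix p (y1 l)" for p l
    using that by (simp add: y prefix_append)
  have y2: "prefix (y1 l @ p) (y l)" if "prefix p (y2 l)" for p l using that by (simp add: y)
  have af1: "almost_full (fills s y1)"
  proof (rule Suc.IH)
    show "0 \<le> lo l (s l @ p)" if "prefix p (y1 l)" for l p by (rule Suc.prems(1)[OF y1[OF that]])
    show "0 \<le> hi l (s l @ p)" if "prefix p (y1 l)" for l p by (rule Suc.prems(2)[OF y1[OF that]])
    show "length (s l @ y1 l) \<le> C * k l" for l using Suc.prems(3)[of l] by (simp add: y)
    show "T1 \<or> T2 \<or> (\<forall>l p. prefix p (y1 l) \<longrightarrow> int (k l) \<le> lo l (s l @ p) + hi l (s l @ p))"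
      using Suc.prems(4) y1 by blast
    show "length (y1 l) \<le> Suc N * m l" for l by (simp add: y1_def)
  qed
  have af2: "almost_full (fills (\<lambda>l. s l @ y1 l) y2)"
  proof (rule Suc.IH)
    show "0 \<le> lo l ((s l @ y1 l) @ p)" if "prefix p (y2 l)" for l p
      using Suc.prems(1)[OF y2[OF that]] by simp
    show "0 \<le> hi l ((s l @ y1 l) @ p)" if "prefix p (y2 l)" for l p
      using Suc.prems(2)[OF y2[OF that]] by simp
    show "length ((s l @ y1 l) @ y2 l) \<le> C * k l" for l using Suc.prems(3)[of l] by (simp add: y)
    show "T1 \<or> T2 \<or> (\<forall>l p. prefix p (y2 l) \<longrightarrow>
        int (k l) \<le> lo l ((s l @ y1 l) @ p) + hi l ((s l @ y1 l) @ p))"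
      using Suc.prems(4) y2 by (metis append_assoc)
    show "length (y2 l) \<le> Suc N * m l" for l using Suc.prems(5)[of l] by (simp add: y2_def)
  qed
  have "almost_full (fills s (\<lambda>l. y1 l @ y2 l))"
    using almost_full_conj[OF af1 af2] by (rule almost_full_mono) (blast intro: fills_append)
  then show ?case by (simp add: y[symmetric])
qed

lemma almost_full_fills:
  assumes "\<And>l p. prefix p (y l) \<Longrightarrow> 0 \<le> lo l (s l @ p)"
    and "\<And>l p. prefix p (y l) \<Longrightarrow> 0 \<le> hi l (s l @ p)"
    and len: "\<And>l. length (s l @ y l) \<le> C * k l"
    and "T1 \<or> T2 \<or> (\<forall>l p. prefix p (y l) \<longrightarrow> int (k l) \<le> lo l (s l @ p) + hi l (s l @ p))"
    and k_ge: "\<And>l. 4 * (1 + q1 + q2) \<le> k l"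
  shows "almost_full (fills s y)"
proof -
  define Q where "Q = 4 * (1 + q1 + q2)"
  \<comment> \<open>The number of pieces must not depend on \<open>l\<close>. By \<open>k_ge\<close>
    the quotient is at least 1, so rounding down loses at most a factor 2 and
    \<open>k l \<le> 2 * Q * m l\<close>.\<close>
  define m where "m l = k l div Q" for l
  have Q: "0 < Q" by (simp add: Q_def)
  have m: "4 * (1 + q1 + q2) * m l \<le> k l" for l
    unfolding Q_def[symmetric] m_def by (rule times_div_less_eq_dividend)
  have "length (y l) \<le> Suc (2 * Q * C) * m l" for l
  proof -
    have "1 \<le> m l" using k_ge[of l] Q unfolding Q_def[symmetric] m_def by (simp add: Suc_le_eq div_greater_zero_iff)
    then have "Q * 1 \<le> Q * m l" by (rule mult_le_mono2)
    moreover have "k l < Q * m l + Q"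
      using Q by (metis m_def mod_less_divisor mult_div_mod_eq nat_add_left_cancel_less)
    ultimately have "k l \<le> 2 * Q * m l" by linarith
    then have "C * k l \<le> C * (2 * Q * m l)" by (rule mult_le_mono2)
    moreover have "C * (2 * Q * m l) \<le> Suc (2 * Q * C) * m l" by (simp add: algebra_simps)
    moreover have "length (y l) \<le> C * k l" using len[of l] by simp
    ultimately show ?thesis by linarith
  qed
  with assms(1-4) m show ?thesis by (rule almost_full_fills_pieces)
qed

end

end

section \<open>Shuffles of copies of a good word\<close>

lemma same_length_first_difference:
  assumes "length x = length y" "x \<noteq> y"
  obtains p c x' d y' where "x = p @ c # x'" "y = p @ d # y'" "c \<noteq> d"
  using same_length_different[OF assms(2,1)] by auto

text \<open>The path of \<open>y\<close> runs through images of points of the path of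
  \<open>x\<close> under \<open>(S, T)\<close>. This transports membership in a region from the
  prefixes of \<open>x\<close> to those of \<open>y\<close>.\<close>

definition tracks :: "(nat \<Rightarrow> nat) \<Rightarrow> (nat \<Rightarrow> nat) \<Rightarrow> letter list \<Rightarrow> letter list \<Rightarrow> bool" where
  "tracks S T x y \<longleftrightarrow>
    (\<forall>p. prefix p y \<longrightarrow> (\<exists>p0. prefix p0 x \<and> count_list p a = S (count_list p0 a) \<and>
      count_list p b = T (count_list p0 b))) \<and>
    count_list y a = S (count_list x a) \<and> count_list y b = T (count_list x b)"

lemma tracks_snoc_left:
  assumes "tracks S T x y" "count_list y a = S (count_list (x @ [c]) a)"
    "count_list y b = T (count_list (x @ [c]) b)"
  shows "tracks S T (x @ [c]) y"
  using assms unfolding tracks_def by (meson prefix_prefix)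

lemma tracks_snoc_both:
  assumes "tracks S T x y" "count_list (y @ [c]) a = S (count_list (x @ [c]) a)"
    "count_list (y @ [c]) b = T (count_list (x @ [c]) b)"
  shows "tracks S T (x @ [c]) (y @ [c])"
proof -
  have "\<exists>p0. prefix p0 (x @ [c]) \<and> count_list p a = S (count_list p0 a) \<and> count_list p b = T (count_list p0 b)"
    if "prefix p (y @ [c])" for p
  proof (cases "p = y @ [c]")
    case True
    then show ?thesis using assms(2,3) by blast
  next
    case False
    with that have "prefix p y" by simp
    then show ?thesis using assms(1) unfolding tracks_def by (meson prefix_prefix)
  qed
  then show ?thesis using assms(2,3) unfolding tracks_def by blast
qed

text \<open>A letter of \<open>x\<close> goes to \<open>y\<close> exactly when it makes
  \<open>S\<close> or \<open>T\<close>, respectively, increase. The choice depends only on its rank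
  among equal letters, so extracting a copy becomes arithmetic on counts.\<close>

lemma count_based_split:
  fixes S T :: "nat \<Rightarrow> nat"
  assumes S0: "S 0 = 0" and S: "\<And>t. S (Suc t) = S t \<or> S (Suc t) = Suc (S t)"
    and T0: "T 0 = 0" and T: "\<And>t. T (Suc t) = T t \<or> T (Suc t) = Suc (T t)"
  shows "\<exists>x' y. x \<in> shuffles x' y \<and> tracks S T x y \<and> tracks (\<lambda>t. t - S t) (\<lambda>t. t - T t) x x'"
proof (induction x rule: rev_induct)
  case Nil
  have "tracks S T [] []" "tracks (\<lambda>t. t - S t) (\<lambda>t. t - T t) [] []"
    by (simp_all add: tracks_def S0 T0)
  then show ?case by (intro exI[of _ "[]"]) simp
next
  case (snoc c x)
  have le: "U t \<le> t" if "U 0 = 0" "\<And>t. U (Suc t) = U t \<or> U (Suc t) = Suc (U t)" for U :: "nat \<Rightarrow> nat" and t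
  proof (induction t)
    case (Suc t)
    then show ?case using that(2)[of t] by auto
  qed (simp add: that(1))
  note S_le = le[OF S0 S] and T_le = le[OF T0 T]
  from snoc obtain x' y where sh: "x \<in> shuffles x' y"
    and y: "tracks S T x y" and x': "tracks (\<lambda>t. t - S t) (\<lambda>t. t - T t) x x'" by blast
  have cnt: "count_list y a = S (count_list x a)" "count_list y b = T (count_list x b)"
    "count_list x' a = count_list x a - S (count_list x a)" "count_list x' b = count_list x b - T (count_list x b)"
    using y x' by (simp_all add: tracks_def)
  show ?case
  proof (cases "if c = a then S (Suc (count_list x a)) = S (count_list x a)
      else T (Suc (count_list x b)) = T (count_list x b)")
    case True
    have "x @ [c] \<in> shuffles (x' @ [c]) (y @ [])"
      by (rule append_in_shuffles) (simp_all add: sh)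
    moreover have "tracks S T (x @ [c]) y"
      using True cnt by (intro tracks_snoc_left[OF y]) (cases c; simp)+
    moreover have "tracks (\<lambda>t. t - S t) (\<lambda>t. t - T t) (x @ [c]) (x' @ [c])"
      using True cnt S_le[of "count_list x a"] T_le[of "count_list x b"]
      by (intro tracks_snoc_both[OF x']) (cases c; simp add: Suc_diff_le)+
    ultimately show ?thesis by auto
  next
    case False
    have "x @ [c] \<in> shuffles (x' @ []) (y @ [c])"
      by (rule append_in_shuffles) (simp_all add: sh)
    moreover have "tracks S T (x @ [c]) (y @ [c])"
      using False cnt S[of "count_list x a"] T[of "count_list x b"]
      by (intro tracks_snoc_both[OF y]) (cases c; simp)+
    moreover have "tracks (\<lambda>t. t - S t) (\<lambda>t. t - T t) (x @ [c]) x'"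
      using False cnt S[of "count_list x a"] T[of "count_list x b"]
      by (intro tracks_snoc_left[OF x']) (cases c; simp)+
    ultimately show ?thesis by auto
  qed
qed

lemma ceil_div_bounds:
  fixes t m :: nat
  defines "T \<equiv> (t + m) div Suc m"
  shows "t \<le> Suc m * T" "Suc m * T \<le> t + m"
proof -
  have "Suc m * T + (t + m) mod Suc m = t + m" unfolding T_def by (rule mult_div_mod_eq)
  moreover have "(t + m) mod Suc m < Suc m" by simp
  ultimately show "t \<le> Suc m * T" "Suc m * T \<le> t + m" by linarith+
qed

lemma div_Suc_cases: "0 < (k::nat) \<Longrightarrow> Suc d div k = d div k \<and> Suc d mod k = Suc (d mod k) \<or>
    Suc d div k = Suc (d div k) \<and> Suc d mod k = 0 \<and> Suc (d mod k) = k"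
  by (simp add: div_Suc mod_Suc)

section \<open>The hexagon of a good word\<close>

definition good_word :: "nat \<Rightarrow> nat \<Rightarrow> nat \<Rightarrow> nat \<Rightarrow> letter list" where
  "good_word i j n M = replicate i a @ concat (replicate M (b # replicate n a)) @ b # replicate j a"

context
  fixes i j n M :: nat
begin

text \<open>Here \<open>t\<close> and \<open>A\<close> count the letters \<open>b\<close> and \<open>a\<close> of a prefix. If the \<open>t\<close> letters \<open>b\<close> are
  distributed evenly over \<open>k\<close> copies of \<^term>\<open>good_word i j n M\<close>, the inequalities bound the number
  of letters \<open>a\<close> that these copies must, respectively can, have read.\<close>

definition in_region :: "nat \<Rightarrow> nat \<Rightarrow> nat \<Rightarrow> bool" where
  "in_region k t A \<longleftrightarrow> i * t \<le> A \<and> k * i + n * t \<le> A + n * k \<and> A \<le> k * i + n * t \<and>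
    A + j * (k * M) \<le> k * i + n * (k * M) + j * t"

definition region :: "nat \<Rightarrow> letter list \<Rightarrow> bool" where
  "region k x \<longleftrightarrow> count_list x b = k * (M + 1) \<and> count_list x a = k * (i + j + n * M) \<and>
    (\<forall>p. prefix p x \<longrightarrow> in_region k (count_list p b) (count_list p a))"

lemma in_region_add:
  "in_region k t A \<Longrightarrow> in_region k' t' A' \<Longrightarrow> in_region (k + k') (t + t') (A + A')"
  by (simp add: in_region_def algebra_simps)

context
  assumes i: "i \<le> n" and j: "j \<le> n" and n: "1 \<le> n"
begin

lemma good_word_prefix:
  fixes m :: nat
  assumes "prefix p (replicate i a @ concat (replicate m (b # replicate n a)))"
  shows "count_list p b \<le> m \<and> count_list p a \<le> i + n * count_list p b \<and>
    i + n * count_list p b \<le> count_list p a + n \<and> i * count_list p b \<le> count_list p a"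
  using assms
proof (induction m arbitrary: p)
  case 0
  then obtain r where "p = replicate r a" "r \<le> i" by (auto elim: prefix_replicateE)
  then show ?case using i by (simp add: count_list_0_iff)
next
  case (Suc m)
  define V where "V = replicate i a @ concat (replicate m (b # replicate n a))"
  have cnt: "count_list V b = m" "count_list V a = i + n * m"
    unfolding V_def by (induction m) simp_all
  have "concat (replicate (Suc m) (b # replicate n a)) = concat (replicate m (b # replicate n a)) @ b # replicate n a"
    by (induction m) simp_all
  then have "prefix p (V @ b # replicate n a)"
    using Suc.prems by (simp add: V_def)
  then consider "prefix p V" | r where "p = V @ b # replicate r a" "r \<le> n"
    unfolding prefix_append by (auto simp: prefix_Cons elim!: prefix_replicateE)
  then show ?case
  proof cases
    case 1
    then show ?thesis using Suc.IH[of p] by (simp add: V_def)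
  next
    case 2
    have "i * m \<le> n * m" using i by (rule mult_le_mono1)
    then have "i * m \<le> n * m + r" by linarith
    then show ?thesis using cnt 2 by simp
  qed
qed

lemma region_good_word: "region 1 (good_word i j n M)"
proof -
  define U where "U = replicate i a @ concat (replicate M (b # replicate n a))"
  have cnt: "count_list U b = M" "count_list U a = i + n * M"
    unfolding U_def by (induction M) simp_all
  have W: "good_word i j n M = U @ b # replicate j a" by (simp add: good_word_def U_def)
  have "in_region 1 (count_list p b) (count_list p a)" if p: "prefix p (good_word i j n M)" for p
  proof -
    from p consider "prefix p U" | r where "p = U @ b # replicate r a" "r \<le> j"
      unfolding W prefix_append by (auto simp: prefix_Cons elim!: prefix_replicateE)
    then show ?thesis
    proof cases
      case 1
      then have *: "count_list p b \<le> M" "count_list p a \<le> i + n * count_list p b"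
        "i + n * count_list p b \<le> count_list p a + n" "i * count_list p b \<le> count_list p a"
        using good_word_prefix[of p M] by (simp_all add: U_def)
      from *(1) obtain e where e: "M = count_list p b + e" using le_Suc_ex by blast
      have "j * e \<le> n * e" using j by simp
      then have "n * count_list p b + j * M \<le> n * M + j * count_list p b" by (simp add: e algebra_simps)
      then show ?thesis using * by (simp add: in_region_def)
    next
      case 2
      have "i * M \<le> n * M" using i by (rule mult_le_mono1)
      then have "i * M \<le> n * M + r" by linarith
      then show ?thesis using 2 cnt j by (simp add: in_region_def)
    qed
  qed
  then show ?thesis by (simp add: region_def) (simp add: W cnt)
qed

text \<open>At the first difference both \<open>p @ [a]\<close> and \<open>p @ [b]\<close> would lie
  in the hexagon of one copy. With \<open>t\<close> and \<open>A\<close> counting the letters of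
  \<open>p\<close>, the former requires \<open>A < i + n * t\<close> and the latter
  \<open>i + n * t \<le> A\<close>.\<close>

lemma region_1_unique:
  assumes "region 1 x" "region 1 y"
  shows "x = y"
proof (rule ccontr)
  assume "x \<noteq> y"
  have len: "length x = count_list x a + count_list x b" for x
  proof (induction x)
    case (Cons c x)
    then show ?case by (cases c) auto
  qed simp
  have "length x = length y" using assms by (simp add: len region_def)
  from same_length_first_difference[OF this \<open>x \<noteq> y\<close>] obtain p c x' d y' where
    xy: "x = p @ c # x'" "y = p @ d # y'" "c \<noteq> d" .
  have False if "region 1 (p @ a # x')" "region 1 (p @ b # y')" for x' y'
  proof -
    have "in_region 1 (count_list (p @ [a]) b) (count_list (p @ [a]) a)"
      "in_region 1 (count_list (p @ [b]) b) (count_list (p @ [b]) a)"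
    proof -
      have "prefix (p @ [a]) (p @ a # x')" "prefix (p @ [b]) (p @ b # y')" by simp_all
      with that show "in_region 1 (count_list (p @ [a]) b) (count_list (p @ [a]) a)"
        "in_region 1 (count_list (p @ [b]) b) (count_list (p @ [b]) a)"
        unfolding region_def by blast+
    qed
    then show False by (simp add: in_region_def)
  qed
  with xy assms show False by (cases c; cases d) auto
qed

lemma region_shuffles:
  assumes "z \<in> shuffles x y" "region k x" "region l y"
  shows "region (k + l) z"
proof -
  have "in_region (k + l) (count_list p b) (count_list p a)" if "prefix p z" for p
  proof -
    from that obtain r where "z = p @ r" by (auto simp: prefix_def)
    with assms(1) obtain x1 x2 y1 y2 where "x = x1 @ x2" "y = y1 @ y2" "p \<in> shuffles x1 y1"
      by (metis append_in_shufflesE)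
    then show ?thesis using assms(2,3) in_region_add
      by (simp add: region_def count_list_shuffles[of p x1 y1])
  qed
  then show ?thesis using assms
    by (simp add: region_def count_list_shuffles[OF assms(1)] algebra_simps)
qed

lemma shuffle_power_region: "x \<in> shuffle_power (good_word i j n M) k \<Longrightarrow> region k x"
proof (induction k arbitrary: x)
  case 0
  then show ?case by (simp add: region_def in_region_def)
next
  case (Suc k)
  then obtain y where "y \<in> shuffle_power (good_word i j n M) k" "x \<in> shuffles y (good_word i j n M)" by auto
  with Suc.IH region_good_word show ?case using region_shuffles[of x y "good_word i j n M" k 1] by simp
qed

text \<open>The copy to be extracted takes every \<open>k\<close>-th \<open>b\<close>, and each block of its \<open>a\<close>s consists of the
  earliest ones that the balanced distribution assigns to it.\<close>

context
  fixes m :: nat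
begin

definition stair :: "nat \<Rightarrow> nat" where
  "stair d = n * (d div (n * Suc m)) + min n (d mod (n * Suc m))"

definition copy_a :: "nat \<Rightarrow> nat" where
  "copy_a A = min (i + j + n * M) (min A i + stair (A - Suc m * i))"

definition copy_b :: "nat \<Rightarrow> nat" where
  "copy_b t = (t + m) div Suc m"

lemma stair_step: "stair (Suc d) = stair d \<or> stair (Suc d) = Suc (stair d)"
proof -
  have pos: "0 < n * Suc m" using n by simp
  from div_Suc_cases[OF pos, of d] show ?thesis
  proof (elim disjE conjE)
    assume "Suc d div (n * Suc m) = d div (n * Suc m)" "Suc d mod (n * Suc m) = Suc (d mod (n * Suc m))"
    then show ?thesis unfolding stair_def by (auto simp: min_def)
  next
    assume *: "Suc d div (n * Suc m) = Suc (d div (n * Suc m))" "Suc d mod (n * Suc m) = 0"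
      "Suc (d mod (n * Suc m)) = n * Suc m"
    have "n \<le> n * Suc m" by simp
    with *(3) have "n \<le> Suc (d mod (n * Suc m))" by simp
    then have "min n (d mod (n * Suc m)) = n \<or> Suc (min n (d mod (n * Suc m))) = n" by linarith
    then show ?thesis unfolding stair_def *(1,2) by auto
  qed
qed

lemma stair_0 [simp]: "stair 0 = 0"
  by (simp add: stair_def)

lemma stair_mono: "d \<le> d' \<Longrightarrow> stair d \<le> stair d'"
proof (rule lift_Suc_mono_le[of stair])
  show "stair d \<le> stair (Suc d)" for d using stair_step[of d] by auto
qed

lemma stair_le: "stair d \<le> d"
proof (induction d)
  case (Suc d)
  then show ?case using stair_step[of d] by auto
qed simp

text \<open>The share of the other copies is monotone as well, so it can be estimated at the extreme
  value of \<open>d\<close> that the region permits.\<close>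

lemma diff_stair_mono: "d \<le> d' \<Longrightarrow> d - stair d \<le> d' - stair d'"
proof (rule lift_Suc_mono_le[of "\<lambda>d. d - stair d"])
  show "d - stair d \<le> Suc d - stair (Suc d)" for d using stair_step[of d] by auto
qed

text \<open>In every period of \<open>n * Suc m\<close> steps \<open>stair\<close> rises during the
  first \<open>n\<close> and then rests, so it has reached \<open>n * u\<close> after
  \<open>u\<close> periods.\<close>

lemma stair_upper: "d \<le> n * (Suc m * u) \<Longrightarrow> stair d \<le> n * u"
proof -
  assume "d \<le> n * (Suc m * u)"
  then have "stair d \<le> stair ((n * Suc m) * u)" by (intro stair_mono) (simp only: mult.assoc)
  also have "\<dots> = n * u" using n unfolding stair_def by (simp del: mult_Suc mult_Suc_right)
  finally show ?thesis .
qed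

lemma stair_lower: "n * (Suc m * u) + r \<le> d \<Longrightarrow> r \<le> n \<Longrightarrow> n * u + r \<le> stair d"
proof -
  assume "n * (Suc m * u) + r \<le> d" and r: "r \<le> n"
  then have "stair ((n * Suc m) * u + r) \<le> stair d" by (intro stair_mono) (simp only: mult.assoc)
  moreover have "n * u + r \<le> stair ((n * Suc m) * u + r)"
  proof (cases "r < n * Suc m")
    case True
    then show ?thesis using n r unfolding stair_def by (simp del: mult_Suc mult_Suc_right)
  next
    case False
    then have "r = n * Suc m" using r by (simp add: not_less)
    moreover from this r n have "m = 0" by simp
    ultimately show ?thesis using n unfolding stair_def by simp
  qed
  ultimately show ?thesis by simp
qed

lemma copy_a_step: "copy_a (Suc A) = copy_a A \<or> copy_a (Suc A) = Suc (copy_a A)"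
proof -
  have cap: "min c X' = min c X \<or> min c X' = Suc (min c X)" if "X' = X \<or> X' = Suc X" for c X X' :: nat
    using that by (auto simp: min_def)
  show ?thesis
  proof (cases "A < Suc m * i")
    case True
    then have "Suc A - Suc m * i = 0" "A - Suc m * i = 0" by simp_all
    moreover have "min (Suc A) i = min A i \<or> min (Suc A) i = Suc (min A i)" by (auto simp: min_def)
    ultimately show ?thesis unfolding copy_a_def by (intro cap) auto
  next
    case False
    then have "min A i = i" "min (Suc A) i = i" "Suc A - Suc m * i = Suc (A - Suc m * i)" by auto
    then show ?thesis unfolding copy_a_def using stair_step[of "A - Suc m * i"] by (intro cap) auto
  qed
qed

lemma copy_b_step: "copy_b (Suc t) = copy_b t \<or> copy_b (Suc t) = Suc (copy_b t)"
  using div_Suc_cases[of "Suc m" "t + m"] by (auto simp: copy_b_def)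

text \<open>For \<open>t > 0\<close> write \<open>t = Suc m * u + Suc \<sigma>\<close> with
  \<open>\<sigma> \<le> m\<close>: the extracted copy has read \<open>u + 1\<close> letters
  \<open>b\<close> and the others together \<open>m * u + \<sigma>\<close>. Both
  \<open>stair d\<close> and \<open>d - stair d\<close> are monotone, so the bounds on the inner
  blocks are checked at extreme values of \<open>d\<close>. The cases \<open>u = 0\<close> and
  \<open>u = M\<close> are those in which the outer blocks of length \<open>i\<close> and
  \<open>j\<close> enter.\<close>

lemma extract_in_region:
  assumes reg: "in_region (Suc m) t A" and tM: "t \<le> Suc m * (M + 1)"
  shows "in_region 1 (copy_b t) (copy_a A) \<and> in_region m (t - copy_b t) (A - copy_a A)"
proof -
  note T_bounds = ceil_div_bounds[where t = t and m = m, folded copy_b_def]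
  from reg have h1: "i * t \<le> A" and h2: "Suc m * i + n * t \<le> A + n * Suc m"
    and h3: "A \<le> Suc m * i + n * t" and h4: "A + j * (Suc m * M) \<le> Suc m * i + n * (Suc m * M) + j * t"
    by (simp_all add: in_region_def)
  define d where "d = A - Suc m * i"
  have copy_a: "copy_a A = min (i + j + n * M) (min A i + stair d)" by (simp add: copy_a_def d_def)
  \<comment> \<open>Because \<open>j \<le> n\<close>, the upper line of slope \<open>n\<close>
    implies the one of slope \<open>j\<close> up to their meeting point; \<open>cross_i\<close> is
    the analogue for the two lower lines.\<close>
  have cross: "n * x + j * y \<le> n * y + j * x" if "x \<le> y" for x y
  proof -
    from that obtain e where "y = x + e" using le_Suc_ex by blast
    moreover have "j * e \<le> n * e" using j by simp
    ultimately show ?thesis by (simp add: algebra_simps)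
  qed
  have cross_i: "n * x + i * y \<le> n * y + i * x" if "x \<le> y" for x y
  proof -
    from that obtain e where "y = x + e" using le_Suc_ex by blast
    moreover have "i * e \<le> n * e" using i by simp
    ultimately show ?thesis by (simp add: algebra_simps)
  qed
  show ?thesis
  proof (cases "t = 0")
    case True
    then have T0: "copy_b t = 0" by (simp add: copy_b_def)
    have "A \<le> Suc m * i" using h3 True by simp
    then have "d = 0" by (simp add: d_def)
    then have F0: "copy_a A = min A i" unfolding copy_a by auto
    have T00: "copy_b 0 = 0" using T0 True by simp
    have ineqs: "m * i \<le> n * m" "j * (m * M) \<le> n * (m * M)" "j * M \<le> n * M"
      using i j mult_le_mono1[OF i, of m] by (simp_all add: mult.commute)
    have min: "min A i \<le> i" "A - min A i \<le> m * i" using \<open>A \<le> Suc m * i\<close> by auto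
    have "in_region 1 0 (min A i)"
      unfolding in_region_def mult_0_right mult_1 using ineqs min i by (intro conjI) linarith+
    moreover have "in_region m 0 (A - min A i)"
      unfolding in_region_def mult_0_right using ineqs min by (intro conjI) linarith+
    ultimately show ?thesis unfolding True T00 F0 by simp
  next
    case False
    then have "1 \<le> Suc m * copy_b t" using T_bounds by linarith
    then obtain u where u: "copy_b t = Suc u" by (cases "copy_b t") auto
    define \<rho> where "\<rho> = t - Suc m * u"
    have t: "t = Suc m * u + \<rho>" "1 \<le> \<rho>" "\<rho> \<le> Suc m"
      using T_bounds unfolding u \<rho>_def by (simp_all add: algebra_simps)
    have uM: "u \<le> M"
    proof (rule ccontr)
      assume "\<not> u \<le> M"
      then have "Suc m * (M + 1) \<le> Suc m * u" by (intro mult_le_mono2) simp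
      with tM t show False by linarith
    qed
    from t(2) obtain \<sigma> where \<sigma>: "\<rho> = Suc \<sigma>" by (cases \<rho>) auto
    have \<sigma>m: "\<sigma> \<le> m" using t(3) \<sigma> by simp
    have tu: "t = Suc m * u + Suc \<sigma>" using t(1) \<sigma> by simp
    have tT: "t - copy_b t = m * u + \<sigma>" unfolding u using tu by simp
    have G_up: "stair d \<le> n * Suc u"
    proof (rule stair_upper)
      have "n * t \<le> n * (Suc m * Suc u)" using tu \<sigma>m by (intro mult_le_mono2) simp
      with h3 show "d \<le> n * (Suc m * Suc u)" unfolding d_def by linarith
    qed
    have "n * u \<le> n * M" using uM by simp
    have F_low: "i + n * u \<le> copy_a A"
    proof (cases u)
      case 0
      have "i \<le> i * t" using tu by simp
      with h1 have "min A i = i" by linarith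
      then show ?thesis unfolding copy_a 0 by simp
    next
      case (Suc v)
      have "n * \<rho> + n * (Suc m * v) + Suc m * i \<le> A"
        using h2 unfolding t(1) Suc by (simp add: algebra_simps)
      moreover have "n \<le> n * \<rho>" using t(2) by simp
      ultimately have A: "Suc m * i \<le> A" "n * (Suc m * v) + n \<le> d" unfolding d_def by linarith+
      have "n * v + n \<le> stair d" using A(2) by (rule stair_lower) simp
      moreover have "min A i = i" using A(1) by simp
      ultimately show ?thesis using \<open>n * u \<le> n * M\<close> unfolding copy_a Suc by simp
    qed
    have F_up: "copy_a A \<le> i + n * Suc u" "copy_a A \<le> i + j + n * M" using G_up unfolding copy_a by auto
    have part1: "in_region 1 (copy_b t) (copy_a A)"
    proof -
      have "i * u \<le> n * u" using i by simp
      then have "i + i * u \<le> copy_a A" using F_low by linarith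
      moreover have "copy_a A + j * M \<le> i + n * M + j * Suc u"
      proof (cases "Suc u \<le> M")
        case True
        from cross[OF this] F_up show ?thesis by linarith
      next
        case False
        then have "u = M" using uM by simp
        then show ?thesis using F_up(2) by simp
      qed
      ultimately show ?thesis unfolding in_region_def u using F_low F_up by simp
    qed
    have low: "i * (m * u + \<sigma>) \<le> A - copy_a A \<and> m * i + n * (m * u + \<sigma>) \<le> A - copy_a A + n * m"
    proof (cases u)
      case 0
      have "i * \<sigma> \<le> A - copy_a A"
      proof (cases "A \<le> Suc m * i")
        case True
        then have "copy_a A \<le> i" unfolding copy_a d_def by simp
        moreover have "i + i * \<sigma> \<le> A" using h1 tu 0 by simp
        ultimately show ?thesis by linarith
      next
        case False
        then have "copy_a A \<le> i + d" using stair_le[of d] unfolding copy_a by auto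
        moreover have "A = m * i + i + d" using False by (simp add: d_def)
        moreover have "i * \<sigma> \<le> m * i" using \<sigma>m by (simp add: mult.commute)
        ultimately show ?thesis by linarith
      qed
      moreover have "m * i + n * \<sigma> \<le> i * \<sigma> + n * m" using cross_i[OF \<sigma>m] by (simp add: algebra_simps)
      ultimately show ?thesis by (simp add: 0)
    next
      case (Suc v)
      \<comment> \<open>The least \<open>d\<close> allowed by the lower line of slope
        \<open>n\<close>. In the cases below, \<open>d0\<close> is the greatest one allowed by the
        relevant upper line.\<close>
      define d0 where "d0 = n * (Suc m * v) + n * Suc \<sigma>"
      have "d0 + Suc m * i \<le> A"
        using h2 unfolding tu Suc d0_def by (simp add: algebra_simps)
      then have A: "A = Suc m * i + d" "d0 \<le> d" unfolding d_def by simp_all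
      have "stair d0 \<le> n * Suc v"
      proof (rule stair_upper)
        have "n * Suc \<sigma> \<le> n * Suc m" using \<sigma>m by simp
        then show "d0 \<le> n * (Suc m * Suc v)" unfolding d0_def by (simp add: algebra_simps)
      qed
      then have "n * (m * v) + n * \<sigma> \<le> d0 - stair d0" unfolding d0_def by (simp add: algebra_simps)
      also have "\<dots> \<le> d - stair d" by (rule diff_stair_mono[OF A(2)])
      finally have dG: "n * (m * v) + n * \<sigma> \<le> d - stair d" .
      have "copy_a A \<le> i + stair d" unfolding copy_a by simp
      moreover have "m * i + i + d = A" using A(1) by simp
      ultimately have "m * i + (d - stair d) \<le> A - copy_a A" using stair_le[of d] by linarith
      with dG have *: "m * i + n * (m * v) + n * \<sigma> \<le> A - copy_a A" by linarith
      have "i * (m * v) \<le> n * (m * v)" "i * \<sigma> \<le> n * \<sigma>" using i by simp_all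
      moreover have "i * (m * u + \<sigma>) = m * i + i * (m * v) + i * \<sigma>"
        unfolding Suc by (simp add: algebra_simps)
      ultimately have "i * (m * u + \<sigma>) \<le> m * i + n * (m * v) + n * \<sigma>" by linarith
      moreover have "m * i + n * (m * u + \<sigma>) = m * i + n * (m * v) + n * \<sigma> + n * m"
        unfolding Suc by (simp add: algebra_simps)
      ultimately show ?thesis using * by linarith
    qed
    have high: "A - copy_a A \<le> m * i + n * (m * u + \<sigma>) \<and>
      A - copy_a A + j * (m * M) \<le> m * i + n * (m * M) + j * (m * u + \<sigma>)"
    proof (cases "Suc u \<le> M")
      case True
      then have "n * Suc u \<le> n * M" by (rule mult_le_mono2)
      then have copy_a': "copy_a A = min A i + stair d" using G_up unfolding copy_a by auto
      have *: "A - copy_a A \<le> m * i + n * (m * u + \<sigma>)"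
      proof (cases "A \<le> Suc m * i")
        case True
        then have "A - min A i \<le> m * i" by auto
        then show ?thesis unfolding copy_a' by linarith
      next
        case False
        define d0 where "d0 = n * (Suc m * u) + n * Suc \<sigma>"
        have A: "A = Suc m * i + d" using False by (simp add: d_def)
        have "d \<le> d0" using h3 unfolding A tu d0_def by (simp add: algebra_simps)
        then have "d - stair d \<le> d0 - stair d0" by (rule diff_stair_mono)
        moreover have "n * u + n \<le> stair d0" unfolding d0_def by (rule stair_lower) simp_all
        ultimately have "d - stair d \<le> n * (m * u + \<sigma>)" unfolding d0_def by (simp add: algebra_simps)
        moreover have "min A i = i" using False by simp
        moreover have "A = m * i + i + d" using A by simp
        ultimately show ?thesis using copy_a' by linarith
      qed
      have "m * Suc u \<le> m * M" using True by (rule mult_le_mono2)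
      then have "m * u + \<sigma> \<le> m * M" using \<sigma>m by simp
      from * cross[OF this] show ?thesis by linarith
    next
      case False
      then have uM': "u = M" using uM by simp
      have A_le: "A \<le> Suc m * i + n * (Suc m * M) + j * Suc \<sigma>"
        using h4 unfolding tu uM' by (simp add: algebra_simps)
      have *: "A - copy_a A \<le> m * i + n * (m * M) + j * \<sigma>"
      proof (cases "copy_a A = i + j + n * M")
        case True
        then show ?thesis using A_le by (simp add: algebra_simps)
      next
        case False
        then have copy_a': "copy_a A = min A i + stair d" unfolding copy_a by linarith
        show ?thesis
        proof (cases "A \<le> Suc m * i")
          case True
          then have "A - min A i \<le> m * i" by auto
          then show ?thesis unfolding copy_a' by linarith
        next
          case False
          define d0 where "d0 = n * (Suc m * M) + j * Suc \<sigma>"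
          have A: "A = Suc m * i + d" using False by (simp add: d_def)
          have "d \<le> d0" using A_le unfolding A d0_def by linarith
          then have "d - stair d \<le> d0 - stair d0" by (rule diff_stair_mono)
          moreover have "n * M + j \<le> stair d0" unfolding d0_def by (rule stair_lower) (use j in simp_all)
          ultimately have "d - stair d \<le> n * (m * M) + j * \<sigma>" unfolding d0_def by (simp add: algebra_simps)
          moreover have "min A i = i" using False by simp
          moreover have "A = m * i + i + d" using A by simp
        ultimately show ?thesis using copy_a' by linarith
        qed
      qed
      have "j * \<sigma> \<le> n * \<sigma>" using j by simp
      with * show ?thesis unfolding uM' distrib_left by linarith
    qed
    from part1 low high show ?thesis unfolding in_region_def[of m] tT by blast
  qed
qed

end

lemma region_extract:
  assumes "region (Suc m) x"
  obtains x' y where "x \<in> shuffles x' y" "region 1 y" "region m x'"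
proof -
  have tot: "count_list x b = Suc m * (M + 1)" "count_list x a = Suc m * (i + j + n * M)"
    using assms by (simp_all add: region_def)
  have F0: "copy_a m 0 = 0" "copy_b m 0 = 0" by (simp_all add: copy_a_def copy_b_def)
  obtain x' y where sh: "x \<in> shuffles x' y" and y: "tracks (copy_a m) (copy_b m) x y"
    and x': "tracks (\<lambda>t. t - copy_a m t) (\<lambda>t. t - copy_b m t) x x'"
    using count_based_split[of "copy_a m" "copy_b m" x, OF F0(1) copy_a_step F0(2) copy_b_step] by blast
  have pts: "in_region 1 (copy_b m (count_list p b)) (copy_a m (count_list p a)) \<and>
      in_region m (count_list p b - copy_b m (count_list p b)) (count_list p a - copy_a m (count_list p a))"
    if "prefix p x" for p
  proof (rule extract_in_region)
    show "in_region (Suc m) (count_list p b) (count_list p a)" using assms that by (simp add: region_def)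
    from that have "count_list p b \<le> count_list x b" by (auto simp: prefix_def)
    then show "count_list p b \<le> Suc m * (M + 1)" by (simp only: tot)
  qed
  have Tt: "copy_b m (count_list x b) = M + 1"
  proof -
    have "Suc m * (M + 1) + m = m + (M + 1) * Suc m" by simp
    then show ?thesis unfolding copy_b_def tot by (simp only: div_mult_self1 div_less lessI)
  qed
  have Ft: "copy_a m (count_list x a) = i + j + n * M"
  proof -
    have "n * M + j \<le> stair m (Suc m * (i + j + n * M) - Suc m * i)"
      by (rule stair_lower) (use j in \<open>simp_all add: algebra_simps\<close>)
    moreover have "min (Suc m * (i + j + n * M)) i = i" by simp
    ultimately show ?thesis unfolding copy_a_def tot by simp
  qed
  have "region 1 y" unfolding region_def using y[unfolded tracks_def] pts Tt Ft by fastforce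
  moreover have "region m x'" unfolding region_def
    using x'[unfolded tracks_def] pts Tt Ft tot by fastforce
  ultimately show thesis using that sh by blast
qed

lemma region_shuffle_power: "region k x \<Longrightarrow> x \<in> shuffle_power (good_word i j n M) k"
proof (induction k arbitrary: x)
  case 0
  then have "count_list x a = 0" "count_list x b = 0" by (simp_all add: region_def)
  then have "set x = {}" by (metis count_list_0_iff equals0I letter.exhaust)
  then show ?case by simp
next
  case (Suc k)
  from region_extract[OF Suc.prems] obtain x' y where
    *: "x \<in> shuffles x' y" "region 1 y" "region k x'" .
  have "y = good_word i j n M" using *(2) region_good_word by (rule region_1_unique)
  with * Suc.IH[of x'] show ?case by auto
qed

end

end

section \<open>Two shuffles whose difference again lies in a hexagon\<close>

lemma derives_refl: "derives {w} x x"
  unfolding derives_def by simp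

lemma finite_UNIV_letter: "finite (UNIV :: letter set)"
proof -
  have "(UNIV :: letter set) = {a, b}" using letter.exhaust by auto
  moreover have "finite {a, b}" by simp
  ultimately show ?thesis by (simp only:)
qed

lemma split_at_count:
  "m \<le> count_list x c \<Longrightarrow> \<exists>p s. x = p @ s \<and> count_list p c = m"
proof (induction x arbitrary: m)
  case (Cons d x)
  show ?case
  proof (cases "m = 0")
    case True
    then show ?thesis by (intro exI[of _ "[]"] exI[of _ "d # x"]) simp
  next
    case False
    then have "(if d = c then m - 1 else m) \<le> count_list x c" using Cons.prems by auto
    from Cons.IH[OF this] obtain p s where "x = p @ s" "count_list p c = (if d = c then m - 1 else m)" by blast
    then show ?thesis using False by (intro exI[of _ "d # p"] exI[of _ s]) auto
  qed
qed simp

text \<open>The subsequence consists of the indices where \<open>k\<close> exceeds all its earlier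
  values.\<close>

lemma unbounded_strict_mono_subseq:
  fixes k :: "nat \<Rightarrow> nat"
  assumes "infinite (range k)"
  obtains \<theta> :: "nat \<Rightarrow> nat" where "strict_mono \<theta>" "strict_mono (\<lambda>l. k (\<theta> l))"
proof -
  define I where "I = {l. \<forall>l'<l. k l' < k l}"
  have "\<exists>l\<in>I. N < l" for N
  proof -
    define m where "m = Max (k ` {..N})"
    have m: "k l \<le> m" if "l \<le> N" for l using that by (simp add: m_def)
    have ex: "\<exists>l. m < k l"
    proof (rule ccontr)
      assume "\<not> (\<exists>l. m < k l)"
      then have "range k \<subseteq> {..m}" by (auto simp: not_less)
      with assms show False using finite_subset by blast
    qed
    define l where "l = (LEAST l. m < k l)"
    have l: "m < k l" unfolding l_def using ex by (rule LeastI_ex)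
    have "k l' \<le> m" if "l' < l" for l' using not_less_Least[of l' "\<lambda>l. m < k l"] that by (simp add: l_def)
    with l have "l \<in> I" unfolding I_def by force
    moreover have "N < l" using l m[of l] by (cases "l \<le> N") auto
    ultimately show ?thesis by blast
  qed
  then have "infinite I" unfolding infinite_nat_iff_unbounded by blast
  from infinite_strict_mono[OF this] obtain \<theta> :: "nat \<Rightarrow> nat" where
    \<theta>: "strict_mono \<theta>" "\<And>l. \<theta> l \<in> I" by blast
  have "strict_mono (\<lambda>l. k (\<theta> l))"
    using \<theta> unfolding strict_mono_def I_def by blast
  with \<theta>(1) that show thesis by blast
qed

lemma count_list_prefix: "prefix p x \<Longrightarrow> count_list p c \<le> count_list x c"
  by (auto simp: prefix_def)

context
  fixes i j n M :: nat
  assumes i: "i \<le> n" and j: "j \<le> n" and n: "1 \<le> n"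
begin

abbreviation "h1 \<equiv> \<lambda>(K::nat) p. wt i p"
abbreviation "h2 \<equiv> \<lambda>(K::nat) p. (int n - int i) * int K + wt n p"
abbreviation "h3 \<equiv> \<lambda>(K::nat) p. int i * int K - wt n p"
abbreviation "h4 \<equiv> \<lambda>(K::nat) p. (int i + (int n - int j) * int M) * int K - wt j p"

lemma in_region_iff:
  "in_region i j n M K (count_list p b) (count_list p a) \<longleftrightarrow> 0 \<le> h1 K p \<and> 0 \<le> h2 K p \<and> 0 \<le> h3 K p \<and> 0 \<le> h4 K p"
proof -
  define t A where "t = count_list p b" and "A = count_list p a"
  have "i * t \<le> A \<longleftrightarrow> int i * int t \<le> int A" by (simp only: of_nat_mult[symmetric] of_nat_le_iff)
  moreover have "K * i + n * t \<le> A + n * K \<longleftrightarrow> int K * int i + int n * int t \<le> int A + int n * int K"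
    by (simp only: of_nat_add[symmetric] of_nat_mult[symmetric] of_nat_le_iff)
  moreover have "A \<le> K * i + n * t \<longleftrightarrow> int A \<le> int K * int i + int n * int t"
    by (simp only: of_nat_add[symmetric] of_nat_mult[symmetric] of_nat_le_iff)
  moreover have "A + j * (K * M) \<le> K * i + n * (K * M) + j * t \<longleftrightarrow>
      int A + int j * (int K * int M) \<le> int K * int i + int n * (int K * int M) + int j * int t"
    by (simp only: of_nat_add[symmetric] of_nat_mult[symmetric] of_nat_le_iff)
  ultimately show ?thesis
    unfolding in_region_def wt_def t_def[symmetric] A_def[symmetric]
    by (simp add: algebra_simps)
qed

text \<open>So the lower bound is decided by \<open>h1\<close> up to \<open>t = K\<close> and by
  \<open>h2\<close> beyond it. In the same way \<open>h3\<close> and \<open>h4\<close> exchange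
  roles at \<open>t = M * K\<close>.\<close>

lemma h1_h2: "h2 K p = h1 K p + (int n - int i) * (int K - int (count_list p b))"
  by (simp add: wt_def algebra_simps)

lemma h3_h4: "h4 K p = h3 K p + (int n - int j) * (int M * int K - int (count_list p b))"
  by (simp add: wt_def algebra_simps)

lemma h2_if_h1: "count_list p b \<le> K \<Longrightarrow> 0 \<le> h1 K p \<Longrightarrow> 0 \<le> h2 K p"
  unfolding h1_h2 using i by simp

lemma h1_if_h2: "K \<le> count_list p b \<Longrightarrow> 0 \<le> h2 K p \<Longrightarrow> 0 \<le> h1 K p"
proof -
  assume "K \<le> count_list p b" "0 \<le> h2 K p"
  moreover have "(int n - int i) * (int K - int (count_list p b)) \<le> 0"
    using i \<open>K \<le> _\<close> by (simp add: mult_nonneg_nonpos)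
  ultimately show ?thesis unfolding h1_h2 by linarith
qed

lemma h4_if_h3: "count_list p b \<le> M * K \<Longrightarrow> 0 \<le> h3 K p \<Longrightarrow> 0 \<le> h4 K p"
proof -
  assume "count_list p b \<le> M * K" "0 \<le> h3 K p"
  then have "int (count_list p b) \<le> int M * int K" by (simp only: of_nat_mult[symmetric] of_nat_le_iff)
  then have "0 \<le> (int n - int j) * (int M * int K - int (count_list p b))" using j by simp
  then show ?thesis using \<open>0 \<le> h3 K p\<close> unfolding h3_h4 by linarith
qed

lemma h3_if_h4: "M * K \<le> count_list p b \<Longrightarrow> 0 \<le> h4 K p \<Longrightarrow> 0 \<le> h3 K p"
proof -
  assume "M * K \<le> count_list p b" "0 \<le> h4 K p"
  then have "int M * int K \<le> int (count_list p b)" by (simp only: of_nat_mult[symmetric] of_nat_le_iff)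
  then have "(int n - int j) * (int M * int K - int (count_list p b)) \<le> 0"
    using j by (simp add: mult_nonneg_nonpos)
  then show ?thesis using \<open>0 \<le> h4 K p\<close> unfolding h3_h4 by linarith
qed

lemma h1_trivial: "i = 0 \<Longrightarrow> 0 \<le> h1 K p"
  by (simp add: wt_def)

text \<open>For \<open>j = 0\<close> the last line is horizontal at the total number of letters
  \<open>a\<close>.\<close>

lemma h4_trivial: "j = 0 \<Longrightarrow> count_list p a \<le> K * (i + j + n * M) \<Longrightarrow> 0 \<le> h4 K p"
proof -
  assume "j = 0" "count_list p a \<le> K * (i + j + n * M)"
  then have "int (count_list p a) \<le> int K * (int i + int n * int M)"
    by (simp only: of_nat_add[symmetric] of_nat_mult[symmetric] of_nat_le_iff add_0_right)
  then show ?thesis using \<open>j = 0\<close> by (simp add: wt_def algebra_simps)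
qed

lemma region_shuffles_diff:
  assumes "region i j n M k x" "region i j n M k' x'" "x' \<in> shuffles x z" "k \<le> k'"
  shows "count_list z b = (k' - k) * (M + 1)" "count_list z a = (k' - k) * (i + j + n * M)"
proof -
  have "count_list x b = k * (M + 1)" "count_list x' b = k' * (M + 1)"
    "count_list x a = k * (i + j + n * M)" "count_list x' a = k' * (i + j + n * M)"
    using assms(1,2) unfolding region_def by blast+
  with count_list_shuffles[OF assms(3), of a] count_list_shuffles[OF assms(3), of b]
  show "count_list z b = (k' - k) * (M + 1)" "count_list z a = (k' - k) * (i + j + n * M)"
    unfolding diff_mult_distrib by linarith+
qed

context
  fixes x :: "nat \<Rightarrow> letter list" and k :: "nat \<Rightarrow> nat"
  assumes reg: "\<And>l. region i j n M (k l) (x l)" and k: "strict_mono k"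
    and k_ge: "\<And>l. 4 * (1 + 2 * n) \<le> k l"
begin

lemma points:
  assumes "prefix p (x l)"
  shows "0 \<le> h1 (k l) p" "0 \<le> h2 (k l) p" "0 \<le> h3 (k l) p" "0 \<le> h4 (k l) p"
  using reg[of l] assms in_region_iff[of "k l" p] by (simp_all add: region_def)

lemma length_x: "length (x l) \<le> (i + j + n * M + M + 1) * k l"
proof -
  have len: "length x = count_list x a + count_list x b" for x
  proof (induction x)
    case (Cons c x)
    then show ?case by (cases c) auto
  qed simp
  show ?thesis using reg[of l] by (simp add: region_def len algebra_simps)
qed

lemma k_less: "l < l' \<Longrightarrow> k l \<le> k l'"
  using k by (simp add: strict_mono_less_eq)

lemma k_ge': "q1 \<le> n \<Longrightarrow> q2 \<le> n \<Longrightarrow> 4 * (1 + q1 + q2) \<le> k l"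
  using k_ge[of l] by (simp add: algebra_simps)

text \<open>The lower boundary of the region changes its slope at \<open>t = k\<close> and the upper one at \<open>t = k M\<close>.
  For \<open>M = 0\<close> these are the end points of the range of \<open>t\<close>, otherwise words are cut there.\<close>

lemma region_pair_single_zone:
  assumes M: "M = 0"
  shows "\<exists>l l'. l < l' \<and> (\<exists>z. x l' \<in> shuffles (x l) z \<and> region i j n M (k l' - k l) z)"
proof -
  \<comment> \<open>The width is \<open>i * (k - t) + j * t\<close>. It is at least \<open>k\<close>
    unless \<open>i = 0\<close> or \<open>j = 0\<close>, and the flags drop the line that is then
    automatic.\<close>
  have "almost_full (fills k 0 (int i) i j (i = 0) (j = 0) (\<lambda>_. []) x)"
  proof (rule almost_full_fills[OF k])
    fix l p assume p: "prefix p (x l)"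
    show "0 \<le> lo k 0 i l ([] @ p)" using points(1)[OF p] by (simp add: lo_def)
    show "0 \<le> hi k (int i) j l ([] @ p)" using points(4)[OF p] M by (simp add: hi_def)
  next
    show "length ([] @ x l) \<le> (i + j + n * M + M + 1) * k l" for l using length_x by simp
  next
    have "int (k l) \<le> lo k 0 i l ([] @ p) + hi k (int i) j l ([] @ p)"
      if p: "prefix p (x l)" and ij: "i \<noteq> 0" "j \<noteq> 0" for l p
    proof -
      have "count_list p b \<le> k l" using count_list_prefix[OF p, of b] reg[of l] M by (simp add: region_def)
      then have "int (k l) - int (count_list p b) \<le> int i * (int (k l) - int (count_list p b))"
        using ij by (simp add: mult_le_cancel_right1)
      moreover have "int (count_list p b) \<le> int j * int (count_list p b)" using ij by (simp add: mult_le_cancel_right1)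
      moreover have "lo k 0 i l ([] @ p) + hi k (int i) j l ([] @ p) =
          int i * (int (k l) - int (count_list p b)) + int j * int (count_list p b)"
        by (simp add: lo_def hi_def wt_def algebra_simps)
      ultimately show ?thesis by linarith
    qed
    then show "i = 0 \<or> j = 0 \<or> (\<forall>l p. prefix p (x l) \<longrightarrow>
        int (k l) \<le> lo k 0 i l ([] @ p) + hi k (int i) j l ([] @ p))" by blast
  next
    show "4 * (1 + i + j) \<le> k l" for l using i j by (rule k_ge')
  qed
  from this[unfolded almost_full_def, rule_format, of "\<lambda>l. l"] obtain l l' where
    ll: "l < l'" "fills k 0 (int i) i j (i = 0) (j = 0) (\<lambda>_. []) x l l'"
    by (auto simp: strict_mono_def)
  then obtain z where z: "x l' \<in> shuffles (x l) z" and
    zp: "\<And>p. prefix p z \<Longrightarrow> (i = 0 \<or> 0 \<le> lo k 0 i l' ([] @ p) - lo k 0 i l []) \<and>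
      (j = 0 \<or> 0 \<le> hi k (int i) j l' ([] @ p) - hi k (int i) j l [])"
    unfolding fills_def by blast
  define K where "K = k l' - k l"
  have K: "int K = int (k l') - int (k l)" using k_less[OF ll(1)] by (simp add: K_def)
  note cnt = region_shuffles_diff[OF reg reg z k_less[OF ll(1)], folded K_def]
  have "in_region i j n M K (count_list p b) (count_list p a)" if p: "prefix p z" for p
  proof -
    have t: "count_list p b \<le> K" using count_list_prefix[OF p, of b] cnt M by simp
    have A: "count_list p a \<le> K * (i + j + n * M)" using count_list_prefix[OF p, of a] cnt by simp
    have 1: "0 \<le> h1 K p"
      using zp[OF p] h1_trivial by (auto simp: lo_def)
    have 4: "0 \<le> h4 K p"
      using zp[OF p] h4_trivial[OF _ A] M by (auto simp: hi_def K algebra_simps)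
    have 3: "0 \<le> h3 K p" using 4 by (rule h3_if_h4[rotated]) (simp add: M)
    from 1 4 3 h2_if_h1[OF t 1] show ?thesis unfolding in_region_iff by blast
  qed
  then have "region i j n M K z" using cnt by (simp add: region_def)
  with ll z show ?thesis unfolding K_def by blast
qed

lemma region_pair_three_zones:
  assumes M: "1 \<le> M"
  shows "\<exists>l l'. l < l' \<and> (\<exists>z. x l' \<in> shuffles (x l) z \<and> region i j n M (k l' - k l) z)"
proof -
  have "\<exists>u v w. x l = u @ v @ w \<and> count_list u b = k l \<and> count_list (u @ v) b = M * k l" for l
  proof -
    have "M * k l \<le> count_list (x l) b" using reg[of l] by (simp add: region_def)
    from split_at_count[OF this] obtain u' w where 1: "x l = u' @ w" "count_list u' b = M * k l" by blast
    have "k l \<le> count_list u' b" using 1 M by simp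
    from split_at_count[OF this] obtain u v where "u' = u @ v" "count_list u b = k l" by blast
    with 1 show ?thesis by (intro exI[of _ u] exI[of _ v] exI[of _ w]) simp
  qed
  then obtain x1 x2 x3 where x: "\<And>l. x l = x1 l @ x2 l @ x3 l"
    and x1: "\<And>l. count_list (x1 l) b = k l" and x12: "\<And>l. count_list (x1 l @ x2 l) b = M * k l"
    by metis
  have len: "length (x1 l) + length (x2 l) + length (x3 l) \<le> (i + j + n * M + M + 1) * k l" for l
    using length_x[of l] by (simp add: x)
  have p1: "prefix p (x l)" if "prefix p (x1 l)" for p l using that by (simp add: x prefix_append)
  have p2: "prefix (x1 l @ p) (x l)" if "prefix p (x2 l)" for p l using that by (simp add: x prefix_append)
  have p3: "prefix ((x1 l @ x2 l) @ p) (x l)" if "prefix p (x3 l)" for p l using that by (simp add: x)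
  define c3 where "c3 = int i + (int n - int j) * int M"
  \<comment> \<open>Slope \<open>i\<close> below and \<open>n\<close> above: the width is
    \<open>i * k + (n - i) * t\<close>, at least \<open>k\<close> unless
    \<open>i = 0\<close>.\<close>
  have af1: "almost_full (fills k 0 (int i) i n (i = 0) False (\<lambda>_. []) x1)"
  proof (rule almost_full_fills[OF k])
    fix l p assume p: "prefix p (x1 l)"
    show "0 \<le> lo k 0 i l ([] @ p)" using points(1)[OF p1[OF p]] by (simp add: lo_def)
    show "0 \<le> hi k (int i) n l ([] @ p)" using points(3)[OF p1[OF p]] by (simp add: hi_def)
  next
    show "length ([] @ x1 l) \<le> (i + j + n * M + M + 1) * k l" for l using len[of l] by simp
  next
    have "int (k l) \<le> lo k 0 i l ([] @ p) + hi k (int i) n l ([] @ p)" if "i \<noteq> 0" for l p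
    proof -
      have "int (k l) \<le> int i * int (k l)" using that by (simp add: mult_le_cancel_right1)
      moreover have "0 \<le> (int n - int i) * int (count_list p b)" using i by simp
      moreover have "lo k 0 i l ([] @ p) + hi k (int i) n l ([] @ p) =
          int i * int (k l) + (int n - int i) * int (count_list p b)"
        by (simp add: lo_def hi_def wt_def algebra_simps)
      ultimately show ?thesis by linarith
    qed
    then show "i = 0 \<or> False \<or> (\<forall>l p. prefix p (x1 l) \<longrightarrow>
        int (k l) \<le> lo k 0 i l ([] @ p) + hi k (int i) n l ([] @ p))" by blast
  next
    show "4 * (1 + i + n) \<le> k l" for l using i order_refl by (rule k_ge')
  qed
  \<comment> \<open>Parallel lines at distance \<open>n * k\<close>.\<close>
  have af2: "almost_full (fills k (int n - int i) (int i) n n False False x1 x2)"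
  proof (rule almost_full_fills[OF k])
    fix l p assume p: "prefix p (x2 l)"
    show "0 \<le> lo k (int n - int i) n l (x1 l @ p)" using points(2)[OF p2[OF p]] by (simp add: lo_def)
    show "0 \<le> hi k (int i) n l (x1 l @ p)" using points(3)[OF p2[OF p]] by (simp add: hi_def)
  next
    show "length (x1 l @ x2 l) \<le> (i + j + n * M + M + 1) * k l" for l using len[of l] by simp
  next
    have "int (k l) \<le> lo k (int n - int i) n l (x1 l @ p) + hi k (int i) n l (x1 l @ p)" for l p
    proof -
      have "int (k l) \<le> int n * int (k l)" using n by (simp add: mult_le_cancel_right1)
      then show ?thesis by (simp add: lo_def hi_def algebra_simps)
    qed
    then show "False \<or> False \<or> (\<forall>l p. prefix p (x2 l) \<longrightarrow>
        int (k l) \<le> lo k (int n - int i) n l (x1 l @ p) + hi k (int i) n l (x1 l @ p))" by blast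
  next
    show "4 * (1 + n + n) \<le> k l" for l by (rule k_ge') simp_all
  qed
  \<comment> \<open>Slope \<open>n\<close> below and \<open>j\<close> above: the width is
    \<open>j * k + (n - j) * (M * k + k - t)\<close>, at least \<open>k\<close> unless
    \<open>j = 0\<close>.\<close>
  have af3: "almost_full (fills k (int n - int i) c3 n j False (j = 0) (\<lambda>l. x1 l @ x2 l) x3)"
  proof (rule almost_full_fills[OF k])
    fix l p assume p: "prefix p (x3 l)"
    show "0 \<le> lo k (int n - int i) n l ((x1 l @ x2 l) @ p)" using points(2)[OF p3[OF p]] by (simp add: lo_def)
    show "0 \<le> hi k c3 j l ((x1 l @ x2 l) @ p)" using points(4)[OF p3[OF p]] by (simp add: hi_def c3_def)
  next
    show "length ((x1 l @ x2 l) @ x3 l) \<le> (i + j + n * M + M + 1) * k l" for l using len[of l] by simp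
  next
    have "int (k l) \<le> lo k (int n - int i) n l ((x1 l @ x2 l) @ p) + hi k c3 j l ((x1 l @ x2 l) @ p)"
      if p: "prefix p (x3 l)" and j0: "j \<noteq> 0" for l p
    proof -
      define t where "t = count_list ((x1 l @ x2 l) @ p) b"
      have "t \<le> M * k l + k l"
        using count_list_prefix[OF p3[OF p], of b] reg[of l] by (simp add: t_def region_def algebra_simps)
      then have "int t \<le> int M * int (k l) + int (k l)" by (simp only: of_nat_add[symmetric] of_nat_mult[symmetric] of_nat_le_iff)
      then have "0 \<le> (int n - int j) * (int M * int (k l) + int (k l) - int t)" using j by simp
      moreover have "int (k l) \<le> int j * int (k l)" using j0 by (simp add: mult_le_cancel_right1)
      moreover have "lo k (int n - int i) n l ((x1 l @ x2 l) @ p) + hi k c3 j l ((x1 l @ x2 l) @ p) =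
          int j * int (k l) + (int n - int j) * (int M * int (k l) + int (k l) - int t)"
        unfolding lo_def hi_def c3_def wt_def t_def[symmetric] by (simp add: algebra_simps)
      ultimately show ?thesis by linarith
    qed
    then show "False \<or> j = 0 \<or> (\<forall>l p. prefix p (x3 l) \<longrightarrow>
        int (k l) \<le> lo k (int n - int i) n l ((x1 l @ x2 l) @ p) + hi k c3 j l ((x1 l @ x2 l) @ p))" by blast
  next
    show "4 * (1 + n + j) \<le> k l" for l using order_refl j by (rule k_ge')
  qed
  from almost_full_conj[OF af1 almost_full_conj[OF af2 af3],
      unfolded almost_full_def, rule_format, of "\<lambda>l. l"] obtain l l' where
    ll: "l < l'" "fills k 0 (int i) i n (i = 0) False (\<lambda>_. []) x1 l l'"
    "fills k (int n - int i) (int i) n n False False x1 x2 l l'"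
    "fills k (int n - int i) c3 n j False (j = 0) (\<lambda>l. x1 l @ x2 l) x3 l l'"
    by (auto simp: strict_mono_def)
  define K where "K = k l' - k l"
  have K: "int K = int (k l') - int (k l)" using k_less[OF ll(1)] by (simp add: K_def)
  from ll(2) obtain z1 where z1: "x1 l' \<in> shuffles (x1 l) z1" and
    zp1: "\<And>p. prefix p z1 \<Longrightarrow> (i = 0 \<or> 0 \<le> lo k 0 i l' ([] @ p) - lo k 0 i l []) \<and>
      0 \<le> hi k (int i) n l' ([] @ p) - hi k (int i) n l []"
    unfolding fills_def by blast
  from ll(3) obtain z2 where z2: "x2 l' \<in> shuffles (x2 l) z2" and
    zp2: "\<And>p. prefix p z2 \<Longrightarrow> 0 \<le> lo k (int n - int i) n l' (x1 l' @ p) - lo k (int n - int i) n l (x1 l) \<and>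
      0 \<le> hi k (int i) n l' (x1 l' @ p) - hi k (int i) n l (x1 l)"
    unfolding fills_def by blast
  from ll(4) obtain z3 where z3: "x3 l' \<in> shuffles (x3 l) z3" and
    zp3: "\<And>p. prefix p z3 \<Longrightarrow>
      0 \<le> lo k (int n - int i) n l' ((x1 l' @ x2 l') @ p) - lo k (int n - int i) n l (x1 l @ x2 l) \<and>
      (j = 0 \<or> 0 \<le> hi k c3 j l' ((x1 l' @ x2 l') @ p) - hi k c3 j l (x1 l @ x2 l))"
    unfolding fills_def by blast
  define z where "z = z1 @ z2 @ z3"
  have z: "x l' \<in> shuffles (x l) z"
    unfolding x z_def by (intro append_in_shuffles z1 z2 z3)
  note cnt = region_shuffles_diff[OF reg reg z k_less[OF ll(1)], folded K_def]
  have z1b: "count_list z1 b = K" using count_list_shuffles[OF z1, of b] x1 by (simp add: K_def)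
  have z12b: "count_list (z1 @ z2) b = M * K"
    using count_list_shuffles[OF append_in_shuffles[OF z1 z2], of b] x12 by (simp add: K_def diff_mult_distrib2)
  have wt1: "wt q (x1 l') = wt q (x1 l) + wt q z1" for q using z1 by (rule wt_shuffles)
  have wt2: "wt q (x2 l') = wt q (x2 l) + wt q z2" for q using z2 by (rule wt_shuffles)
  have KM: "K \<le> M * K" using M by simp
  have "in_region i j n M K (count_list p b) (count_list p a)" if p: "prefix p z" for p
  proof -
    have A: "count_list p a \<le> K * (i + j + n * M)" using count_list_prefix[OF p, of a] cnt by simp
    from p consider "prefix p z1" | p' where "p = z1 @ p'" "prefix p' z2"
      | p' where "p = (z1 @ z2) @ p'" "prefix p' z3"
      unfolding z_def prefix_append by auto
    then show ?thesis
    proof cases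
      case 1
      have t: "count_list p b \<le> K" using count_list_prefix[OF 1, of b] z1b by simp
      have h1: "0 \<le> h1 K p" using zp1[OF 1] h1_trivial by (auto simp: lo_def)
      have h3: "0 \<le> h3 K p" using zp1[OF 1] by (simp add: hi_def K algebra_simps)
      have t': "count_list p b \<le> M * K" using t KM by linarith
      from h1 h3 h2_if_h1[OF t h1] h4_if_h3[OF t' h3] show ?thesis unfolding in_region_iff by blast
    next
      case 2
      have t: "K \<le> count_list p b" using z1b 2 by simp
      have t': "count_list p b \<le> M * K" using count_list_prefix[OF 2(2), of b] z12b 2 by simp
      have h2: "0 \<le> h2 K p" using zp2[OF 2(2)] wt1[of n] by (simp add: lo_def K 2 algebra_simps)
      have h3: "0 \<le> h3 K p" using zp2[OF 2(2)] wt1[of n] by (simp add: hi_def K 2 algebra_simps)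
      from h2 h3 h1_if_h2[OF t h2] h4_if_h3[OF t' h3] show ?thesis unfolding in_region_iff by blast
    next
      case 3
      have t': "M * K \<le> count_list p b" using z12b 3 by simp
      then have t: "K \<le> count_list p b" using KM by linarith
      have h2: "0 \<le> h2 K p" using zp3[OF 3(2)] wt1[of n] wt2[of n] by (simp add: lo_def K 3 algebra_simps)
      have h4: "0 \<le> h4 K p"
      proof (cases "j = 0")
        case True
        then show ?thesis using A by (rule h4_trivial)
      next
        case False
        then show ?thesis using zp3[OF 3(2)] wt1[of j] wt2[of j]
          unfolding c3_def[symmetric] by (simp add: hi_def K 3 algebra_simps)
      qed
      from h2 h4 h1_if_h2[OF t h2] h3_if_h4[OF t' h4] show ?thesis unfolding in_region_iff by blast
    qed
  qed
  then have "region i j n M K z" using cnt by (simp add: region_def)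
  with ll(1) z show ?thesis unfolding K_def by blast
qed

end

lemma wqo_on_good_word:
  "wqo_on (derives {good_word i j n M}) (lang_eps {good_word i j n M})"
  unfolding wqo_on_def
proof (intro allI impI)
  fix f :: "nat \<Rightarrow> letter list"
  assume "\<forall>l. f l \<in> lang_eps {good_word i j n M}"
  then obtain k0 where k0: "\<And>l. f l \<in> shuffle_power (good_word i j n M) (k0 l)"
    unfolding lang_eps_iff by metis
  show "\<exists>l l'. l < l' \<and> derives {good_word i j n M} (f l) (f l')"
  proof (cases "finite (range k0)")
    case True
    \<comment> \<open>A bounded number of copies leaves only finitely many words, so one of them
      recurs.\<close>
    define B where "B = Max (range k0) * length (good_word i j n M)"
    have "length (f l) \<le> B" for l
      using length_shuffle_power[OF k0[of l]] Max_ge[OF True, of "k0 l"] by (simp add: B_def)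
    then have "range f \<subseteq> {x. set x \<subseteq> UNIV \<and> length x \<le> B}" by auto
    then have "finite (range f)" using finite_lists_length_le[OF finite_UNIV_letter] finite_subset by blast
    then obtain \<psi> :: "nat \<Rightarrow> nat" and v where \<psi>: "strict_mono \<psi>" "\<And>l. f (\<psi> l) = v"
      using finite_range_const_subseq by blast
    have "\<psi> 0 < \<psi> 1" using \<psi>(1) by (simp add: strict_mono_def)
    moreover have "derives {good_word i j n M} (f (\<psi> 0)) (f (\<psi> 1))"
      unfolding \<psi>(2) by (rule derives_refl)
    ultimately show ?thesis by blast
  next
    case False
    from unbounded_strict_mono_subseq[OF this] obtain \<theta> :: "nat \<Rightarrow> nat" where
      \<theta>: "strict_mono \<theta>" "strict_mono (\<lambda>l. k0 (\<theta> l))" by blast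
    \<comment> \<open>The shift discards the initial words whose number of copies is too small for
      cutting into pieces of positive length.\<close>
    define \<eta> where "\<eta> l = \<theta> (l + 4 * (1 + 2 * n))" for l
    define x k where "x l = f (\<eta> l)" and "k l = k0 (\<eta> l)" for l
    have \<eta>: "strict_mono \<eta>" using \<theta>(1) by (simp add: strict_mono_def \<eta>_def)
    have k: "strict_mono k" using \<theta>(2) by (simp add: strict_mono_def k_def \<eta>_def)
    have reg: "region i j n M (k l) (x l)" for l
      unfolding x_def k_def by (rule shuffle_power_region[OF i j n k0])
    have k_ge: "4 * (1 + 2 * n) \<le> k l" for l
      using strict_mono_imp_increasing[OF \<theta>(2), of "l + 4 * (1 + 2 * n)"] by (simp add: k_def \<eta>_def)
    have "\<exists>l l'. l < l' \<and> (\<exists>z. x l' \<in> shuffles (x l) z \<and> region i j n M (k l' - k l) z)"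
    proof (cases "M = 0")
      case True
      show ?thesis by (rule region_pair_single_zone[OF reg k k_ge True])
    next
      case False
      then have "1 \<le> M" by simp
      show ?thesis by (rule region_pair_three_zones[OF reg k k_ge \<open>1 \<le> M\<close>])
    qed
    then obtain l l' z where "l < l'" "x l' \<in> shuffles (x l) z" "region i j n M (k l' - k l) z" by blast
    then have "derives {good_word i j n M} (f (\<eta> l)) (f (\<eta> l'))"
      unfolding derives_iff x_def using region_shuffle_power[OF i j n] by blast
    moreover have "\<eta> l < \<eta> l'" using \<eta> \<open>l < l'\<close> by (rule strict_monoD)
    ultimately show ?thesis by blast
  qed
qed

end

section \<open>Classification of the good words\<close>

lemma bad_if_aabb_or_aabab:
  assumes "sublist [a, a, b, b] w \<or> sublist [a, a, b, a, b] w"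
  shows "has_bad_factor w"
  using assms
proof
  assume "sublist [a, a, b, b] w"
  then have "sublist (replicate 2 a @ replicate 2 b) w" by (simp add: numeral_2_eq_2)
  then show ?thesis unfolding has_bad_factor_def by blast
next
  assume "sublist [a, a, b, a, b] w"
  then have "sublist (replicate 2 a @ [b] @ replicate 1 a @ replicate 1 b) w" by (simp add: numeral_2_eq_2)
  moreover have "(2::nat) > 1" "(1::nat) \<ge> 1" by simp_all
  ultimately show ?thesis unfolding has_bad_factor_def by blast
qed

lemma sublist_prepend: "sublist x y \<Longrightarrow> sublist x (p @ y)"
  by (auto simp: sublist_append)

text \<open>Move on to the last \<open>aa\<close> before an occurrence of \<open>bb\<close>. No
  further \<open>aa\<close> intervenes, so it is followed by \<open>bb\<close> or by
  \<open>bab\<close>.\<close>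

lemma aa_then_bb:
  "sublist [b, b] v \<Longrightarrow> sublist [a, a, b, b] (a # a # v) \<or> sublist [a, a, b, a, b] (a # a # v)"
proof (induction v rule: length_induct)
  case (1 v)
  from \<open>sublist [b, b] v\<close> obtain c v' where v: "v = c # v'" by (cases v) auto
  show ?case
  proof (cases c)
    case a
    then have "sublist [b, b] v'" using 1(2) v by (auto simp: sublist_Cons_right)
    with 1(1) v have "sublist [a, a, b, b] (a # a # v') \<or> sublist [a, a, b, a, b] (a # a # v')" by simp
    then show ?thesis unfolding v a by (meson sublist_Cons_right)
  next
    case b
    from 1(2) v obtain d v'' where v': "v' = d # v''" by (cases v') (auto simp: sublist_Cons_right)
    show ?thesis
    proof (cases d)
      case b: b
      then show ?thesis unfolding v v' \<open>c = b\<close> by (simp add: sublist_Cons_right)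
    next
      case a
      then have bb: "sublist [b, b] v''" using 1(2) v v' b by (auto simp: sublist_Cons_right)
      then obtain e v3 where v'': "v'' = e # v3" by (cases v'') auto
      show ?thesis
      proof (cases e)
        case b: b
        then show ?thesis unfolding v v' v'' \<open>c = b\<close> \<open>d = a\<close> by (simp add: sublist_Cons_right)
      next
        case e: a
        then have "sublist [b, b] v3" using bb v'' by (auto simp: sublist_Cons_right)
        with 1(1) v v' v'' have "sublist [a, a, b, b] (a # a # v3) \<or> sublist [a, a, b, a, b] (a # a # v3)" by simp
        then show ?thesis unfolding v v' v'' \<open>c = b\<close> \<open>d = a\<close> e by (meson sublist_Cons_right)
      qed
    qed
  qed
qed

lemma sublist_E: "sublist (E x) (E w) \<longleftrightarrow> sublist x w"
proof -
  have "sublist (E x) (E w)" if "sublist x w" for x w using that unfolding E_def by (rule map_mono_sublist)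
  from this[of x w] this[of "E x" "E w"] show ?thesis by auto
qed

lemma good_no_aa_or_no_bb:
  assumes "good w"
  shows "\<not> sublist [a, a] w \<or> \<not> sublist [b, b] w"
proof (rule ccontr)
  assume "\<not> (\<not> sublist [a, a] w \<or> \<not> sublist [b, b] w)"
  then have aa: "sublist [a, a] w" and bb: "sublist [b, b] w" by auto
  from aa obtain p s where w: "w = p @ a # a # s" by (auto simp: sublist_def)
  from bb have "sublist [b, b] p \<or> sublist [b, b] s"
    unfolding w by (auto simp: sublist_append sublist_Cons_right prefix_Cons append_eq_Cons_conv Cons_eq_append_conv)
  then show False
  proof
    assume "sublist [b, b] s"
    from aa_then_bb[OF this] have "has_bad_factor w"
      unfolding w by (intro bad_if_aabb_or_aabab) (auto intro: sublist_prepend)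
    with assms show False by (simp add: good_def bad_def)
  next
    assume "sublist [b, b] p"
    then obtain p1 p2 where p: "p = p1 @ b # b # p2" by (auto simp: sublist_def)
    \<comment> \<open>Here \<open>bb\<close> stands before \<open>aa\<close>; exchanging the letters
      restores the order needed for \<open>aa_then_bb\<close>.\<close>
    have Ew: "E w = E p1 @ a # a # (E p2 @ b # b # E s)" by (simp add: w p E_def)
    have "sublist [b, b] (E p2 @ b # b # E s)" unfolding sublist_def by (intro exI[of _ "E p2"] exI[of _ "E s"]) simp
    from aa_then_bb[OF this] have "has_bad_factor (E w)"
      unfolding Ew by (intro bad_if_aabb_or_aabab) (auto intro: sublist_prepend)
    with assms show False by (simp add: good_def bad_def)
  qed
qed

lemma good_E: "good w \<Longrightarrow> good (E w)"
  by (auto simp: good_def bad_def E_rev)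

text \<open>Letters are added on the left. A single \<open>b\<close> puts no bound on the two outer
  runs; a second one fixes \<open>n\<close> as the length of the run that it closes. From then on
  the excluded factors force every closed run to have length \<open>n\<close> and the leading run
  not to be longer.\<close>

lemma no_bb_form:
  assumes "\<not> sublist [b, b] w"
    and "\<And>l. 1 \<le> l \<Longrightarrow> \<not> sublist (replicate (Suc l) a @ [b] @ replicate l a @ [b]) w"
    and "\<And>l. 1 \<le> l \<Longrightarrow> \<not> sublist ([b] @ replicate l a @ [b] @ replicate (Suc l) a) w"
  shows "(\<exists>r. w = replicate r a) \<or> (\<exists>i j. w = good_word i j 0 0) \<or>
    (\<exists>i j n M. 1 \<le> n \<and> i \<le> n \<and> j \<le> n \<and> w = good_word i j n (Suc M))"
  using assms
proof (induction w)
  case Nil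
  then show ?case by (intro disjI1 exI[of _ 0]) simp
next
  case (Cons c w)
  have sub: "sublist x w \<Longrightarrow> sublist x (c # w)" for x by (simp add: sublist_Cons_right)
  have "(\<exists>r. w = replicate r a) \<or> (\<exists>i j. w = good_word i j 0 0) \<or>
    (\<exists>i j n M. 1 \<le> n \<and> i \<le> n \<and> j \<le> n \<and> w = good_word i j n (Suc M))"
    using Cons.IH Cons.prems sub by blast
  then consider r where "w = replicate r a" | i j where "w = good_word i j 0 0"
    | i j n M where "1 \<le> n" "i \<le> n" "j \<le> n" "w = good_word i j n (Suc M)" by blast
  then show ?case
  proof cases
    case 1
    show ?thesis
    proof (cases c)
      case a
      then show ?thesis using 1 by (intro disjI1 exI[of _ "Suc r"]) simp
    next
      case b
      then show ?thesis using 1 by (intro disjI2 disjI1 exI[of _ 0] exI[of _ r]) (simp add: good_word_def)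
    qed
  next
    case 2
    show ?thesis
    proof (cases c)
      case a
      then show ?thesis using 2 by (intro disjI2 disjI1 exI[of _ "Suc i"] exI[of _ j]) (simp add: good_word_def)
    next
      case b
      have cw: "c # w = [b] @ replicate i a @ [b] @ replicate j a" using 2 b by (simp add: good_word_def)
      have i: "1 \<le> i"
      proof (rule ccontr)
        assume "\<not> 1 \<le> i"
        then have "i = 0" by simp
        then have "sublist [b, b] (c # w)" unfolding cw by (simp add: sublist_Cons_right)
        with Cons.prems(1) show False by simp
      qed
      have "j \<le> i"
      proof (rule ccontr)
        assume "\<not> j \<le> i"
        then obtain e where "j = Suc i + e" using less_iff_Suc_add by (metis add_Suc not_le)
        then have "c # w = [] @ ([b] @ replicate i a @ [b] @ replicate (Suc i) a) @ replicate e a"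
          unfolding cw by (simp add: replicate_add)
        then have "sublist ([b] @ replicate i a @ [b] @ replicate (Suc i) a) (c # w)"
          unfolding sublist_def by blast
        with Cons.prems(3)[OF i] show False by simp
      qed
      then show ?thesis using i cw
        by (intro disjI2 exI[of _ 0] exI[of _ j] exI[of _ i] exI[of _ 0]) (simp add: good_word_def)
    qed
  next
    case 3
    obtain v where w: "w = replicate i a @ [b] @ replicate n a @ [b] @ v"
    proof (cases M)
      case 0
      then show ?thesis using that[of "replicate j a"] by (simp add: 3(4) good_word_def)
    next
      case (Suc M')
      then show ?thesis
        using that[of "replicate n a @ concat (replicate M' (b # replicate n a)) @ b # replicate j a"]
        by (simp add: 3(4) good_word_def)
    qed
    show ?thesis
    proof (cases c)
      case a
      have "Suc i \<le> n"
      proof (rule ccontr)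
        assume "\<not> Suc i \<le> n"
        then have "i = n" using 3 by simp
        then have "c # w = [] @ (replicate (Suc n) a @ [b] @ replicate n a @ [b]) @ v"
          unfolding w a by simp
        then have "sublist (replicate (Suc n) a @ [b] @ replicate n a @ [b]) (c # w)"
          unfolding sublist_def by blast
        with Cons.prems(2)[OF 3(1)] show False by simp
      qed
      then show ?thesis using 3 a
        by (intro disjI2 exI[of _ "Suc i"] exI[of _ j] exI[of _ n] exI[of _ M]) (simp add: good_word_def)
    next
      case b
      have i1: "1 \<le> i"
      proof (rule ccontr)
        assume "\<not> 1 \<le> i"
        then have "i = 0" by simp
        then have "sublist [b, b] (c # w)" unfolding w b by (simp add: sublist_Cons_right)
        with Cons.prems(1) show False by simp
      qed
      have "i = n"
      proof (rule ccontr)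
        assume "i \<noteq> n"
        then have "i < n" using 3 by simp
        then obtain e where "n = Suc i + e" using less_iff_Suc_add by auto
        then have n: "replicate n a = replicate (Suc i) a @ replicate e a" by (simp add: replicate_add)
        have "c # w = [] @ ([b] @ replicate i a @ [b] @ replicate (Suc i) a) @ (replicate e a @ [b] @ v)"
          unfolding w b n by simp
        then have "sublist ([b] @ replicate i a @ [b] @ replicate (Suc i) a) (c # w)"
          unfolding sublist_def by blast
        with Cons.prems(3)[OF i1] show False by simp
      qed
      then show ?thesis using 3 b
        by (intro disjI2 exI[of _ 0] exI[of _ j] exI[of _ n] exI[of _ "Suc M"]) (simp add: good_word_def)
    qed
  qed
qed

section \<open>Well quasi-order for all good words\<close>

lemma concat_replicate_shuffle_power: "concat (replicate k w) \<in> shuffle_power w k"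
proof (induction k)
  case (Suc k)
  have "w @ concat (replicate k w) \<in> shuffles ([] @ concat (replicate k w)) (w @ [])"
    by (rule append_in_shuffles) simp_all
  with Suc show ?case by auto
qed simp

lemma wqo_on_unary:
  "wqo_on (derives {replicate r a}) (lang_eps {replicate r a})"
  unfolding wqo_on_def
proof (intro allI impI)
  fix f :: "nat \<Rightarrow> letter list"
  assume "\<forall>l. f l \<in> lang_eps {replicate r a}"
  then obtain k where k: "\<And>l. f l \<in> shuffle_power (replicate r a) (k l)"
    unfolding lang_eps_iff by metis
  have unary: "x = replicate (m * r) a" if "x \<in> shuffle_power (replicate r a) m" for x m
  proof (rule replicate_eqI)
    show "length x = m * r" using length_shuffle_power[OF that] by simp
    show "c = a" if "c \<in> set x" for c
      using count_list_shuffle_power[OF \<open>x \<in> _\<close>, of b] that count_list_0_iff[of x b] by (cases c) auto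
  qed
  \<comment> \<open>All words are powers of \<open>a\<close>, so one with the fewest copies derives
    each of the others, in particular its successor in the sequence.\<close>
  obtain l where l: "\<And>l'. k l \<le> k l'" using ex_has_least_nat[of "\<lambda>_. True" 0 k] by blast
  define m where "m = k (Suc l) - k l"
  define z where "z = concat (replicate m (replicate r a))"
  have z: "z \<in> shuffle_power (replicate r a) m" unfolding z_def by (rule concat_replicate_shuffle_power)
  have "splice (f l) z \<in> shuffle_power (replicate r a) (k l + m)"
    by (rule shuffle_power_add[OF splice_in_shuffles k z])
  then have "splice (f l) z = replicate (k (Suc l) * r) a" using unary l[of "Suc l"] by (simp add: m_def)
  also have "\<dots> = f (Suc l)" using unary[OF k] by simp
  finally have "splice (f l) z = f (Suc l)" .
  then have "f (Suc l) \<in> shuffles (f l) z" by (metis splice_in_shuffles)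
  then have "derives {replicate r a} (f l) (f (Suc l))" unfolding derives_iff using z by blast
  then show "\<exists>i j. i < j \<and> derives {replicate r a} (f i) (f j)" by blast
qed

lemma wqo_on_good_no_bb:
  assumes "good w" "\<not> sublist [b, b] w"
  shows "wqo_on (derives {w}) (lang_eps {w})"
proof -
  have "\<not> sublist (replicate (Suc l) a @ [b] @ replicate l a @ [b]) v"
    if "1 \<le> l" "\<not> has_bad_factor v" for l v
  proof
    assume "sublist (replicate (Suc l) a @ [b] @ replicate l a @ [b]) v"
    then have "sublist (replicate (Suc l) a @ [b] @ replicate l a @ replicate 1 b) v" by simp
    moreover have "Suc l > l" "(1::nat) \<ge> 1" by simp_all
    ultimately show False using that unfolding has_bad_factor_def by blast
  qed
  note no = this
  have 1: "\<not> sublist (replicate (Suc l) a @ [b] @ replicate l a @ [b]) w" if "1 \<le> l" for l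
    using no[OF that] assms(1) by (simp add: good_def bad_def)
  have 2: "\<not> sublist ([b] @ replicate l a @ [b] @ replicate (Suc l) a) w" if "1 \<le> l" for l
  proof
    assume "sublist ([b] @ replicate l a @ [b] @ replicate (Suc l) a) w"
    then obtain p s where w: "w = p @ ([b] @ replicate l a @ [b] @ replicate (Suc l) a) @ s"
      unfolding sublist_def by blast
    have "rev w = rev s @ (replicate (Suc l) a @ [b] @ replicate l a @ [b]) @ rev p"
      unfolding w by (simp add: replicate_append_same del: replicate_Suc)
    then have "sublist (replicate (Suc l) a @ [b] @ replicate l a @ [b]) (rev w)"
      unfolding sublist_def by blast
    with no[OF that] assms(1) show False by (simp add: good_def bad_def)
  qed
  from no_bb_form[OF assms(2) 1 2] consider r where "w = replicate r a"
    | i j where "w = good_word i j 0 0"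
    | i j n M where "1 \<le> n" "i \<le> n" "j \<le> n" "w = good_word i j n (Suc M)" by blast
  then show ?thesis
  proof cases
    case 1
    then show ?thesis using wqo_on_unary by simp
  next
    case 2
    \<comment> \<open>Without inner blocks the word does not depend on \<open>n\<close>, which can
      therefore be chosen to meet the side conditions.\<close>
    define n where "n = max 1 (max i j)"
    have n: "i \<le> n" "j \<le> n" "1 \<le> n" by (auto simp: n_def)
    have "w = good_word i j n 0" unfolding 2 good_word_def by simp
    then show ?thesis using wqo_on_good_word[OF n] by simp
  next
    case 3
    have "w = good_word i j n (Suc M)" unfolding 3 ..
    then show ?thesis using wqo_on_good_word[OF 3(2,3,1)] by simp
  qed
qed

lemma wqo_on_good:
  assumes "good w"
  shows "wqo_on (derives {w}) (lang_eps {w})"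
proof (cases "sublist [b, b] w")
  case False
  then show ?thesis using assms wqo_on_good_no_bb by blast
next
  case True
  then have "\<not> sublist [a, a] w" using good_no_aa_or_no_bb[OF assms] by blast
  then have "\<not> sublist [b, b] (E w)" using sublist_E[of "[a, a]" w] by (simp add: E_def)
  from wqo_on_derives_E[OF wqo_on_good_no_bb[OF good_E[OF assms] this]] show ?thesis by simp
qed

section \<open>Bad sequences for bad words\<close>

abbreviation lead :: "'c \<Rightarrow> 'c list \<Rightarrow> nat" where
  "lead c x \<equiv> length (takeWhile (\<lambda>d. d = c) x)"

abbreviation strip :: "'c \<Rightarrow> 'c list \<Rightarrow> 'c list" where
  "strip c x \<equiv> dropWhile (\<lambda>d. d = c) x"

text \<open>Equality means that both leading runs are used up before any other letter is read, so
  all three can be stripped simultaneously.\<close>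

lemma takeWhile_shuffles:
  assumes "z \<in> shuffles x y"
  shows "lead c z \<le> lead c x + lead c y \<and>
    (lead c z = lead c x + lead c y \<longrightarrow>
      strip c z \<in> shuffles (strip c x) (strip c y))"
  using assms
proof (induction z arbitrary: x y)
  case Nil
  then show ?case by simp
next
  case (Cons d z)
  from Cons.prems consider x' where "x = d # x'" "z \<in> shuffles x' y"
    | y' where "y = d # y'" "z \<in> shuffles x y'"
    by (auto simp: Cons_in_shuffles_iff neq_Nil_conv)
  then show ?case
  proof cases
    case 1
    show ?thesis
    proof (cases "d = c")
      case True
      then show ?thesis using Cons.IH[OF 1(2)] 1 by auto
    next
      case False
      moreover from this have "strip c y = y" if "takeWhile (\<lambda>d. d = c) y = []"
        using that by (metis append_Nil takeWhile_dropWhile_id)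
      ultimately show ?thesis using Cons.prems 1 by auto
    qed
  next
    case 2
    show ?thesis
    proof (cases "d = c")
      case True
      then show ?thesis using Cons.IH[OF 2(2)] 2 by auto
    next
      case False
      moreover from this have "strip c x = x" if "takeWhile (\<lambda>d. d = c) x = []"
        using that by (metis append_Nil takeWhile_dropWhile_id)
      ultimately show ?thesis using Cons.prems 2 by auto
    qed
  qed
qed

lemma takeWhile_shuffle_power:
  assumes "z \<in> shuffle_power w k"
  shows "lead c z \<le> k * lead c w \<and>
    (lead c z = k * lead c w \<longrightarrow>
      strip c z \<in> shuffle_power (strip c w) k)"
  using assms
proof (induction k arbitrary: z)
  case 0
  then show ?case by simp
next
  case (Suc k)
  then obtain y where y: "y \<in> shuffle_power w k" "z \<in> shuffles y w" by auto
  note ih = Suc.IH[OF y(1)] and tw = takeWhile_shuffles[OF y(2), of c]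
  show ?case
  proof (intro conjI impI)
    show "lead c z \<le> Suc k * lead c w"
      using ih tw by simp
    assume "lead c z = Suc k * lead c w"
    then have "lead c z =
        lead c y + lead c w"
      "lead c y = k * lead c w" using ih tw by simp_all
    then show "strip c z \<in> shuffle_power (strip c w) (Suc k)"
      using ih tw by auto
  qed
qed

text \<open>The shuffle of \<open>k\<close> copies read in lockstep; it turns each maximal run of
  \<open>x\<close> into a run \<open>k\<close> times as long.\<close>

definition blow_up :: "nat \<Rightarrow> 'c list \<Rightarrow> 'c list" where
  "blow_up k x = concat (map (replicate k) x)"

lemma blow_up_append [simp]: "blow_up k (x @ y) = blow_up k x @ blow_up k y"
  by (simp add: blow_up_def)

lemma blow_up_Nil [simp]: "blow_up k [] = []"
  by (simp add: blow_up_def)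

lemma blow_up_rev: "blow_up k (rev x) = rev (blow_up k x)"
  by (induction x) (simp_all add: blow_up_def)

lemma blow_up_replicate: "blow_up k (replicate r c) = replicate (r * k) c"
  by (induction r) (simp_all add: blow_up_def replicate_add)

lemma shuffle_power_append:
  "p \<in> shuffle_power x k \<Longrightarrow> q \<in> shuffle_power y k \<Longrightarrow> p @ q \<in> shuffle_power (x @ y) k"
proof (induction k arbitrary: p q)
  case (Suc k)
  then show ?case by (auto intro!: append_in_shuffles)
qed simp

lemma blow_up_shuffle_power: "blow_up k x \<in> shuffle_power x k"
proof (induction x)
  case Nil
  have "[] \<in> shuffle_power [] k" by (induction k) auto
  then show ?case by (simp add: blow_up_def)
next
  case (Cons c x)
  have "replicate k c \<in> shuffle_power [c] k"
  proof (induction k)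
    case (Suc k)
    have "[c] @ replicate k c \<in> shuffles ([] @ replicate k c) ([c] @ [])"
      by (rule append_in_shuffles) simp_all
    with Suc show ?case by auto
  qed simp
  from shuffle_power_append[OF this Cons] show ?case by (simp add: blow_up_def)
qed

text \<open>Each run of \<open>x\<close> bounds the number of letters that either component can contribute to the
  corresponding run of the blow-up, so both bounds are attained.\<close>

lemma blow_up_cancel_left:
  assumes "blow_up (k + k') x @ R \<in> shuffles (blow_up k x @ R1) z" "z \<in> shuffle_power (x @ v) k'"
    and "x \<noteq> [] \<Longrightarrow> v = [] \<or> hd v \<noteq> last x" "x \<noteq> [] \<Longrightarrow> R1 = [] \<or> hd R1 \<noteq> last x" "1 \<le> k"
  shows "\<exists>z'\<in>shuffle_power v k'. R \<in> shuffles R1 z'"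
  using assms
proof (induction x arbitrary: z rule: length_induct)
  case (1 x)
  show ?case
  proof (cases x)
    case Nil
    then show ?thesis using 1 by auto
  next
    case (Cons c x0)
    define r where "r = lead c x"
    define x1 where "x1 = strip c x"
    have r: "1 \<le> r" by (simp add: r_def Cons)
    have tw: "takeWhile (\<lambda>d. d = c) x = replicate r c"
      unfolding r_def by (intro replicate_eqI) (auto dest: set_takeWhileD)
    have x: "x = replicate r c @ x1" unfolding x1_def tw[symmetric] by simp
    have x1: "x1 = [] \<or> hd x1 \<noteq> c" unfolding x1_def using hd_dropWhile by blast
    have lst: "last x = (if x1 = [] then c else last x1)" using r by (simp add: x last_append)
    have split: "takeWhile (\<lambda>d. d = c) (replicate m c @ y) = replicate m c"
      "strip c (replicate m c @ y) = y" if "y = [] \<or> hd y \<noteq> c" for m y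
      using that by (cases y; induction m; auto)+
    have nv: "x1 @ v = [] \<or> hd (x1 @ v) \<noteq> c" using x1 lst 1(4) Cons by (cases x1) auto
    have hd_blow: "hd (blow_up k x1) = hd x1 \<and> blow_up k x1 \<noteq> []" if "x1 \<noteq> []"
      using that \<open>1 \<le> k\<close> by (cases x1; cases k) (auto simp: blow_up_def)
    have nR1: "blow_up k x1 @ R1 = [] \<or> hd (blow_up k x1 @ R1) \<noteq> c"
      using x1 lst 1(5) Cons hd_blow by (cases "x1 = []") auto
    define Y where "Y = blow_up (k + k') x1 @ R"
    have sh: "replicate (r * (k + k')) c @ Y \<in> shuffles (replicate (r * k) c @ (blow_up k x1 @ R1)) z"
      using 1(2) unfolding x Y_def by (simp add: blow_up_replicate)
    have zp: "z \<in> shuffle_power (replicate r c @ (x1 @ v)) k'" using 1(3) unfolding x by simp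
    have len_Y: "r * (k + k') \<le> lead c (replicate (r * (k + k')) c @ Y)"
      by (subst takeWhile_append2) auto
    have A: "lead c (replicate (r * (k + k')) c @ Y) \<le>
        r * k + lead c z"
      using takeWhile_shuffles[OF sh, of c] unfolding split[OF nR1] by simp
    have B: "lead c z \<le> k' * r"
      using takeWhile_shuffle_power[OF zp, of c] unfolding split[OF nv] by simp
    have eqs: "lead c (replicate (r * (k + k')) c @ Y) = r * k + lead c z"
      "lead c z = k' * r"
      "lead c (replicate (r * (k + k')) c @ Y) = r * (k + k')"
      using A B len_Y by (simp_all add: algebra_simps)
    have dY: "strip c (replicate (r * (k + k')) c @ Y) = Y"
      unfolding dropWhile_eq_drop eqs(3) by simp
    have "Y \<in> shuffles (blow_up k x1 @ R1) (strip c z)"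
      using takeWhile_shuffles[OF sh, of c] eqs(1) unfolding split[OF nR1] dY by simp
    moreover have "strip c z \<in> shuffle_power (x1 @ v) k'"
      using takeWhile_shuffle_power[OF zp, of c] eqs(2) unfolding split[OF nv] by simp
    moreover have "length x1 < length x" using r by (simp add: x)
    moreover have "v = [] \<or> hd v \<noteq> last x1" "R1 = [] \<or> hd R1 \<noteq> last x1" if "x1 \<noteq> []"
      using 1(4,5) that lst Cons by simp_all
    ultimately show ?thesis using 1(1) \<open>1 \<le> k\<close> unfolding Y_def by blast
  qed
qed

lemma hd_shuffle_power: "x \<in> shuffle_power w k \<Longrightarrow> x \<noteq> [] \<Longrightarrow> hd x = hd w"
proof (induction k arbitrary: x)
  case (Suc k)
  then obtain y where y: "y \<in> shuffle_power w k" "x \<in> shuffles y w" by auto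
  from Suc.prems(2) obtain c x' where x: "x = c # x'" by (cases x) auto
  show ?case using Suc.IH[OF y(1)] y(2) by (auto simp: x Cons_in_shuffles_iff)
qed simp

lemma last_shuffle_power: "x \<in> shuffle_power w k \<Longrightarrow> x \<noteq> [] \<Longrightarrow> last x = last w"
  using hd_shuffle_power[OF rev_shuffle_power, of x w k]
  by (cases "w = []") (auto simp: hd_rev dest: length_shuffle_power)

text \<open>Words are nonempty so that they begin and end like \<open>w\<close>; this keeps adjacent
  runs separate when a context is put around them.\<close>

definition has_bad_sequence :: "letter list \<Rightarrow> bool" where
  "has_bad_sequence w \<longleftrightarrow> (\<exists>f. (\<forall>l::nat. f l \<in> lang_eps {w} \<and> f l \<noteq> []) \<and>
    (\<forall>l l'. l < l' \<longrightarrow> \<not> derives {w} (f l) (f l')))"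

lemma not_wqo_if_bad_sequence: "has_bad_sequence w \<Longrightarrow> \<not> wqo_on (derives {w}) (lang_eps {w})"
  unfolding has_bad_sequence_def wqo_on_def by blast

text \<open>Lengths determine the number \<open>m\<close> of inserted copies. Then the blow-up of
  \<open>x\<close> is cancelled on the left and, after reversal, that of \<open>y\<close> on the
  right. The hypotheses on \<open>last x\<close> and \<open>hd y\<close> prevent runs from merging
  at the seams.\<close>

lemma has_bad_sequence_extend:
  assumes "has_bad_sequence F" "F \<noteq> []" "x = [] \<or> last x \<noteq> hd F" "y = [] \<or> hd y \<noteq> last F"
  shows "has_bad_sequence (x @ F @ y)"
proof -
  from assms(1) obtain f where f: "\<And>l::nat. f l \<in> lang_eps {F}" "\<And>l. f l \<noteq> []"
    "\<And>l l'. l < l' \<Longrightarrow> \<not> derives {F} (f l) (f l')"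
    unfolding has_bad_sequence_def by blast
  from f(1) obtain k where k: "\<And>l. f l \<in> shuffle_power F (k l)" unfolding lang_eps_iff by metis
  have k1: "1 \<le> k l" for l using k[of l] f(2)[of l] by (cases "k l") auto
  define g where "g l = blow_up (k l) x @ f l @ blow_up (k l) y" for l
  have gp: "g l \<in> shuffle_power (x @ F @ y) (k l)" for l
    unfolding g_def by (intro shuffle_power_append blow_up_shuffle_power k)
  have "\<not> derives {x @ F @ y} (g l) (g l')" if "l < l'" for l l'
  proof
    assume "derives {x @ F @ y} (g l) (g l')"
    then obtain m z where z: "z \<in> shuffle_power (x @ F @ y) m" "g l' \<in> shuffles (g l) z"
      unfolding derives_iff by blast
    have "k l' * length (x @ F @ y) = (k l + m) * length (x @ F @ y)"
      using length_shuffles[OF z(2)] length_shuffle_power[OF gp[of l]] length_shuffle_power[OF gp[of l']]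
        length_shuffle_power[OF z(1)] by (simp add: distrib_right)
    then have m: "k l' = k l + m" using \<open>F \<noteq> []\<close> by simp
    have "\<exists>z'\<in>shuffle_power (F @ y) m. f l' @ blow_up (k l') y \<in> shuffles (f l @ blow_up (k l) y) z'"
    proof (rule blow_up_cancel_left[of "k l" m x])
      show "blow_up (k l + m) x @ f l' @ blow_up (k l') y \<in> shuffles (blow_up (k l) x @ f l @ blow_up (k l) y) z"
        using z(2) by (simp add: g_def m)
      show "z \<in> shuffle_power (x @ F @ y) m" by (rule z(1))
      show "F @ y = [] \<or> hd (F @ y) \<noteq> last x" if "x \<noteq> []" using that assms(2,3) by auto
      show "f l @ blow_up (k l) y = [] \<or> hd (f l @ blow_up (k l) y) \<noteq> last x" if "x \<noteq> []"
        using that assms(3) hd_shuffle_power[OF k f(2), of l] f(2)[of l] by auto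
    qed (rule k1)
    then obtain z' where z': "z' \<in> shuffle_power (F @ y) m"
      "f l' @ blow_up (k l') y \<in> shuffles (f l @ blow_up (k l) y) z'" by blast
    have "\<exists>z''\<in>shuffle_power (rev F) m. rev (f l') \<in> shuffles (rev (f l)) z''"
    proof (rule blow_up_cancel_left[of "k l" m "rev y"])
      show "blow_up (k l + m) (rev y) @ rev (f l') \<in> shuffles (blow_up (k l) (rev y) @ rev (f l)) (rev z')"
        using rev_in_shuffles[OF z'(2)] by (simp add: blow_up_rev m)
      show "rev z' \<in> shuffle_power (rev y @ rev F) m" using rev_shuffle_power[OF z'(1)] by simp
      show "rev F = [] \<or> hd (rev F) \<noteq> last (rev y)" if "rev y \<noteq> []"
        using that assms(2,4) by (auto simp: hd_rev last_rev)
      show "rev (f l) = [] \<or> hd (rev (f l)) \<noteq> last (rev y)" if "rev y \<noteq> []"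
        using that assms(4) last_shuffle_power[OF k f(2), of l] by (auto simp: hd_rev last_rev)
    qed (rule k1)
    then obtain z'' where z'': "z'' \<in> shuffle_power (rev F) m" "rev (f l') \<in> shuffles (rev (f l)) z''" by blast
    have "rev z'' \<in> shuffle_power F m" "f l' \<in> shuffles (f l) (rev z'')"
      using rev_shuffle_power[OF z''(1)] rev_in_shuffles[OF z''(2)] by simp_all
    then have "derives {F} (f l) (f l')" unfolding derives_iff by blast
    with f(3)[OF that] show False by blast
  qed
  moreover have "g l \<in> lang_eps {x @ F @ y}" "g l \<noteq> []" for l
    using gp f(2) unfolding lang_eps_iff g_def by auto
  ultimately show ?thesis unfolding has_bad_sequence_def by blast
qed

section \<open>Rigidity of repeated shuffles of a suffix with a prefix\<close>

lemma prefix_concat_replicate: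
  "prefix p (concat (replicate m x)) \<Longrightarrow> \<exists>q p'. p = concat (replicate q x) @ p' \<and> prefix p' x"
proof (induction m arbitrary: p)
  case 0
  then show ?case by (intro exI[of _ 0] exI[of _ "[]"]) simp
next
  case (Suc m)
  then have "prefix p x \<or> (\<exists>p'. p = x @ p' \<and> prefix p' (concat (replicate m x)))"
    by (simp add: prefix_append)
  then show ?case
  proof (elim disjE exE conjE)
    assume "prefix p x"
    then show ?thesis by (intro exI[of _ 0] exI[of _ p]) simp
  next
    fix p' assume p': "p = x @ p'" "prefix p' (concat (replicate m x))"
    from Suc.IH[OF p'(2)] obtain q p'' where "p' = concat (replicate q x) @ p''" "prefix p'' x" by blast
    then show ?thesis using p'(1) by (intro exI[of _ "Suc q"] exI[of _ p'']) simp
  qed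
qed

definition excess :: "letter list \<Rightarrow> letter list \<Rightarrow> int" where
  "excess F p = int (count_list F b) * int (count_list p a) - int (count_list F a) * int (count_list p b)"

lemma excess_append [simp]: "excess F (x @ y) = excess F x + excess F y"
  by (simp add: excess_def algebra_simps)

lemma excess_Nil [simp]: "excess F [] = 0"
  by (simp add: excess_def)

lemma excess_self [simp]: "excess F F = 0"
  by (simp add: excess_def)

lemma excess_shuffles: "z \<in> shuffles x y \<Longrightarrow> excess F z = excess F x + excess F y"
  by (simp add: excess_def count_list_shuffles algebra_simps)

lemma excess_replicate: "excess F (concat (replicate m x)) = int m * excess F x"
  by (induction m) (simp_all add: algebra_simps)

lemma excess_le: "excess F p \<le> int (length F * length p)"
proof -
  have "int (count_list F b) * int (count_list p a) \<le> int (length F) * int (length p)"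
    by (intro mult_mono) (simp_all add: count_le_length)
  moreover have "0 \<le> int (count_list F a) * int (count_list p b)" by simp
  ultimately show ?thesis unfolding excess_def of_nat_mult by linarith
qed

context
  fixes F s r \<beta> :: "letter list"
  assumes F: "F = s @ r" and s: "s \<noteq> []" and r: "r \<noteq> []"
    and pos: "\<And>p. prefix p F \<Longrightarrow> p \<noteq> [] \<Longrightarrow> p \<noteq> F \<Longrightarrow> 0 < excess F p \<and> excess F s \<le> excess F p"
    and \<beta>: "\<beta> \<in> shuffles r s" "\<beta> \<noteq> F"
    and \<beta>_pos: "\<And>p. prefix p \<beta> \<Longrightarrow> 0 < excess F s + excess F p"
begin

lemma excess_s: "0 < excess F s"
  using pos[of s] F s r by simp

lemma excess_prefix_F: "prefix p F \<Longrightarrow> p = [] \<or> p = F \<or> excess F s \<le> excess F p"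
  using pos by blast

text \<open>Every copy contributes a nonnegative excess, and one that has been started but not
  finished at least \<open>excess F s\<close>. Below that value every copy is either finished or
  untouched.\<close>

lemma excess_prefix:
  assumes "z \<in> shuffle_power F k" "prefix p z"
  shows "excess F p = 0 \<and> (\<exists>k'. p \<in> shuffle_power F k') \<or> excess F s \<le> excess F p"
  using assms
proof (induction k arbitrary: z p)
  case 0
  then have "p = []" "[] \<in> shuffle_power F 0" by simp_all
  then show ?case by (metis excess_Nil)
next
  case (Suc k)
  then obtain y where y: "y \<in> shuffle_power F k" "z \<in> shuffles y F" by auto
  from Suc.prems(2) obtain p' where "z = p @ p'" by (auto simp: prefix_def)
  with y(2) obtain y1 y2 f1 f2 where sp: "y = y1 @ y2" "F = f1 @ f2" "p \<in> shuffles y1 f1"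
    by (metis append_in_shufflesE)
  have ex: "excess F p = excess F y1 + excess F f1" using sp(3) by (rule excess_shuffles)
  have y1: "excess F y1 = 0 \<and> (\<exists>k'. y1 \<in> shuffle_power F k') \<or> excess F s \<le> excess F y1"
    using Suc.IH[OF y(1)] sp(1) by simp
  have f1: "f1 = [] \<or> f1 = F \<or> excess F s \<le> excess F f1"
    using excess_prefix_F[of f1] sp(2) by (metis prefixI)
  have f1': "0 \<le> excess F f1" using f1 excess_s by auto
  from y1 show ?case
  proof
    assume "excess F s \<le> excess F y1"
    then show ?thesis using ex f1' by simp
  next
    assume y1: "excess F y1 = 0 \<and> (\<exists>k'. y1 \<in> shuffle_power F k')"
    then obtain k' where k': "y1 \<in> shuffle_power F k'" by blast
    from f1 show ?thesis
    proof (elim disjE)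
      assume "f1 = []"
      then show ?thesis using ex sp(3) y1 k' by auto
    next
      assume "f1 = F"
      then have "p \<in> shuffle_power F (Suc k')" using sp(3) k' by auto
      then show ?thesis using ex y1 \<open>f1 = F\<close> by (auto simp del: shuffle_power.simps)
    next
      assume "excess F s \<le> excess F f1"
      then show ?thesis using ex y1 by simp
    qed
  qed
qed

lemma excess_prefix_nonneg: "z \<in> shuffle_power F k \<Longrightarrow> prefix p z \<Longrightarrow> 0 \<le> excess F p"
  using excess_prefix[of z k p] excess_s by auto

text \<open>At excess 0 each copy lies entirely on one side of the cut.\<close>

lemma suffix_shuffle_power:
  assumes "x @ y \<in> shuffle_power F k" "excess F x = 0"
  shows "\<exists>k'. y \<in> shuffle_power F k'"
  using assms
proof (induction k arbitrary: x y)
  case 0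
  then have "y \<in> shuffle_power F 0" by simp
  then show ?case by blast
next
  case (Suc k)
  then obtain v where v: "v \<in> shuffle_power F k" "x @ y \<in> shuffles v F" by auto
  from v(2) obtain v1 v2 f1 f2 where sp: "v = v1 @ v2" "F = f1 @ f2" "x \<in> shuffles v1 f1" "y \<in> shuffles v2 f2"
    by (rule append_in_shufflesE)
  have ex: "excess F v1 + excess F f1 = 0" using Suc.prems(2) excess_shuffles[OF sp(3)] by simp
  have "0 \<le> excess F v1" using excess_prefix_nonneg[OF v(1)] sp(1) by simp
  moreover have f1: "f1 = [] \<or> f1 = F \<or> excess F s \<le> excess F f1"
    using excess_prefix_F[of f1] sp(2) by (metis prefixI)
  ultimately have "f1 = [] \<or> f1 = F" and v1: "excess F v1 = 0" using ex excess_s by auto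
  from Suc.IH[of v1 v2] v(1) sp(1) v1 obtain k' where k': "v2 \<in> shuffle_power F k'" by auto
  from \<open>f1 = [] \<or> f1 = F\<close> show ?case
  proof
    assume "f1 = []"
    then have "y \<in> shuffle_power F (Suc k')" using sp k' by auto
    then show ?thesis by blast
  next
    assume "f1 = F"
    then have "y = v2" using sp by simp
    then show ?thesis using k' by blast
  qed
qed

lemma length_\<beta>: "length \<beta> = length F"
  using length_shuffles[OF \<beta>(1)] F by simp

lemma excess_\<beta>: "excess F \<beta> = 0"
proof -
  have "excess F F = excess F s + excess F r" using excess_append[of F s r] F by simp
  then show ?thesis using excess_shuffles[OF \<beta>(1), of F] by simp
qed

text \<open>At each boundary between two factors \<open>\<beta>\<close> the total excess is the least positive one, so it
  belongs to one component only, and the other one cannot read anything in between.\<close>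

lemma middle_rigid:
  assumes "concat (replicate q \<beta>) \<in> shuffles U2 Z2" "excess F U1 + excess F Z1 = excess F s"
    and "Z1 @ Z2 @ Z3 \<in> shuffle_power F k"
    and "\<And>p. prefix p U2 \<Longrightarrow> 0 < excess F (U1 @ p)"
  shows "Z2 = []"
  using assms
proof (induction q arbitrary: U1 U2 Z1 Z2)
  case 0
  then show ?case by simp
next
  case (Suc q)
  from Suc.prems(1) have "\<beta> @ concat (replicate q \<beta>) \<in> shuffles U2 Z2" by simp
  then obtain u U2' \<zeta> Z2' where sp: "U2 = u @ U2'" "Z2 = \<zeta> @ Z2'" "\<beta> \<in> shuffles u \<zeta>"
    "concat (replicate q \<beta>) \<in> shuffles U2' Z2'" by (rule append_in_shufflesE)
  have ex: "excess F u + excess F \<zeta> = 0" using excess_shuffles[OF sp(3)] excess_\<beta> by simp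
  have "0 < excess F U1" using Suc.prems(4)[of "[]"] by simp
  then have Z1: "excess F Z1 = 0"
    using excess_prefix[OF Suc.prems(3), of Z1] Suc.prems(2) by auto
  have "0 < excess F (U1 @ u)" using Suc.prems(4)[of u] sp(1) by simp
  then have "excess F (Z1 @ \<zeta>) < excess F s" using Suc.prems(2) ex by simp
  moreover have pz: "prefix (Z1 @ \<zeta>) (Z1 @ Z2 @ Z3)" using sp(2) by simp
  ultimately obtain k' where k': "excess F (Z1 @ \<zeta>) = 0" "Z1 @ \<zeta> \<in> shuffle_power F k'"
    using excess_prefix[OF Suc.prems(3) pz] by auto
  from suffix_shuffle_power[OF k'(2) Z1] obtain k'' where k'': "\<zeta> \<in> shuffle_power F k''" by blast
  have \<zeta>: "\<zeta> = []"
  proof (rule ccontr)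
    assume "\<zeta> \<noteq> []"
    then have "1 \<le> k''" using k'' by (cases k'') auto
    have F0: "0 < length F" using F s by simp
    have len: "length F = length u + k'' * length F"
      using length_shuffles[OF sp(3)] length_\<beta> length_shuffle_power[OF k''] by simp
    then have "k'' * length F \<le> 1 * length F" by linarith
    then have "k'' = 1" using F0 \<open>1 \<le> k''\<close> by simp
    then have "u = []" "\<zeta> = F" using len k'' by simp_all
    then have "\<beta> = F" using sp(3) by simp
    with \<beta>(2) show False by simp
  qed
  have "Z2' = []"
  proof (rule Suc.IH[OF sp(4)])
    show "excess F (U1 @ u) + excess F Z1 = excess F s" using Suc.prems(2) ex \<zeta> by simp
    show "Z1 @ Z2' @ Z3 \<in> shuffle_power F k" using Suc.prems(3) sp(2) \<zeta> by simp
    show "0 < excess F ((U1 @ u) @ p)" if "prefix p U2'" for p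
      using Suc.prems(4)[of "u @ p"] that sp(1) by simp
  qed
  then show ?case using \<zeta> sp(2) by simp
qed

text \<open>In \<open>s @ rep m @ r\<close> each \<open>\<beta>\<close> finishes the open copy of
  \<open>F\<close> and opens the next one. The blocks of \<open>c\<close> and of \<open>F'\<close>
  serve as markers: if a shorter word is completed to a longer one by copies of \<open>F\<close>,
  they ensure that it is strictly inside, hence of positive excess, all along the middle of the
  longer word. Then \<open>middle_rigid\<close> assigns the whole middle to the shorter word, which
  has too few letters if the lengths are spaced widely.\<close>

lemma has_bad_sequence_factor: "has_bad_sequence F"
proof -
  obtain c F' where cF: "F = c # F'" using F s by (metis append_is_Nil_conv neq_Nil_conv)
  have F'ne: "F' \<noteq> []"
    using F s r cF by (cases s; cases r) auto
  have exc: "0 < excess F [c]" using pos[of "[c]"] F'ne unfolding cF by simp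
  have excF': "excess F [c] + excess F F' = 0"
    using excess_append[of F "[c]" F'] excess_self[of F] cF by simp
  \<comment> \<open>The excess of \<open>\<alpha>\<close> followed by any prefix of
    \<open>rep m\<close> is at most \<open>excess F s + length F * length F\<close>; a block of
    \<open>C\<close> letters \<open>c\<close> alone exceeds this.\<close>
  define C where "C = nat (excess F s + int (length F * length F)) + 1"
  have C: "excess F s + int (length F * length F) < int C * excess F [c]"
  proof -
    have "excess F s + int (length F * length F) < int C" using excess_s by (simp add: C_def)
    also have "int C \<le> int C * excess F [c]" using exc by (simp add: mult_le_cancel_left1)
    finally show ?thesis .
  qed
  have C1: "1 \<le> C" by (simp add: C_def)
  define cC where "cC = replicate C c"
  define FC where "FC = concat (replicate C F')"
  define \<alpha> where "\<alpha> = cC @ s @ FC"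
  define \<gamma> where "\<gamma> = cC @ FC @ r"
  define rep where "rep q = concat (replicate q \<beta>)" for q
  have rep_simps: "rep 0 = []" "rep (Suc q) = \<beta> @ rep q" for q by (simp_all add: rep_def)
  define u where "u m = \<alpha> @ rep m @ \<gamma>" for m
  have cC_eq: "cC = concat (replicate C [c])" unfolding cC_def by (induction C) simp_all
  have excC: "excess F cC = int C * excess F [c]" unfolding cC_eq by (rule excess_replicate)
  have exFC: "excess F FC = - int C * excess F [c]"
    using excF' unfolding FC_def excess_replicate by (simp add: eq_neg_iff_add_eq_0 distrib_left[symmetric] add.commute)
  have ex\<alpha>: "excess F \<alpha> = excess F s" using excC exFC by (simp add: \<alpha>_def)
  have ex\<beta>m: "excess F (rep m) = 0" for m by (simp add: rep_def excess_replicate excess_\<beta>)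
  have length_rep: "length (rep q) = q * length F" for q
    using length_\<beta> by (induction q) (simp_all add: rep_simps)
  have cCFC: "cC @ FC \<in> shuffle_power F C" unfolding cC_def FC_def
  proof (induction C)
    case (Suc C)
    have "[c] @ F' @ concat (replicate C F') \<in> shuffles ([] @ [] @ concat (replicate C F')) ([c] @ F' @ [])"
      by (intro append_in_shuffles) simp_all
    then have "replicate C c @ ([c] @ F' @ concat (replicate C F')) \<in>
        shuffles (replicate C c @ ([] @ [] @ concat (replicate C F'))) ([] @ ([c] @ F' @ []))"
      by (intro append_in_shuffles) simp_all
    then have "replicate (Suc C) c @ concat (replicate (Suc C) F') \<in>
        shuffles (replicate C c @ concat (replicate C F')) F"
      by (simp add: cF replicate_app_Cons_same)
    with Suc show ?case by (simp only: shuffle_power.simps) blast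
  qed simp
  have u_in: "\<exists>k. u m \<in> shuffle_power F k" for m
  proof -
    have "s @ (cC @ FC) @ r \<in> shuffles ([] @ (cC @ FC) @ []) (s @ [] @ r)"
      by (intro append_in_shuffles) simp_all
    then have "s @ (cC @ FC) @ r \<in> shuffles (cC @ FC) F" by (simp add: F)
    with cCFC have base: "s @ \<gamma> \<in> shuffle_power F (Suc C)" unfolding \<gamma>_def by auto
    have "s @ rep m @ \<gamma> \<in> shuffle_power F (m + Suc C)"
    proof (induction m)
      case 0
      then show ?case using base by (simp add: rep_simps)
    next
      case (Suc m)
      define y where "y = rep m @ \<gamma>"
      have "s @ \<beta> @ y \<in> shuffles ([] @ s @ y) (s @ r @ [])"
        by (intro append_in_shuffles) (use \<beta>(1) in \<open>simp_all add: shuffles_commutes\<close>)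
      then have "s @ \<beta> @ y \<in> shuffles (s @ y) F" by (simp add: F)
      with Suc show ?case unfolding y_def rep_simps by auto
    qed
    then have sy: "s @ (rep m @ \<gamma>) \<in> shuffle_power F (m + Suc C)" .
    define y where "y = rep m @ \<gamma>"
    have "cC @ s @ FC @ y \<in> shuffles (cC @ [] @ FC @ []) ([] @ s @ [] @ y)"
      by (intro append_in_shuffles) simp_all
    then have "u m \<in> shuffles (cC @ FC) (s @ y)" by (simp add: u_def \<alpha>_def y_def)
    from shuffle_power_add[OF this cCFC] sy show ?thesis unfolding y_def by blast
  qed
  have pos_u: "0 < excess F p" if p: "prefix p (u m)" "p \<noteq> []" "p \<noteq> u m" for p m
  proof -
    have cp: "0 < excess F p" if "prefix p cC" "p \<noteq> []" for p
    proof -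
      have "p = replicate (length p) c"
        using set_mono_prefix[OF that(1)] unfolding cC_def by (intro replicate_eqI) auto
      then have "p = concat (replicate (length p) [c])" by (metis concat_replicate_single)
      then have "excess F p = int (length p) * excess F [c]" using excess_replicate[of F "length p" "[c]"] by simp
      then show ?thesis using exc that(2) by simp
    qed
    have exC: "0 < excess F cC" using excC exc C1 by simp
    from p(1) consider "prefix p cC"
      | p' where "p = cC @ p'" "prefix p' s"
      | p' where "p = cC @ s @ p'" "prefix p' FC"
      | p' where "p = \<alpha> @ p'" "prefix p' (rep m)"
      | p' where "p = \<alpha> @ rep m @ p'" "prefix p' (cC @ FC)"
      | p' where "p = \<alpha> @ rep m @ cC @ FC @ p'" "prefix p' r"
      unfolding u_def \<alpha>_def \<gamma>_def by (simp add: prefix_append) (elim disjE exE conjE; simp)+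
    then show ?thesis
    proof cases
      case 1
      then show ?thesis using cp p(2) by blast
    next
      case 2
      have "p' = [] \<or> 0 < excess F p'"
        using pos[of p'] 2(2) F r by (metis append_self_conv prefix_prefix same_prefix_nil)
      then show ?thesis using 2 exC by auto
    next
      case 3
      then have "prefix (cC @ p') (cC @ FC)" by simp
      from excess_prefix_nonneg[OF cCFC this] show ?thesis using 3 excess_s by simp
    next
      case 4
      from prefix_concat_replicate[OF 4(2)[unfolded rep_def], folded rep_def] obtain q p'' where "p' = rep q @ p''" "prefix p'' \<beta>" by blast
      then show ?thesis using 4 ex\<alpha> ex\<beta>m \<beta>_pos[of p''] by simp
    next
      case 5
      from excess_prefix_nonneg[OF cCFC 5(2)] show ?thesis using 5 ex\<alpha> ex\<beta>m excess_s by simp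
    next
      case 6
      have "s @ p' \<noteq> F" using 6 p(3) unfolding u_def \<gamma>_def F by auto
      moreover have "prefix (s @ p') F" using 6(2) F by simp
      ultimately have "0 < excess F (s @ p')" using pos s by blast
      then show ?thesis using 6 ex\<alpha> ex\<beta>m excC exFC by simp
    qed
  qed
  have bound: "excess F (\<alpha> @ p) < int C * excess F [c]" if p: "prefix p (rep m)" for p m
  proof -
    from prefix_concat_replicate[OF p[unfolded rep_def], folded rep_def] obtain q p' where p': "p = rep q @ p'" "prefix p' \<beta>" by blast
    have "excess F p' \<le> int (length F * length p')" by (rule excess_le)
    also have "\<dots> \<le> int (length F * length F)"
      using prefix_length_le[OF p'(2)] length_\<beta> by (simp only: of_nat_le_iff) simp
    finally show ?thesis using C p' ex\<alpha> ex\<beta>m by simp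
  qed
  have key: "m' * length F \<le> length (u m)"
    if z: "z \<in> shuffle_power F k" and sh: "u m' \<in> shuffles (u m) z" for m m' z k
  proof -
    from sh have "\<alpha> @ (rep m' @ \<gamma>) \<in> shuffles (u m) z" by (simp add: u_def)
    then obtain U1 U23 Z1 Z23 where sp1: "u m = U1 @ U23" "z = Z1 @ Z23" "\<alpha> \<in> shuffles U1 Z1"
      "rep m' @ \<gamma> \<in> shuffles U23 Z23" by (rule append_in_shufflesE)
    from sp1(4) obtain U2 U3 Z2 Z3 where sp2: "U23 = U2 @ U3" "Z23 = Z2 @ Z3"
      "rep m' \<in> shuffles U2 Z2" "\<gamma> \<in> shuffles U3 Z3" by (rule append_in_shufflesE)
    have zz: "z = Z1 @ Z2 @ Z3" using sp1 sp2 by simp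
    have uu: "u m = U1 @ U2 @ U3" using sp1 sp2 by simp
    \<comment> \<open>Otherwise the first block \<open>cC\<close> of the shorter word is read after
      \<open>\<alpha>\<close>. If it ends within the repetitions of \<open>\<beta>\<close>, the
      excess is too large there; if it ends later, too few letters remain for the rest of that
      word.\<close>
    have U1: "U1 \<noteq> []"
    proof
      assume "U1 = []"
      then have \<alpha>Z: "\<alpha> = Z1" and U23: "U23 = cC @ (s @ FC @ rep m @ \<gamma>)"
        using sp1 by (simp_all add: u_def \<alpha>_def)
      from sp1(4) have "rep m' @ \<gamma> \<in> shuffles Z23 (cC @ (s @ FC @ rep m @ \<gamma>))"
        unfolding U23 by (simp only: shuffles_commutes)
      then obtain v1 v2 zz1 zz2 where v: "rep m' @ \<gamma> = v1 @ v2" "Z23 = zz1 @ zz2"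
        "v1 \<in> shuffles zz1 cC" "v2 \<in> shuffles zz2 (s @ FC @ rep m @ \<gamma>)"
        by (rule shuffles_append_rightE)
      have "0 \<le> excess F (Z1 @ zz1)" using excess_prefix_nonneg[OF z, of "Z1 @ zz1"] sp1(2) v(2) by simp
      then have big: "int C * excess F [c] \<le> excess F (\<alpha> @ v1)"
        using excess_shuffles[OF v(3), of F] excC \<alpha>Z by simp
      have "prefix v1 (rep m' @ \<gamma>)" using v(1) by simp
      then consider "prefix v1 (rep m')" | p where "v1 = rep m' @ p"
        by (auto simp: prefix_append)
      then show False
      proof cases
        case 1
        with bound big show False by fastforce
      next
        case 2
        then have "length v2 \<le> length \<gamma>" using v(1) by (metis append.assoc append_eq_append_conv length_append le_add2 same_append_eq)
        moreover have "length v2 \<ge> length s + length \<gamma>" using length_shuffles[OF v(4)] by simp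
        moreover have "0 < length s" using s by simp
        ultimately show False by linarith
      qed
    qed
    \<comment> \<open>Otherwise the shorter word is finished before \<open>\<gamma>\<close> begins.
      Its second block \<open>cC\<close> then ends behind \<open>\<alpha>\<close>, by length, at a
      position where the excess would be too large.\<close>
    have U3: "U3 \<noteq> []"
    proof
      assume "U3 = []"
      define w1 where "w1 = \<alpha> @ rep m @ cC"
      have um: "U1 @ U2 = w1 @ (FC @ r)" using uu \<open>U3 = []\<close> by (simp add: u_def w1_def \<gamma>_def)
      have "\<alpha> @ rep m' \<in> shuffles (U1 @ U2) (Z1 @ Z2)"
        by (rule append_in_shuffles) (use sp1 sp2 in simp_all)
      then have "\<alpha> @ rep m' \<in> shuffles (Z1 @ Z2) (w1 @ (FC @ r))"
        unfolding um by (simp only: shuffles_commutes)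
      then obtain v1 v2 zz1 zz2 where v: "\<alpha> @ rep m' = v1 @ v2" "Z1 @ Z2 = zz1 @ zz2"
        "v1 \<in> shuffles zz1 w1" by (rule shuffles_append_rightE)
      have "z = zz1 @ zz2 @ Z3" using zz v(2) by (metis append.assoc)
      then have "0 \<le> excess F zz1" using excess_prefix_nonneg[OF z, of zz1] by simp
      then have big: "int C * excess F [c] \<le> excess F v1"
        using excess_shuffles[OF v(3), of F] excC ex\<alpha> ex\<beta>m excess_s by (simp add: w1_def)
      have "prefix v1 (\<alpha> @ rep m')" using v(1) by simp
      moreover have "\<not> prefix v1 \<alpha>"
      proof
        assume "prefix v1 \<alpha>"
        then have "length v1 \<le> length \<alpha>" by (rule prefix_length_le)
        moreover have "length \<alpha> + C \<le> length v1" using length_shuffles[OF v(3)] by (simp add: w1_def cC_def)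
        ultimately show False using C1 by simp
      qed
      ultimately obtain p where "v1 = \<alpha> @ p" "prefix p (rep m')" by (auto simp: prefix_append)
      with bound big show False by fastforce
    qed
    have "Z2 = []"
    proof (rule middle_rigid[OF sp2(3)[unfolded rep_def]])
      show "excess F U1 + excess F Z1 = excess F s" using excess_shuffles[OF sp1(3), of F] ex\<alpha> by simp
      show "Z1 @ Z2 @ Z3 \<in> shuffle_power F k" using z zz by simp
      show "0 < excess F (U1 @ p)" if "prefix p U2" for p
      proof (rule pos_u)
        show "prefix (U1 @ p) (u m)" using that unfolding uu by (simp add: prefix_append)
        show "U1 @ p \<noteq> []" using U1 by simp
        show "U1 @ p \<noteq> u m" using prefix_length_le[OF that] U3 unfolding uu by auto
      qed
    qed
    then have "U2 = rep m'" using sp2(3) by simp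
    then have "length U2 = m' * length F" using length_rep by simp
    then show ?thesis unfolding uu by simp
  qed
  \<comment> \<open>With this spacing \<open>u (l * D)\<close> is shorter than
    \<open>Suc l * D\<close> copies of \<open>\<beta>\<close>.\<close>
  define D where "D = length \<alpha> + length \<gamma> + 1"
  define f where "f l = u (l * D)" for l
  have "\<not> derives {F} (f l) (f l')" if "l < l'" for l l'
  proof
    assume "derives {F} (f l) (f l')"
    then obtain k z where "z \<in> shuffle_power F k" "u (l' * D) \<in> shuffles (u (l * D)) z"
      unfolding derives_iff f_def by blast
    from key[OF this] have le: "l' * D * length F \<le> length (u (l * D))" .
    have "length (u (l * D)) = l * D * length F + (length \<alpha> + length \<gamma>)" by (simp add: u_def length_rep)
    also have "\<dots> < l * D * length F + D" by (simp add: D_def)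
    also have "\<dots> \<le> l * D * length F + D * length F" using F s by (cases s) simp_all
    also have "\<dots> = Suc l * D * length F" by (simp add: algebra_simps)
    also have "\<dots> \<le> l' * D * length F" using that by (intro mult_le_mono1) simp
    finally show False using le by simp
  qed
  moreover have "f l \<in> lang_eps {F}" "f l \<noteq> []" for l
    using u_in s unfolding lang_eps_iff f_def by (auto simp: u_def \<alpha>_def)
  ultimately show ?thesis unfolding has_bad_sequence_def by blast
qed

end

section \<open>Choice of \<open>s\<close> and \<open>\<beta>\<close> for the two shapes of bad
  factors\<close>

lemma mult_step_le: "t < h \<Longrightarrow> int k * int t + int k \<le> int k * int h"
proof -
  assume "t < h"
  then have "int k * (int t + 1) \<le> int k * int h" by (intro mult_left_mono) simp_all
  then show ?thesis by (simp add: algebra_simps)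
qed

lemma append_replicate_neq: "c \<noteq> d \<Longrightarrow> x = p @ c # y \<Longrightarrow> x' = p @ d # y' \<Longrightarrow> x \<noteq> x'"
  by auto

text \<open>On proper nonempty prefixes the excess is least at \<open>a\<close>, with value
  \<open>h\<close>, or just before the last \<open>b\<close>, with value \<open>k\<close>. The
  smaller of the two determines \<open>s\<close>.\<close>

lemma has_bad_sequence_two_runs:
  assumes k: "2 \<le> k" and h: "2 \<le> h"
  shows "has_bad_sequence (replicate k a @ replicate h b)"
proof -
  define F where "F = replicate k a @ replicate h b"
  have ex: "excess F p = int h * int (count_list p a) - int k * int (count_list p b)" for p
    by (simp add: excess_def F_def)
  have pre: "(\<exists>t. p = replicate t a \<and> 1 \<le> t \<and> t \<le> k) \<or> (\<exists>t<h. p = replicate k a @ replicate t b)"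
    if "prefix p F" "p \<noteq> []" "p \<noteq> F" for p
  proof -
    from that(1) consider t where "p = replicate t a" "t \<le> k"
      | t where "p = replicate k a @ replicate t b" "t \<le> h"
      unfolding F_def prefix_append by (auto elim: prefix_replicateE)
    then show ?thesis
    proof cases
      case 1
      then have "1 \<le> t" using that(2) by (cases t) auto
      with 1 show ?thesis by blast
    next
      case 2
      then have "t < h" using that(3) unfolding F_def by (cases "t = h") auto
      with 2 show ?thesis by blast
    qed
  qed
  obtain k' where k': "k = Suc (Suc k')" using k by (metis add_2_eq_Suc le_Suc_ex)
  obtain h' where h': "h = Suc (Suc h')" using h by (metis add_2_eq_Suc le_Suc_ex)
  show ?thesis
  proof (cases "k \<le> h")
    case True
    define s where "s = replicate k a @ replicate (h - 1) b"
    \<comment> \<open>The final \<open>b\<close> of the open copy is read after the first letter of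
      the new one. Reading it at once would let the total excess drop to 0; reading it at the very
      end would give back \<open>F\<close>.\<close>
    define \<beta> where "\<beta> = [a] @ [b] @ (replicate (k - 1) a @ replicate (h - 1) b)"
    have exs: "excess F s = int k" by (simp add: ex s_def h' algebra_simps)
    have "has_bad_sequence F"
    proof (rule has_bad_sequence_factor[of F s "[b]" \<beta>])
      show "F = s @ [b]" by (simp add: F_def s_def h' replicate_append_same)
      show "s \<noteq> []" "[b] \<noteq> []" using k by (simp_all add: s_def)
      fix p assume "prefix p F" "p \<noteq> []" "p \<noteq> F"
      from pre[OF this] show "0 < excess F p \<and> excess F s \<le> excess F p"
      proof (elim disjE exE conjE)
        fix t assume t: "p = replicate t a" "1 \<le> t"
        have "int h * int 0 + int h \<le> int h * int t" using t(2) by (intro mult_step_le) simp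
        moreover have "excess F p = int h * int t" by (simp add: ex t)
        ultimately show ?thesis using True k unfolding exs by linarith
      next
        fix t assume t: "t < h" "p = replicate k a @ replicate t b"
        have "excess F p = int k * int h - int k * int t" by (simp add: ex t mult.commute)
        then show ?thesis using mult_step_le[OF t(1), of k] k unfolding exs by linarith
      qed
    next
      have "\<beta> \<in> shuffles ([] @ [b] @ []) ([a] @ [] @ (replicate (k - 1) a @ replicate (h - 1) b))"
        unfolding \<beta>_def by (intro append_in_shuffles) simp_all
      then show "\<beta> \<in> shuffles [b] s" by (simp add: s_def k')
      show "\<beta> \<noteq> F" by (simp add: \<beta>_def F_def k')
      fix p assume "prefix p \<beta>"
      then consider "p = []" | "p = [a]" | t where "p = [a, b] @ replicate t a"
        | t where "p = [a, b] @ replicate (k - 1) a @ replicate t b" "t \<le> h - 1"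
        unfolding \<beta>_def by (auto simp: prefix_Cons prefix_append elim!: prefix_replicateE)
      then show "0 < excess F s + excess F p"
      proof cases
        case 3
        have "excess F s + excess F p = int h + int h * int t" unfolding exs by (simp add: ex 3 algebra_simps)
        moreover have "0 \<le> int h * int t" by simp
        ultimately show ?thesis using h by linarith
      next
        case 4
        have "excess F s + excess F p = int k * int h - int k * int t"
          unfolding exs by (simp add: ex 4 k' algebra_simps)
        then show ?thesis using mult_step_le[of t h k] 4(2) k h by linarith
      qed (use k exs in \<open>simp_all add: ex\<close>)
    qed
    then show ?thesis by (simp add: F_def)
  next
    case False
    \<comment> \<open>The first \<open>a\<close> of the new copy is delayed until the open copy has
      read one \<open>b\<close>. The excess there is \<open>k * h - k\<close>, positive because
      \<open>h \<ge> 2\<close>.\<close>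
    define \<beta> where "\<beta> = replicate (k - 1) a @ [b] @ [a] @ replicate (h - 1) b"
    have exs: "excess F [a] = int h" by (simp add: ex)
    have "has_bad_sequence F"
    proof (rule has_bad_sequence_factor[of F "[a]" "replicate (k - 1) a @ replicate h b" \<beta>])
      show "F = [a] @ replicate (k - 1) a @ replicate h b" by (simp add: F_def k')
      show "[a] \<noteq> []" "replicate (k - 1) a @ replicate h b \<noteq> []" using h by simp_all
      fix p assume "prefix p F" "p \<noteq> []" "p \<noteq> F"
      from pre[OF this] show "0 < excess F p \<and> excess F [a] \<le> excess F p"
      proof (elim disjE exE conjE)
        fix t assume t: "p = replicate t a" "1 \<le> t"
        have "int h * int 0 + int h \<le> int h * int t" using t(2) by (intro mult_step_le) simp
        moreover have "excess F p = int h * int t" by (simp add: ex t)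
        ultimately show ?thesis using h unfolding exs by linarith
      next
        fix t assume t: "t < h" "p = replicate k a @ replicate t b"
        have "excess F p = int k * int h - int k * int t" by (simp add: ex t mult.commute)
        then show ?thesis using mult_step_le[OF t(1), of k] k False unfolding exs by linarith
      qed
    next
      have "\<beta> \<in> shuffles (replicate (k - 1) a @ [b] @ [] @ replicate (h - 1) b) ([] @ [] @ [a] @ [])"
        unfolding \<beta>_def by (intro append_in_shuffles) simp_all
      then show "\<beta> \<in> shuffles (replicate (k - 1) a @ replicate h b) [a]" by (simp add: h')
      show "\<beta> \<noteq> F"
      proof (rule append_replicate_neq[of b a _ "replicate (k - 1) a"])
        show "F = replicate (k - 1) a @ a # replicate h b"
          by (simp add: F_def k' replicate_app_Cons_same)
      qed (simp_all add: \<beta>_def)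
      fix p assume "prefix p \<beta>"
      then consider t where "p = replicate t a" | "p = replicate (k - 1) a @ [b]"
        | t where "p = replicate (k - 1) a @ [b, a] @ replicate t b" "t \<le> h - 1"
        unfolding \<beta>_def by (auto simp: prefix_Cons prefix_append elim!: prefix_replicateE)
      then show "0 < excess F [a] + excess F p"
      proof cases
        case 1
        have "0 \<le> int h * int t" by simp
        moreover have "excess F p = int h * int t" by (simp add: ex 1)
        ultimately show ?thesis using h unfolding exs by linarith
      next
        case 2
        have "excess F [a] + excess F p = int k * int h - int k * int 1"
          unfolding exs by (simp add: ex 2 k' algebra_simps)
        then show ?thesis using mult_step_le[of 1 h k] k h by linarith
      next
        case 3
        have "excess F [a] + excess F p = int h + int k * int h - int k * int t - int k"
          unfolding exs by (simp add: ex 3 k' algebra_simps)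
        then show ?thesis using mult_step_le[of t h k] 3(2) h by linarith
      qed
    qed
    then show ?thesis by (simp add: F_def)
  qed
qed

text \<open>The candidates for the least excess are \<open>m + 1\<close> at \<open>a\<close>,
  \<open>m * k - l\<close> after the first run and its \<open>b\<close>, and \<open>k + l\<close>
  before the last \<open>b\<close>. The second is positive because \<open>k > l\<close>. Whichever
  is least determines \<open>s\<close>.\<close>

lemma has_bad_sequence_four_runs:
  assumes kl: "l < k" and l: "1 \<le> l" and m: "1 \<le> m"
  shows "has_bad_sequence (replicate k a @ [b] @ replicate l a @ replicate m b)"
proof -
  define F where "F = replicate k a @ [b] @ replicate l a @ replicate m b"
  have ex: "excess F p = (int m + 1) * int (count_list p a) - (int k + int l) * int (count_list p b)" for p
    by (simp add: excess_def F_def algebra_simps)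
  have mk: "int l < int m * int k"
  proof -
    have "1 * int k \<le> int m * int k" using m by (intro mult_right_mono) simp_all
    then show ?thesis using kl by linarith
  qed
  have pre: "(\<exists>t. p = replicate t a \<and> 1 \<le> t \<and> t \<le> k) \<or> (\<exists>t. p = replicate k a @ [b] @ replicate t a) \<or>
      (\<exists>t<m. p = replicate k a @ [b] @ replicate l a @ replicate t b)"
    if "prefix p F" "p \<noteq> []" "p \<noteq> F" for p
  proof -
    from that(1) consider t where "p = replicate t a" "t \<le> k"
      | t where "p = replicate k a @ [b] @ replicate t a"
      | t where "p = replicate k a @ [b] @ replicate l a @ replicate t b" "t \<le> m"
      unfolding F_def by (auto simp: prefix_append prefix_Cons elim!: prefix_replicateE)
    then show ?thesis
    proof cases
      case 1
      then have "1 \<le> t" using that(2) by (cases t) auto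
      with 1 show ?thesis by blast
    next
      case 2
      then show ?thesis by blast
    next
      case 3
      then have "t < m" using that(3) unfolding F_def by (cases "t = m") auto
      with 3 show ?thesis by blast
    qed
  qed
  have low: "min (int m + 1) (min (int m * int k - int l) (int k + int l)) \<le> excess F p"
    if "prefix p F" "p \<noteq> []" "p \<noteq> F" for p
    using pre[OF that]
  proof (elim disjE exE conjE)
    fix t assume t: "p = replicate t a" "1 \<le> t"
    have "int (m + 1) * int 0 + int (m + 1) \<le> int (m + 1) * int t" using t(2) by (intro mult_step_le) simp
    then show ?thesis by (simp add: ex t algebra_simps)
  next
    fix t assume t: "p = replicate k a @ [b] @ replicate t a"
    have "excess F p = int m * int k - int l + (int m + 1) * int t" by (simp add: ex t algebra_simps)
    moreover have "0 \<le> (int m + 1) * int t" by simp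
    ultimately show ?thesis by linarith
  next
    fix t assume t: "t < m" "p = replicate k a @ [b] @ replicate l a @ replicate t b"
    have "excess F p = int (k + l) * int m - int (k + l) * int t" by (simp add: ex t algebra_simps)
    with mult_step_le[OF t(1), of "k + l"] show ?thesis by linarith
  qed
  have pos: "0 < min (int m + 1) (min (int m * int k - int l) (int k + int l))" using mk l by simp
  have minimal: "0 < excess F p \<and> excess F s \<le> excess F p"
    if "excess F s = min (int m + 1) (min (int m * int k - int l) (int k + int l))"
      "prefix p F" "p \<noteq> []" "p \<noteq> F" for p s
    using low[OF that(2-4)] pos that(1) by linarith
  have "2 \<le> k" using kl l by simp
  then obtain k' where k': "k = Suc (Suc k')" by (metis add_2_eq_Suc le_Suc_ex)
  consider "int m + 1 \<le> int m * int k - int l" "int m + 1 \<le> int k + int l"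
    | "int m * int k - int l \<le> int m + 1" "int m * int k - int l \<le> int k + int l"
    | "int k + int l < int m + 1" "int k + int l \<le> int m * int k - int l" by linarith
  then have "has_bad_sequence F"
  proof cases
    case 1
    \<comment> \<open>The first \<open>a\<close> of the new copy is delayed to the end of the second
      run of the open one, shifting one letter between the runs.\<close>
    define \<beta> where "\<beta> = replicate (k - 1) a @ [b] @ replicate (l + 1) a @ replicate m b"
    have exs: "excess F [a] = int m + 1" by (simp add: ex)
    show ?thesis
    proof (rule has_bad_sequence_factor[of F "[a]" "replicate (k - 1) a @ [b] @ replicate l a @ replicate m b" \<beta>])
      show "F = [a] @ replicate (k - 1) a @ [b] @ replicate l a @ replicate m b" by (simp add: F_def k')
      show "0 < excess F p \<and> excess F [a] \<le> excess F p" if "prefix p F" "p \<noteq> []" "p \<noteq> F" for p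
        using 1 by (intro minimal that) (simp add: exs)
      have "replicate (k - 1) a @ [b] @ replicate l a @ [a] @ replicate m b \<in>
          shuffles (replicate (k - 1) a @ [b] @ replicate l a @ [] @ replicate m b) ([] @ [] @ [] @ [a] @ [])"
        by (intro append_in_shuffles) simp_all
      then have "\<beta> \<in> shuffles (replicate (k - 1) a @ [b] @ replicate l a @ [] @ replicate m b) ([] @ [] @ [] @ [a] @ [])"
        by (simp only: \<beta>_def replicate_add append_assoc replicate_Suc replicate_0 One_nat_def)
      then show "\<beta> \<in> shuffles (replicate (k - 1) a @ [b] @ replicate l a @ replicate m b) [a]" by simp
      show "\<beta> \<noteq> F"
      proof (rule append_replicate_neq[of b a _ "replicate (k - 1) a"])
        show "F = replicate (k - 1) a @ a # [b] @ replicate l a @ replicate m b"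
          by (simp add: F_def k' replicate_app_Cons_same)
      qed (simp_all add: \<beta>_def)
      fix p assume "prefix p \<beta>"
      then consider t where "p = replicate t a" | t where "p = replicate (k - 1) a @ [b] @ replicate t a"
        | t where "p = replicate (k - 1) a @ [b] @ replicate (l + 1) a @ replicate t b" "t \<le> m"
        unfolding \<beta>_def
        by (auto simp: prefix_Cons prefix_append simp del: replicate_Suc add_Suc_right elim!: prefix_replicateE)
      then show "0 < excess F [a] + excess F p"
      proof cases
        case 1
        have "0 \<le> (int m + 1) * int t" by simp
        moreover have "excess F p = (int m + 1) * int t" by (simp add: ex 1)
        ultimately show ?thesis unfolding exs by linarith
      next
        case 2
        have "excess F [a] + excess F p = int m * int k - int l + (int m + 1) * int t"
          unfolding exs by (simp add: ex 2 k' algebra_simps)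
        moreover have "0 \<le> (int m + 1) * int t" by simp
        ultimately show ?thesis using mk by linarith
      next
        case 3
        have "excess F [a] + excess F p = int m + 1 + ((int k + int l) * int m - (int k + int l) * int t)"
          unfolding exs by (simp add: ex 3 k' algebra_simps)
        moreover have "(int k + int l) * int t \<le> (int k + int l) * int m" using 3(2) by (intro mult_left_mono) simp_all
        ultimately show ?thesis by linarith
      qed
    qed simp_all
  next
    case 2
    define s where "s = replicate k a @ [b]"
    \<comment> \<open>The open copy reads its second run, then the new one its first run and
      \<open>b\<close>, and finally the open one its last run; two runs merge, so this is not
      \<open>F\<close>.\<close>
    define \<beta> where "\<beta> = replicate (l + k) a @ replicate (Suc m) b"
    have exs: "excess F s = int m * int k - int l" by (simp add: ex s_def algebra_simps)
    show ?thesis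
    proof (rule has_bad_sequence_factor[of F s "replicate l a @ replicate m b" \<beta>])
      show "F = s @ replicate l a @ replicate m b" by (simp add: F_def s_def)
      show "s \<noteq> []" "replicate l a @ replicate m b \<noteq> []" using l by (simp_all add: s_def)
      show "0 < excess F p \<and> excess F s \<le> excess F p" if "prefix p F" "p \<noteq> []" "p \<noteq> F" for p
        using 2 by (intro minimal that) (simp add: exs)
      have "replicate l a @ replicate k a @ [b] @ replicate m b \<in>
          shuffles (replicate l a @ [] @ [] @ replicate m b) ([] @ replicate k a @ [b] @ [])"
        by (intro append_in_shuffles) simp_all
      then show "\<beta> \<in> shuffles (replicate l a @ replicate m b) s" by (simp add: \<beta>_def s_def replicate_add)
      show "\<beta> \<noteq> F"
      proof (rule append_replicate_neq[of a b _ "replicate k a"])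
        obtain l' where "l = Suc l'" using l by (cases l) auto
        then show "\<beta> = replicate k a @ a # replicate (l - 1) a @ replicate (Suc m) b"
          by (simp add: \<beta>_def add.commute[of _ k] replicate_add replicate_append_same)
      qed (simp_all add: F_def)
      fix p assume "prefix p \<beta>"
      then consider t where "p = replicate t a" | t where "p = replicate (l + k) a @ replicate t b" "t \<le> Suc m"
        unfolding \<beta>_def prefix_append by (auto simp del: replicate_Suc elim: prefix_replicateE)
      then show "0 < excess F s + excess F p"
      proof cases
        case 1
        have "0 \<le> (int m + 1) * int t" by simp
        moreover have "excess F p = (int m + 1) * int t" by (simp add: ex 1)
        ultimately show ?thesis using mk unfolding exs by linarith
      next
        case 2
        have "(int k + int l) * int t \<le> (int k + int l) * int (Suc m)" using 2(2) by (intro mult_left_mono) simp_all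
        moreover have "excess F p = (int k + int l) * int (Suc m) - (int k + int l) * int t"
          by (simp add: ex 2 algebra_simps)
        ultimately show ?thesis using mk unfolding exs by linarith
      qed
    qed
  next
    case 3
    have m2: "2 \<le> m" using 3(1) kl l by linarith
    define s where "s = replicate k a @ [b] @ replicate l a @ replicate (m - 1) b"
    \<comment> \<open>As for two runs, the final \<open>b\<close> of the open copy is read after the
      first letter of the new one.\<close>
    define \<beta> where "\<beta> = [a] @ [b] @ (replicate (k - 1) a @ [b] @ replicate l a @ replicate (m - 1) b)"
    obtain m' where m': "m = Suc m'" using m by (cases m) auto
    have exs: "excess F s = int k + int l" by (simp add: ex s_def m' algebra_simps)
    show ?thesis
    proof (rule has_bad_sequence_factor[of F s "[b]" \<beta>])
      show "F = s @ [b]" by (simp add: F_def s_def m' replicate_append_same)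
      show "s \<noteq> []" "[b] \<noteq> []" by (simp_all add: s_def)
      show "0 < excess F p \<and> excess F s \<le> excess F p" if "prefix p F" "p \<noteq> []" "p \<noteq> F" for p
        using 3 by (intro minimal that) (simp add: exs)
      have "\<beta> \<in> shuffles ([] @ [b] @ []) ([a] @ [] @ (replicate (k - 1) a @ [b] @ replicate l a @ replicate (m - 1) b))"
        unfolding \<beta>_def by (intro append_in_shuffles) simp_all
      then show "\<beta> \<in> shuffles [b] s" by (simp add: s_def k')
      show "\<beta> \<noteq> F" by (simp add: \<beta>_def F_def k')
      fix p assume "prefix p \<beta>"
      then consider "p = []" | "p = [a]" | t where "p = [a, b] @ replicate t a"
        | t where "p = [a, b] @ replicate (k - 1) a @ [b] @ replicate t a"
        | t where "p = [a, b] @ replicate (k - 1) a @ [b] @ replicate l a @ replicate t b" "t \<le> m - 1"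
        unfolding \<beta>_def by (auto simp: prefix_Cons prefix_append elim!: prefix_replicateE)
      then show "0 < excess F s + excess F p"
      proof cases
        case 3
        have "excess F s + excess F p = int m + 1 + (int m + 1) * int t"
          unfolding exs by (simp add: ex 3 algebra_simps)
        moreover have "0 \<le> (int m + 1) * int t" by simp
        ultimately show ?thesis by linarith
      next
        case 4
        have "excess F s + excess F p = int m * int k - int l + (int m + 1) * int t"
          unfolding exs by (simp add: ex 4 k' algebra_simps)
        moreover have "0 \<le> (int m + 1) * int t" by simp
        ultimately show ?thesis using mk by linarith
      next
        case 5
        have "excess F s + excess F p = int (k + l) * int m - int (k + l) * int t"
          unfolding exs by (simp add: ex 5 k' algebra_simps)
        then show ?thesis using mult_step_le[of t m "k + l"] 5(2) m l by linarith
      qed (use l exs in \<open>simp_all add: ex\<close>)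
    qed
  qed
  then show ?thesis by (simp add: F_def)
qed

lemma split_trailing_run:
  obtains r x where "p = x @ replicate r c" "x = [] \<or> last x \<noteq> c"
proof (induction p arbitrary: thesis rule: rev_induct)
  case Nil
  show ?case by (rule Nil[of "[]" 0]) simp_all
next
  case (snoc d p)
  show ?case
  proof (cases "d = c")
    case True
    obtain r x where "p = x @ replicate r c" "x = [] \<or> last x \<noteq> c" using snoc.IH by blast
    then show ?thesis using True by (intro snoc.prems[of x "Suc r"]) (simp_all add: replicate_append_same)
  next
    case False
    then show ?thesis by (intro snoc.prems[of "p @ [d]" 0]) simp_all
  qed
qed

lemma split_leading_run:
  obtains r y where "q = replicate r c @ y" "y = [] \<or> hd y \<noteq> c"
proof -
  obtain r x where "rev q = x @ replicate r c" "x = [] \<or> last x \<noteq> c" by (rule split_trailing_run)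
  then have "q = replicate r c @ rev x" "rev x = [] \<or> hd (rev x) \<noteq> c"
    by (metis rev_append rev_replicate rev_rev_ident) (use \<open>x = [] \<or> last x \<noteq> c\<close> in \<open>auto simp: hd_rev\<close>)
  then show thesis by (rule that)
qed

text \<open>Lengthening the outer runs to maximal ones preserves \<open>k, h \<ge> 2\<close> and
  \<open>k > l\<close>, respectively, and maximality supplies the seam conditions of
  \<open>has_bad_sequence_extend\<close>.\<close>

lemma has_bad_sequence_bad_factor:
  assumes "has_bad_factor w"
  shows "has_bad_sequence w"
proof -
  from assms consider k h where "k \<ge> 2" "h \<ge> 2" "sublist (replicate k a @ replicate h b) w"
    | k l m where "k > l" "l \<ge> 1" "m \<ge> 1" "sublist (replicate k a @ [b] @ replicate l a @ replicate m b) w"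
    unfolding has_bad_factor_def by blast
  then show ?thesis
  proof cases
    case 1
    then obtain p q where w: "w = p @ (replicate k a @ replicate h b) @ q" by (auto simp: sublist_def)
    obtain r x where x: "p = x @ replicate r a" "x = [] \<or> last x \<noteq> a" by (rule split_trailing_run)
    obtain t y where y: "q = replicate t b @ y" "y = [] \<or> hd y \<noteq> b" by (rule split_leading_run)
    have "w = x @ (replicate (r + k) a @ replicate (h + t) b) @ y" by (simp add: w x y replicate_add)
    moreover have "has_bad_sequence (x @ (replicate (r + k) a @ replicate (h + t) b) @ y)"
    proof (rule has_bad_sequence_extend)
      show "has_bad_sequence (replicate (r + k) a @ replicate (h + t) b)"
        using 1 by (intro has_bad_sequence_two_runs) simp_all
    qed (use 1 x y in \<open>auto simp: hd_append last_append\<close>)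
    ultimately show ?thesis by simp
  next
    case 2
    then obtain p q where w: "w = p @ (replicate k a @ [b] @ replicate l a @ replicate m b) @ q"
      by (auto simp: sublist_def)
    obtain r x where x: "p = x @ replicate r a" "x = [] \<or> last x \<noteq> a" by (rule split_trailing_run)
    obtain t y where y: "q = replicate t b @ y" "y = [] \<or> hd y \<noteq> b" by (rule split_leading_run)
    have "w = x @ (replicate (r + k) a @ [b] @ replicate l a @ replicate (m + t) b) @ y"
      by (simp add: w x y replicate_add)
    moreover have "has_bad_sequence (x @ (replicate (r + k) a @ [b] @ replicate l a @ replicate (m + t) b) @ y)"
    proof (rule has_bad_sequence_extend)
      show "has_bad_sequence (replicate (r + k) a @ [b] @ replicate l a @ replicate (m + t) b)"
        using 2 by (intro has_bad_sequence_four_runs) simp_all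
    qed (use 2 x y in \<open>auto simp: hd_append last_append\<close>)
    ultimately show ?thesis by simp
  qed
qed

lemma not_wqo_if_bad:
  assumes "bad w"
  shows "\<not> wqo_on (derives {w}) (lang_eps {w})"
proof
  assume wqo: "wqo_on (derives {w}) (lang_eps {w})"
  have "\<not> has_bad_factor v" if "wqo_on (derives {v}) (lang_eps {v})" for v
    using that has_bad_sequence_bad_factor not_wqo_if_bad_sequence by blast
  from this[OF wqo] this[OF wqo_on_derives_rev[OF wqo]] this[OF wqo_on_derives_E[OF wqo]]
    this[OF wqo_on_derives_E[OF wqo_on_derives_rev[OF wqo]]] assms
  show False unfolding bad_def by blast
qed

theorem theorem1:
  fixes w :: "letter list"
  shows "wqo_on (derives {w}) (lang_eps {w}) \<longleftrightarrow> good w"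
  using wqo_on_good not_wqo_if_bad by (auto simp: good_def)

end
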